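(* Let $\mathbb{K}$ be an algebraically closed field of characteristic zero. Fix $m\ge 1$ and positive integers $k_1,\ldots,k_m$, and let $d=\gcd(k_1,\ldots,k_m)$. (i) If $d=1$, then for every rigid affine variety $X$ over $\mathbb{K}$ and every non-constant regular function $f\in\mathbb{K}[X]$, the variety $W=\mathrm{Susp}(X,f,k_1,\ldots,k_m)$ is also rigid. (ii) If $d>1$, then there exist a rigid affine variety $X$ over $\mathbb{K}$ and a non-constant regular function $f\in\mathbb{K}[X]$ such that $W=\mathrm{Susp}(X,f,k_1,\ldots,k_m)$ is not rigid.
   Context: $X$ is an irreducible affine algebraic variety over $\mathbb{K}$ with algebra of regular functions $\mathbb{K}[X]$ (a $\mathbb{K}$-domain). A derivation of a commutative $\mathbb{K}$-algebra $A$ is a $\mathbb{K}$-linear map $\partial\colon A\to A$ with $\partial(ab)=a\partial(b)+b\partial(a)$; it is locally nilpotent (LND) if for every $a\in A$ there is $n\in\mathbb{N}$ with $\partial^n(a)=0$. An affine variety is rigid if its algebra of regular functions admits no nonzero LND (equivalently, it admits no nontrivial action of the additive group $(\mathbb{K},+)$). For a non-constant $f\in\mathbb{K}[X]$ and positive integers $k_1,\ldots,k_m$, the $m$-suspension $\mathrm{Susp}(X,f,k_1,\ldots,k_m)$ is the subvariety of $\mathbb{K}^m\times X$ cut out by $y_1^{k_1}\cdots y_m^{k_m}-f=0$, where $y_1,\ldots,y_m$ are the coordinate functions on $\mathbb{K}^m$. *)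

theory Defs
  imports "HOL-Computational_Algebra.Polynomial" "HOL-Algebra.Module"
begin

section \<open>Affine varieties\<close>

text \<open>
  Varieties are classical ones over an algebraically closed field given as a type \<open>'k\<close>: a point
  of affine \<open>n\<close>-space is a function with coordinates indexed by \<open>{..<n}\<close> and value
  \<^const>\<open>undefined\<close> elsewhere. The dimension is a natural number rather than a type, so that it can
  be quantified over.
\<close>

definition affine_space :: "nat \<Rightarrow> (nat \<Rightarrow> 'k) set" where
  "affine_space n = {..<n} \<rightarrow>\<^sub>E UNIV"

text \<open>Polynomial functions in the first \<open>n\<close> coordinates.\<close>

inductive_set poly_funs :: "nat \<Rightarrow> ((nat \<Rightarrow> 'k :: field) \<Rightarrow> 'k) set" for n :: nat where
  const: "(\<lambda>x. c) \<in> poly_funs n"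
| coord: "i < n \<Longrightarrow> (\<lambda>x. x i) \<in> poly_funs n"
| add: "p \<in> poly_funs n \<Longrightarrow> q \<in> poly_funs n \<Longrightarrow> (\<lambda>x. p x + q x) \<in> poly_funs n"
| mult: "p \<in> poly_funs n \<Longrightarrow> q \<in> poly_funs n \<Longrightarrow> (\<lambda>x. p x * q x) \<in> poly_funs n"

definition algebraic_set :: "nat \<Rightarrow> (nat \<Rightarrow> 'k :: field) set \<Rightarrow> bool" where
  "algebraic_set n X \<longleftrightarrow>
     (\<exists>S \<subseteq> poly_funs n. X = {x \<in> affine_space n. \<forall>p\<in>S. p x = 0})"

definition affine_variety :: "nat \<Rightarrow> (nat \<Rightarrow> 'k :: field) set \<Rightarrow> bool" where
  "affine_variety n X \<longleftrightarrow>
     algebraic_set n X \<and> X \<noteq> {} \<and>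
     (\<forall>Y Z. algebraic_set n Y \<and> algebraic_set n Z \<and> X = Y \<union> Z \<longrightarrow> X = Y \<or> X = Z)"

text \<open>
  The \<open>'k\<close>-algebra of regular functions on \<open>X\<close>, with pointwise operations. Its elements are
  undefined off \<open>X\<close>, so that two polynomials that agree on \<open>X\<close> give the same element.
\<close>

definition coord_algebra ::
  "nat \<Rightarrow> (nat \<Rightarrow> 'k :: field) set \<Rightarrow> ('k, (nat \<Rightarrow> 'k) \<Rightarrow> 'k) module" where
  "coord_algebra n X =
     \<lparr>carrier = {restrict p X |p. p \<in> poly_funs n},
      mult = (\<lambda>f g. \<lambda>x\<in>X. f x * g x),
      one = (\<lambda>x\<in>X. 1),
      zero = (\<lambda>x\<in>X. 0),
      add = (\<lambda>f g. \<lambda>x\<in>X. f x + g x),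
      smult = (\<lambda>c f. \<lambda>x\<in>X. c * f x)\<rparr>"

definition nonconstant_on :: "'a set \<Rightarrow> ('a \<Rightarrow> 'b) \<Rightarrow> bool" where
  "nonconstant_on X f \<longleftrightarrow> \<not> (\<exists>c. \<forall>x\<in>X. f x = c)"


section \<open>Locally nilpotent derivations and rigidity\<close>

text \<open>
  The ground field is the whole type \<open>'k\<close>. As usual with explicit carriers, the behaviour of a
  derivation outside the carrier is irrelevant.
\<close>

definition derivation :: "('k, 'a) module \<Rightarrow> ('a \<Rightarrow> 'a) \<Rightarrow> bool" where
  "derivation A D \<longleftrightarrow>
     D \<in> carrier A \<rightarrow> carrier A \<and>
     (\<forall>a\<in>carrier A. \<forall>b\<in>carrier A. D (a \<oplus>\<^bsub>A\<^esub> b) = D a \<oplus>\<^bsub>A\<^esub> D b) \<and>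
     (\<forall>c. \<forall>a\<in>carrier A. D (c \<odot>\<^bsub>A\<^esub> a) = c \<odot>\<^bsub>A\<^esub> D a) \<and>
     (\<forall>a\<in>carrier A. \<forall>b\<in>carrier A.
        D (a \<otimes>\<^bsub>A\<^esub> b) = (a \<otimes>\<^bsub>A\<^esub> D b) \<oplus>\<^bsub>A\<^esub> (b \<otimes>\<^bsub>A\<^esub> D a))"

definition locally_nilpotent :: "('k, 'a) module \<Rightarrow> ('a \<Rightarrow> 'a) \<Rightarrow> bool" where
  "locally_nilpotent A D \<longleftrightarrow> (\<forall>a\<in>carrier A. \<exists>n::nat. (D ^^ n) a = \<zero>\<^bsub>A\<^esub>)"

definition rigid :: "nat \<Rightarrow> (nat \<Rightarrow> 'k :: field) set \<Rightarrow> bool" where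
  "rigid n X \<longleftrightarrow>
     \<not> (\<exists>D. derivation (coord_algebra n X) D \<and> locally_nilpotent (coord_algebra n X) D \<and>
          (\<exists>a\<in>carrier (coord_algebra n X). D a \<noteq> \<zero>\<^bsub>coord_algebra n X\<^esub>))"


section \<open>Suspensions\<close>

text \<open>
  For \<open>X\<close> in affine \<open>n\<close>-space, the product of affine \<open>m\<close>-space with \<open>X\<close> is realised in affine
  \<open>(m + n)\<close>-space: the coordinates \<open>y\<^sub>1, \<dots>, y\<^sub>m\<close> have the indices \<open>0, \<dots>, m - 1\<close>, and dropping them
  leaves a point of affine \<open>n\<close>-space.
\<close>

definition susp ::
  "nat \<Rightarrow> (nat \<Rightarrow> 'k :: field) set \<Rightarrow> ((nat \<Rightarrow> 'k) \<Rightarrow> 'k) \<Rightarrow> nat \<Rightarrow> (nat \<Rightarrow> nat) \<Rightarrow> (nat \<Rightarrow> 'k) set"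
  where
  "susp n X f m k =
     {w \<in> affine_space (m + n). (\<lambda>i. w (m + i)) \<in> X \<and>
        (\<Prod>i<m. w i ^ k i) - f (\<lambda>i. w (m + i)) = 0}"

end

theory Submission
  imports Defs "HOL-Library.Function_Algebras"
begin

text \<open>
  Part (i). Let \<open>D\<close> be a locally nilpotent derivation of \<open>K[W]\<close>. The torus \<open>y\<^sup>k = 1\<close> acts on \<open>W\<close>, and for
  \<open>d = 1\<close> the group of its weights is torsion-free, so the top component of \<open>D\<close> for a generic
  weight is again locally nilpotent and maps \<open>K[X]\<close> into \<open>K[X] y\<^sup>e\<close> for a single monomial \<open>y\<^sup>e\<close>. Dividing
  by \<open>y\<^sup>e\<close> gives a derivation of \<open>K[X]\<close> that lowers the degree function of the top component; it is locally
  nilpotent, hence zero. The top component then kills \<open>f = y\<^sup>k\<close>, hence every \<open>y\<^sub>i\<close>, and is zero.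

  Part (ii). Let \<open>N\<^sub>u(x)\<close> be the norm form in \<open>d\<close> variables of the extension by \<open>u\<^bsup>1/d\<^esup>\<close>, let \<open>X\<close> be the complement of
  \<open>u v (N\<^sub>u(x) - v z\<^sup>d) = 0\<close> in the affine space with coordinates \<open>u, v, z, x\<close>, and \<open>f = u\<close>. A locally nilpotent
  derivation kills the units \<open>u\<close>, \<open>v\<close> and \<open>N\<^sub>u(x) - v z\<^sup>d\<close>, so the leading coefficients of \<open>x\<close> and \<open>z\<close> along its
  flow solve \<open>N\<^sub>u(a) = v b\<^sup>d\<close>; this equation has only the trivial solution, and \<open>X\<close> is rigid. On the suspension
  \<open>u\<close> has a \<open>d\<close>-th root, the norm form splits into linear factors, and moving one factor against \<open>z\<close> is a
  nontrivial action of the additive group.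
\<close>

section \<open>Locally nilpotent derivations\<close>

text \<open>If a - b is a multiple of k, then in K[W] one of y^a and y^b is a power of f times the
  other. So once weights separate the classes modulo k that occur, a homogeneous element is a single
  term g y^e with g in K[X]. Weights see exponents only modulo torsion: for d > 1 the monomial
  y^(k/d) has weight 0, but it is a d-th root of f, which K[X] may lack. One integer weight
  separates only finitely many classes, so it has to be chosen after D, from the exponents in the
  images of the generators. The same argument shows that K[W] is a domain, on which the degree
  function of D depends.

  Part (ii) is built around this root. Units are created because every locally nilpotent derivation
  kills them; this keeps u and v fixed in the equation for the leading coefficients. The parameter v
  rules out nontrivial solutions, since the two sides have different degrees in v modulo d. The norm
  form is used because a d-th root of u is all it takes to split off a linear factor.\<close>

locale subalgebra =
  fixes B C :: "'b::comm_ring_1 set"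
  assumes zero_mem: "0 \<in> B"
    and add_mem: "a \<in> B \<Longrightarrow> b \<in> B \<Longrightarrow> a + b \<in> B"
    and mult_mem: "a \<in> B \<Longrightarrow> b \<in> B \<Longrightarrow> a * b \<in> B"
    and scal_mem: "c \<in> C \<Longrightarrow> b \<in> B \<Longrightarrow> c * b \<in> B"
    and of_int_scal: "of_int i \<in> C"
begin

lemma uminus_mem: "b \<in> B \<Longrightarrow> - b \<in> B"
  using scal_mem[OF of_int_scal[of "-1"]] by simp

lemma diff_mem: "a \<in> B \<Longrightarrow> b \<in> B \<Longrightarrow> a - b \<in> B"
  using add_mem[OF _ uminus_mem] by fastforce

lemma of_nat_mem: "b \<in> B \<Longrightarrow> of_nat n * b \<in> B"
  using scal_mem[OF of_int_scal[of "int n"]] by simp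

lemma sum_mem: "(\<And>i. i \<in> I \<Longrightarrow> g i \<in> B) \<Longrightarrow> sum g I \<in> B"
  by (induction I rule: infinite_finite_induct) (auto simp: zero_mem add_mem)

end

text \<open>B will consist of functions extended by zero outside a variety, so its unit is an
  indicator function and not the 1 of the ambient ring. Hence characteristic zero is phrased as
  absence of torsion.\<close>

locale algebra_domain = subalgebra +
  assumes no_zero_div: "a \<in> B \<Longrightarrow> b \<in> B \<Longrightarrow> a * b = 0 \<Longrightarrow> a = 0 \<or> b = 0"
    and char_0: "b \<in> B \<Longrightarrow> of_nat (Suc n) * b = 0 \<Longrightarrow> b = 0"

locale lnd = subalgebra +
  fixes D :: "'a::comm_ring_1 \<Rightarrow> 'a"
  assumes D_mem: "b \<in> B \<Longrightarrow> D b \<in> B"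
    and D_add: "a \<in> B \<Longrightarrow> b \<in> B \<Longrightarrow> D (a + b) = D a + D b"
    and D_scal: "c \<in> C \<Longrightarrow> b \<in> B \<Longrightarrow> D (c * b) = c * D b"
    and D_mult: "a \<in> B \<Longrightarrow> b \<in> B \<Longrightarrow> D (a * b) = a * D b + b * D a"
    and D_nilpotent: "b \<in> B \<Longrightarrow> \<exists>n. (D ^^ n) b = 0"
begin

lemma D_zero [simp]: "D 0 = 0"
  using D_add[OF zero_mem zero_mem] by simp

lemma funpow_zero [simp]: "(D ^^ n) 0 = 0"
  by (induction n) auto

lemma funpow_mem: "b \<in> B \<Longrightarrow> (D ^^ n) b \<in> B"
  by (induction n) (auto simp: D_mem)

lemma D_sum: "(\<And>i. i \<in> I \<Longrightarrow> g i \<in> B) \<Longrightarrow> D (sum g I) = (\<Sum>i\<in>I. D (g i))"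
proof (induction I rule: infinite_finite_induct)
  case (insert x F)
  then show ?case using D_add[of "g x" "sum g F"] sum_mem[of F g] by auto
qed auto

lemma D_of_nat: "b \<in> B \<Longrightarrow> D (of_nat n * b) = of_nat n * D b"
  using D_scal[OF of_int_scal[of "int n"]] by simp

lemma funpow_add_distrib: "a \<in> B \<Longrightarrow> b \<in> B \<Longrightarrow> (D ^^ n) (a + b) = (D ^^ n) a + (D ^^ n) b"
  by (induction n) (auto simp: D_add funpow_mem)

lemma funpow_scal: "c \<in> C \<Longrightarrow> b \<in> B \<Longrightarrow> (D ^^ n) (c * b) = c * (D ^^ n) b"
  by (induction n) (auto simp: D_scal funpow_mem)

lemma funpow_eq_0_mono: "(D ^^ n) b = 0 \<Longrightarrow> n \<le> k \<Longrightarrow> (D ^^ k) b = 0"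
  using funpow_add[of "k - n" n D] by simp

lemma Leibniz:
  assumes a: "a \<in> B" and b: "b \<in> B"
  shows "(D ^^ n) (a * b) = (\<Sum>i\<le>n. of_nat (n choose i) * ((D ^^ i) a * (D ^^ (n - i)) b))"
proof (induction n)
  case (Suc n)
  let ?t = "\<lambda>i j. (D ^^ i) a * (D ^^ j) b"
  have mem: "?t i j \<in> B" for i j
    by (intro mult_mem funpow_mem a b)
  have Dt: "D (?t i j) = ?t i (Suc j) + ?t (Suc i) j" for i j
    by (simp add: D_mult funpow_mem a b mult.commute)
  have "(D ^^ Suc n) (a * b) = (\<Sum>i\<le>n. of_nat (n choose i) * D (?t i (n - i)))"
    using Suc by (simp add: D_sum of_nat_mem mem D_of_nat)
  also have "\<dots> = (\<Sum>i\<le>n. of_nat (n choose i) * ?t i (Suc n - i))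
      + (\<Sum>i\<le>n. of_nat (n choose i) * ?t (Suc i) (n - i))"
    by (simp add: Dt algebra_simps sum.distrib Suc_diff_le)
  also have "(\<Sum>i\<le>n. of_nat (n choose i) * ?t i (Suc n - i))
      = ?t 0 (Suc n) + (\<Sum>i\<le>n. of_nat (n choose Suc i) * ?t (Suc i) (n - i))"
  proof -
    have "(\<Sum>i\<le>n. of_nat (n choose i) * ?t i (Suc n - i))
        = (\<Sum>i\<le>Suc n. of_nat (n choose i) * ?t i (Suc n - i))"
      by (simp add: binomial_eq_0)
    also have "\<dots> = ?t 0 (Suc n) + (\<Sum>i\<le>n. of_nat (n choose Suc i) * ?t (Suc i) (n - i))"
      by (subst sum.atMost_Suc_shift) simp
    finally show ?thesis .
  qed
  also have "?t 0 (Suc n) + (\<Sum>i\<le>n. of_nat (n choose Suc i) * ?t (Suc i) (n - i))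
      + (\<Sum>i\<le>n. of_nat (n choose i) * ?t (Suc i) (n - i))
      = ?t 0 (Suc n) + (\<Sum>i\<le>n. of_nat (Suc n choose Suc i) * ?t (Suc i) (n - i))"
    by (simp add: algebra_simps sum.distrib)
  also have "\<dots> = (\<Sum>i\<le>Suc n. of_nat (Suc n choose i) * ?t i (Suc n - i))"
    by (subst sum.atMost_Suc_shift) simp
  finally show ?case .
qed simp

text \<open>One more than the usual degree function of D. The shift gives 0 the value 0 instead of
  minus infinity.\<close>

definition nil_index :: "'a \<Rightarrow> nat" where
  "nil_index b = (LEAST n. (D ^^ n) b = 0)"

lemma funpow_nil_index: "b \<in> B \<Longrightarrow> (D ^^ nil_index b) b = 0"
  unfolding nil_index_def using D_nilpotent by (rule LeastI_ex)

lemma funpow_eq_0_iff: "b \<in> B \<Longrightarrow> (D ^^ n) b = 0 \<longleftrightarrow> nil_index b \<le> n"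
  using funpow_nil_index[of b] funpow_eq_0_mono[of "nil_index b" b n] Least_le[of "\<lambda>n. (D ^^ n) b = 0" n]
  by (auto simp: nil_index_def)

lemma nil_index_0 [simp]: "nil_index 0 = 0"
  using funpow_eq_0_iff[OF zero_mem, of 0] by simp

lemma nil_index_eq_0_iff: "b \<in> B \<Longrightarrow> nil_index b = 0 \<longleftrightarrow> b = 0"
  using funpow_eq_0_iff[of b 0] by simp

lemma nil_index_D: "b \<in> B \<Longrightarrow> nil_index (D b) = nil_index b - 1"
proof -
  assume b: "b \<in> B"
  have "nil_index (D b) \<le> n \<longleftrightarrow> nil_index b \<le> Suc n" for n
    using funpow_eq_0_iff[OF D_mem[OF b], of n] funpow_eq_0_iff[OF b, of "Suc n"]
    by (simp add: funpow_swap1)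
  from this[of "nil_index (D b)"] this[of "nil_index b - 1"] show ?thesis
    by linarith
qed

lemma D_eq_0_iff: "b \<in> B \<Longrightarrow> D b = 0 \<longleftrightarrow> nil_index b \<le> 1"
  using funpow_eq_0_iff[of b 1] by simp

end

locale lnd_domain = algebra_domain + lnd
begin

text \<open>For indices i + 1 and j + 1 the Leibniz formula leaves only (i + j choose i) D^i a D^j b
  in order i + j, and nothing in order i + j + 1. The surviving term is nonzero in a torsion-free
  domain. The \<open>Suc\<close> comes from the shift in \<open>nil_index\<close>.\<close>

lemma nil_index_mult:
  assumes a: "a \<in> B" "a \<noteq> 0" and b: "b \<in> B" "b \<noteq> 0"
  shows "Suc (nil_index (a * b)) = nil_index a + nil_index b"
proof -
  obtain i where i: "nil_index a = Suc i"
    using a nil_index_eq_0_iff not0_implies_Suc by blast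
  obtain j where j: "nil_index b = Suc j"
    using b nil_index_eq_0_iff not0_implies_Suc by blast
  have z: "(D ^^ r) a * (D ^^ s) b = 0" if "r > i \<or> s > j" for r s
    using that funpow_eq_0_iff[OF a(1), of r] funpow_eq_0_iff[OF b(1), of s] i j by auto
  have "(D ^^ Suc (i + j)) (a * b) = 0"
    unfolding Leibniz[OF a(1) b(1)]
  proof (intro sum.neutral ballI)
    fix r assume "r \<in> {..Suc (i + j)}"
    then have "r > i \<or> Suc (i + j) - r > j" by auto
    from z[OF this]
    show "of_nat (Suc (i + j) choose r) * ((D ^^ r) a * (D ^^ (Suc (i + j) - r)) b) = 0"
      by simp
  qed
  moreover have "(D ^^ (i + j)) (a * b) \<noteq> 0"
  proof
    assume "(D ^^ (i + j)) (a * b) = 0"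
    moreover have "(D ^^ (i + j)) (a * b) = of_nat ((i + j) choose i) * ((D ^^ i) a * (D ^^ j) b)"
      unfolding Leibniz[OF a(1) b(1)]
    proof -
      have "(\<Sum>r\<in>{..i + j} - {i}. of_nat (i + j choose r) * ((D ^^ r) a * (D ^^ (i + j - r)) b)) = 0"
      proof (intro sum.neutral ballI)
        fix r assume "r \<in> {..i + j} - {i}"
        then have "r > i \<or> i + j - r > j" by auto
        from z[OF this]
        show "of_nat (i + j choose r) * ((D ^^ r) a * (D ^^ (i + j - r)) b) = 0"
          by simp
      qed
      then show "(\<Sum>r\<le>i + j. of_nat (i + j choose r) * ((D ^^ r) a * (D ^^ (i + j - r)) b))
          = of_nat (i + j choose i) * ((D ^^ i) a * (D ^^ j) b)"
        by (subst sum.remove[of _ i]) auto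
    qed
    ultimately have "of_nat ((i + j) choose i) * ((D ^^ i) a * (D ^^ j) b) = 0" by simp
    moreover obtain c where "(i + j) choose i = Suc c"
      by (metis le_add1 zero_less_binomial gr0_implies_Suc)
    ultimately have "(D ^^ i) a * (D ^^ j) b = 0"
      using char_0 mult_mem[OF funpow_mem[OF a(1)] funpow_mem[OF b(1)]] by metis
    moreover have "(D ^^ i) a \<noteq> 0" "(D ^^ j) b \<noteq> 0"
      using funpow_eq_0_iff[OF a(1), of i] funpow_eq_0_iff[OF b(1), of j] i j by auto
    ultimately show False
      using no_zero_div[OF funpow_mem[OF a(1)] funpow_mem[OF b(1)]] by blast
  qed
  ultimately have "nil_index (a * b) = Suc (i + j)"
    using funpow_eq_0_iff[OF mult_mem[OF a(1) b(1)]] by (metis le_antisym not_less_eq_eq)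
  then show ?thesis using i j by simp
qed

text \<open>The kernel of a locally nilpotent derivation is factorially closed, because degrees add
  and are not negative. This forces factors of the unit, and the y_i as factors of f, into the
  kernel.\<close>

lemma D_eq_0_factor:
  assumes "a \<in> B" "b \<in> B" "a * b \<noteq> 0" "D (a * b) = 0"
  shows "D a = 0" "D b = 0"
proof -
  have ne: "a \<noteq> 0" "b \<noteq> 0" using assms by auto
  have "nil_index (a * b) \<le> 1" using assms D_eq_0_iff mult_mem by blast
  then have "nil_index a + nil_index b \<le> 2"
    using nil_index_mult[OF assms(1) ne(1) assms(2) ne(2)] by simp
  moreover have "nil_index a \<noteq> 0" "nil_index b \<noteq> 0"
    using ne assms nil_index_eq_0_iff by auto
  ultimately show "D a = 0" "D b = 0"
    using assms D_eq_0_iff by auto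
qed

text \<open>A nonzero idempotent has an index N with N + 1 = 2 N. Applied to the unit of B this
  replaces D 1 = 0, since that unit need not be the ambient 1.\<close>

lemma D_idempotent: "e \<in> B \<Longrightarrow> e * e = e \<Longrightarrow> D e = 0"
proof -
  assume e: "e \<in> B" "e * e = e"
  have "Suc (nil_index e) = nil_index e + nil_index e" if "e \<noteq> 0"
    using nil_index_mult[OF e(1) that e(1) that] e by simp
  then show ?thesis using D_eq_0_iff[OF e(1)] by fastforce
qed

end

text \<open>The quotient by \<open>u\<close> is locally nilpotent because it lowers the degree function of \<open>D\<close>.\<close>

lemma (in lnd_domain) lnd_quotient:
  fixes A :: "'c::comm_ring_1 set" and h :: "'c \<Rightarrow> 'a" and g :: "'c \<Rightarrow> 'a"
  assumes A: "subalgebra A C'"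
    and h: "\<And>a. a \<in> A \<Longrightarrow> h a \<in> B"
    and inj: "\<And>a. a \<in> A \<Longrightarrow> h a = 0 \<Longrightarrow> a = 0"
    and add: "\<And>a b. a \<in> A \<Longrightarrow> b \<in> A \<Longrightarrow> h (a + b) = h a + h b"
    and mult: "\<And>a b. a \<in> A \<Longrightarrow> b \<in> A \<Longrightarrow> h (a * b) = h a * h b"
    and scal: "\<And>c a. c \<in> C' \<Longrightarrow> a \<in> A \<Longrightarrow> h (c * a) = \<sigma> c * h a \<and> \<sigma> c \<in> C"
    and u: "u \<in> B" "u \<noteq> 0"
    and ex: "\<And>a. a \<in> A \<Longrightarrow> \<exists>b\<in>A. D (h a) = h b * u"
  obtains \<delta> where "lnd A C' \<delta>" "\<And>a. a \<in> A \<Longrightarrow> D (h a) = h (\<delta> a) * u"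
proof -
  interpret A: subalgebra A C' by fact
  obtain \<delta> where d: "\<And>a. a \<in> A \<Longrightarrow> \<delta> a \<in> A" "\<And>a. a \<in> A \<Longrightarrow> D (h a) = h (\<delta> a) * u"
    using ex by metis
  have h0: "h 0 = 0"
    using add[OF A.zero_mem A.zero_mem] by simp
  have hdiff: "h (a - b) = h a - h b" if "a \<in> A" "b \<in> A" for a b
    using add[OF A.diff_mem[OF that] that(2)] by simp
  have eq: "a = b" if "a \<in> A" "b \<in> A" "h a * u = h b * u" for a b
  proof -
    have "h (a - b) * u = 0" using that by (simp add: hdiff left_diff_distrib)
    then have "h (a - b) = 0"
      using no_zero_div h A.diff_mem that u by blast
    then show ?thesis using inj A.diff_mem that by fastforce
  qed
  have nil: "nil_index (h (\<delta> a)) < nil_index (h a)" if a: "a \<in> A" "\<delta> a \<noteq> 0" for a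
  proof -
    have ne: "h (\<delta> a) \<noteq> 0" using inj a d by blast
    have "Suc (nil_index (D (h a))) = nil_index (h (\<delta> a)) + nil_index u"
      using nil_index_mult[OF h[OF d(1)[OF a(1)]] ne u] d(2)[OF a(1)] by simp
    moreover have "nil_index u \<noteq> 0" "nil_index (h (\<delta> a)) \<noteq> 0"
      using u ne nil_index_eq_0_iff h d a by auto
    ultimately show ?thesis using nil_index_D[OF h[OF a(1)]] by linarith
  qed
  have "lnd A C' \<delta>"
  proof unfold_locales
    show "\<delta> (a + b) = \<delta> a + \<delta> b" if "a \<in> A" "b \<in> A" for a b
    proof (rule eq)
      show "h (\<delta> (a + b)) * u = h (\<delta> a + \<delta> b) * u"
        using that by (simp add: d A.add_mem flip: d(2)) (simp add: add d D_add h distrib_right)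
    qed (auto intro!: d A.add_mem that)
    show "\<delta> (a * b) = a * \<delta> b + b * \<delta> a" if "a \<in> A" "b \<in> A" for a b
    proof (rule eq)
      show "h (\<delta> (a * b)) * u = h (a * \<delta> b + b * \<delta> a) * u"
        using that by (simp add: d A.mult_mem flip: d(2))
          (simp add: add mult A.mult_mem d D_mult h algebra_simps)
    qed (auto intro!: d A.add_mem A.mult_mem that)
    show "\<delta> (c * a) = c * \<delta> a" if "c \<in> C'" "a \<in> A" for c a
    proof (rule eq)
      show "h (\<delta> (c * a)) * u = h (c * \<delta> a) * u"
        using that scal by (simp add: d A.scal_mem flip: d(2))
          (simp add: d D_scal h algebra_simps)
    qed (auto intro!: d A.scal_mem that)
    show "\<exists>n. (\<delta> ^^ n) a = 0" if "a \<in> A" for a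
      using that
    proof (induction "nil_index (h a)" arbitrary: a rule: less_induct)
      case less
      show ?case
      proof (cases "\<delta> a = 0")
        case True then show ?thesis by (intro exI[of _ 1]) simp
      next
        case False
        from less(1)[OF nil[OF less(2) this] d(1)[OF less(2)]]
        obtain n where "(\<delta> ^^ n) (\<delta> a) = 0" by blast
        then show ?thesis by (intro exI[of _ "Suc n"]) (simp add: funpow_swap1)
      qed
    qed
  qed (auto simp: d)
  with d show ?thesis using that by blast
qed

section \<open>Graded algebras\<close>

locale graded_algebra = subalgebra +
  fixes G :: "int \<Rightarrow> 'a::comm_ring_1 set"
  assumes G_sub: "b \<in> G j \<Longrightarrow> b \<in> B"
    and G_zero: "0 \<in> G j"
    and G_add: "a \<in> G j \<Longrightarrow> b \<in> G j \<Longrightarrow> a + b \<in> G j"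
    and G_scal: "c \<in> C \<Longrightarrow> b \<in> G j \<Longrightarrow> c * b \<in> G j"
    and G_mult: "a \<in> G i \<Longrightarrow> b \<in> G j \<Longrightarrow> a * b \<in> G (i + j)"
    and G_indep: "finite J \<Longrightarrow> (\<And>j. j \<in> J \<Longrightarrow> g j \<in> G j) \<Longrightarrow> sum g J = 0 \<Longrightarrow> j \<in> J \<Longrightarrow> g j = 0"
    and G_span: "b \<in> B \<Longrightarrow> \<exists>J g. finite J \<and> (\<forall>j. g j \<in> G j) \<and> (\<forall>j. j \<notin> J \<longrightarrow> g j = 0) \<and> b = sum g J"
begin

lemma G_diff: "a \<in> G j \<Longrightarrow> b \<in> G j \<Longrightarrow> a - b \<in> G j"
  using G_add[OF _ G_scal[OF of_int_scal[of "-1"]], of a j b] by simp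

text \<open>A whole family is chosen at once, so that one choice yields all components of b;
  \<open>G_indep\<close> makes it unique for b in B.\<close>

definition hcomp :: "'a \<Rightarrow> int \<Rightarrow> 'a" where
  "hcomp b = (SOME g. (\<forall>j. g j \<in> G j) \<and> finite {j. g j \<noteq> 0} \<and> b = (\<Sum>j | g j \<noteq> 0. g j))"

lemma hcomp_props:
  assumes "b \<in> B"
  shows "hcomp b j \<in> G j" "finite {j. hcomp b j \<noteq> 0}" "b = (\<Sum>j | hcomp b j \<noteq> 0. hcomp b j)"
proof -
  obtain J g where g: "finite J" "\<forall>j. g j \<in> G j" "\<forall>j. j \<notin> J \<longrightarrow> g j = 0" "b = sum g J"
    using G_span[OF assms] by blast
  have sub: "{j. g j \<noteq> 0} \<subseteq> J" using g(3) by auto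
  have "b = (\<Sum>j | g j \<noteq> 0. g j)"
    unfolding g(4) by (rule sum.mono_neutral_right) (use g sub in auto)
  with g sub have ex: "\<exists>g. (\<forall>j. g j \<in> G j) \<and> finite {j. g j \<noteq> 0} \<and> b = (\<Sum>j | g j \<noteq> 0. g j)"
    using finite_subset by blast
  from someI_ex[OF ex] show "hcomp b j \<in> G j" "finite {j. hcomp b j \<noteq> 0}" "b = (\<Sum>j | hcomp b j \<noteq> 0. hcomp b j)"
    unfolding hcomp_def by auto
qed

lemma hcomp_sum:
  assumes "b \<in> B" "finite J" "\<And>j. j \<notin> J \<Longrightarrow> hcomp b j = 0"
  shows "b = (\<Sum>j\<in>J. hcomp b j)"
  by (subst hcomp_props(3)[OF assms(1)], rule sum.mono_neutral_left) (use assms in auto)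

lemma hcomp_unique:
  assumes g: "\<And>j. g j \<in> G j" and J: "finite J" "\<And>j. j \<notin> J \<Longrightarrow> g j = 0" and b: "b = sum g J"
  shows "hcomp b = g"
proof
  fix j
  have bB: "b \<in> B" unfolding b by (intro sum_mem G_sub[OF g])
  let ?K = "insert j (J \<union> {j. hcomp b j \<noteq> 0})"
  have fin: "finite ?K" by (intro finite.insertI finite_UnI J(1) hcomp_props(2)[OF bB])
  have "b = (\<Sum>j\<in>?K. hcomp b j)"
    by (rule hcomp_sum[OF bB fin]) auto
  moreover have "b = (\<Sum>j\<in>?K. g j)"
    using fin J by (subst b, intro sum.mono_neutral_left) auto
  ultimately have "(\<Sum>j\<in>?K. hcomp b j - g j) = 0"
    by (simp add: sum_subtractf)
  from G_indep[OF fin _ this, of j] show "hcomp b j = g j"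
    using G_diff hcomp_props(1)[OF bB] g by auto
qed

lemma hcomp_hom: "b \<in> G j \<Longrightarrow> hcomp b = (\<lambda>i. if i = j then b else 0)"
  by (rule hcomp_unique[where J = "{j}"]) (auto simp: G_zero)

lemma hcomp_zero [simp]: "hcomp 0 = (\<lambda>i. 0)"
  using hcomp_hom[OF G_zero[of 0]] by auto

lemma hcomp_add: "a \<in> B \<Longrightarrow> b \<in> B \<Longrightarrow> hcomp (a + b) = (\<lambda>j. hcomp a j + hcomp b j)"
proof -
  assume ab: "a \<in> B" "b \<in> B"
  let ?K = "{j. hcomp a j \<noteq> 0} \<union> {j. hcomp b j \<noteq> 0}"
  have fin: "finite ?K" using ab hcomp_props by auto
  show ?thesis
  proof (rule hcomp_unique[where J = ?K])
    show "a + b = (\<Sum>j\<in>?K. hcomp a j + hcomp b j)"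
      using hcomp_sum[OF ab(1) fin] hcomp_sum[OF ab(2) fin] by (simp add: sum.distrib)
  qed (use ab fin G_add hcomp_props in auto)
qed

lemma hcomp_scal: "c \<in> C \<Longrightarrow> b \<in> B \<Longrightarrow> hcomp (c * b) = (\<lambda>j. c * hcomp b j)"
proof -
  assume cb: "c \<in> C" "b \<in> B"
  show ?thesis
  proof (rule hcomp_unique[where J = "{j. hcomp b j \<noteq> 0}"])
    show "c * b = (\<Sum>j | hcomp b j \<noteq> 0. c * hcomp b j)"
      using hcomp_props(3)[OF cb(2)] by (simp flip: sum_distrib_left)
  qed (use cb G_scal hcomp_props in auto)
qed

lemma hcomp_mult_hom:
  assumes a: "a \<in> G i" and b: "b \<in> B"
  shows "hcomp (a * b) = (\<lambda>j. a * hcomp b (j - i))"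
proof (rule hcomp_unique[where J = "(\<lambda>j. j + i) ` {j. hcomp b j \<noteq> 0}"])
  show "a * hcomp b (j - i) \<in> G j" for j
    using G_mult[OF a hcomp_props(1)[OF b, of "j - i"]] by simp
  show "finite ((\<lambda>j. j + i) ` {j. hcomp b j \<noteq> 0})"
    using hcomp_props(2)[OF b] by auto
  show "a * hcomp b (j - i) = 0" if "j \<notin> (\<lambda>j. j + i) ` {j. hcomp b j \<noteq> 0}" for j
  proof -
    have "hcomp b (j - i) = 0" using that by force
    then show ?thesis by simp
  qed
  show "a * b = (\<Sum>j\<in>(\<lambda>j. j + i) ` {j. hcomp b j \<noteq> 0}. a * hcomp b (j - i))"
    by (subst hcomp_props(3)[OF b]) (simp add: sum_distrib_left sum.reindex inj_on_def)
qed

lemma hom_induct [consumes 1, case_names hom add]: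
  assumes "b \<in> B"
    and hom: "\<And>j g. g \<in> G j \<Longrightarrow> P g"
    and add: "\<And>a b. a \<in> B \<Longrightarrow> b \<in> B \<Longrightarrow> P a \<Longrightarrow> P b \<Longrightarrow> P (a + b)"
  shows "P b"
proof -
  have "(\<Sum>j\<in>J. hcomp b j) \<in> B \<and> P (\<Sum>j\<in>J. hcomp b j)" if "finite J" for J
    using that
  proof (induction J rule: finite_induct)
    case empty then show ?case using hom[OF G_zero] zero_mem by simp
  next
    case (insert j J)
    then show ?case
      using add hom hcomp_props(1)[OF assms(1)] add_mem G_sub by (simp, blast)
  qed
  then show ?thesis using hcomp_props[OF assms(1)] by metis
qed

end

section \<open>Homogeneous top parts of derivations\<close>

locale graded_lnd = graded_algebra + lnd
begin

text \<open>By the product rule, if D raises the degrees of the components of a and b by at most l,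
  then it does so for a * b. So a bound on the degree shift needs checking on generators
  only.\<close>

lemma degree_bound_closed:
  fixes l :: int
  defines "Q \<equiv> {b \<in> B. \<forall>j i. i > j + l \<longrightarrow> hcomp (D (hcomp b j)) i = 0}"
  shows "a \<in> Q \<Longrightarrow> b \<in> Q \<Longrightarrow> a + b \<in> Q"
    and "c \<in> C \<Longrightarrow> b \<in> Q \<Longrightarrow> c * b \<in> Q"
    and "a \<in> Q \<Longrightarrow> b \<in> Q \<Longrightarrow> a * b \<in> Q"
proof -
  have cB: "hcomp b j \<in> B" if "b \<in> B" for b j
    using that hcomp_props G_sub by blast
  show add: "a + b \<in> Q" if "a \<in> Q" "b \<in> Q" for a b
    using that by (simp add: Q_def add_mem hcomp_add D_add cB D_mem)
  show "c * b \<in> Q" if "c \<in> C" "b \<in> Q" for c b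
    using that by (simp add: Q_def scal_mem hcomp_scal D_scal cB D_mem)
  have hom: "a * b \<in> Q" if a: "a \<in> G i" "a \<in> Q" and b: "b \<in> Q" for a b i
  proof -
    have aB: "a \<in> B" and bB: "b \<in> B" using a b by (auto simp: Q_def)
    have "hcomp (D (hcomp (a * b) j)) n = 0" if n: "n > j + l" for j n
    proof -
      have 1: "hcomp (D (hcomp b (j - i))) (n - i) = 0"
        using b n by (simp add: Q_def)
      have "hcomp (D (hcomp a i)) (n - (j - i)) = 0"
        using a n by (simp add: Q_def del: hcomp_hom)
      then have 2: "hcomp (D a) (n - (j - i)) = 0"
        using hcomp_hom[OF a(1)] by simp
      show ?thesis
        by (simp add: hcomp_mult_hom[OF a(1) bB] D_mult aB cB[OF bB] hcomp_add mult_mem D_mem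
            hcomp_mult_hom[OF a(1)] hcomp_mult_hom[OF hcomp_props(1)[OF bB]] 1 2)
    qed
    then show ?thesis by (simp add: Q_def mult_mem aB bB)
  qed
  show "a * b \<in> Q" if "a \<in> Q" "b \<in> Q" for a b
  proof -
    have aB: "a \<in> B" using that by (simp add: Q_def)
    have cQ: "hcomp a j \<in> Q" for j
      using that by (auto simp: Q_def cB hcomp_hom[OF hcomp_props(1)[OF aB, of j]])
    have "(\<Sum>j\<in>J. hcomp a j) * b \<in> Q" if "finite J" for J
      using that
    proof (induction J rule: finite_induct)
      case empty then show ?case by (simp add: Q_def zero_mem)
    next
      case (insert j J)
      then show ?case
        using add hom[OF hcomp_props(1)[OF aB] cQ \<open>b \<in> Q\<close>] by (simp add: distrib_right)
    qed
    then show ?thesis using hcomp_props[OF aB] by metis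
  qed
qed

text \<open>The images of the finitely many generators have finitely many nonzero components, and l
  is the largest degree shift among these. It bounds D everywhere by
  \<open>degree_bound_closed\<close>, and it is attained at s, so that the part of D of degree l
  does not vanish.\<close>

lemma ex_top_degree:
  fixes deg :: "'a \<Rightarrow> int"
  assumes S: "finite S" "\<And>s. s \<in> S \<Longrightarrow> s \<in> G (deg s)"
    and gen: "\<And>Q. S \<subseteq> Q \<Longrightarrow> Q \<subseteq> B \<Longrightarrow> (\<And>a b. a \<in> Q \<Longrightarrow> b \<in> Q \<Longrightarrow> a + b \<in> Q)
        \<Longrightarrow> (\<And>c b. c \<in> C \<Longrightarrow> b \<in> Q \<Longrightarrow> c * b \<in> Q)
        \<Longrightarrow> (\<And>a b. a \<in> Q \<Longrightarrow> b \<in> Q \<Longrightarrow> a * b \<in> Q) \<Longrightarrow> Q = B"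
    and nz: "b \<in> B" "D b \<noteq> 0"
  obtains l s where "\<And>j i b. b \<in> G j \<Longrightarrow> i > j + l \<Longrightarrow> hcomp (D b) i = 0"
    "s \<in> S" "hcomp (D s) (deg s + l) \<noteq> 0"
proof -
  have SB: "s \<in> B" if "s \<in> S" for s using that S G_sub by blast
  have "\<exists>s\<in>S. D s \<noteq> 0"
  proof (rule ccontr)
    assume "\<not> ?thesis"
    then have z: "\<forall>s\<in>S. D s = 0" by auto
    have "{b \<in> B. D b = 0} = B"
      by (rule gen) (auto simp: z SB D_add D_scal D_mult add_mem scal_mem mult_mem)
    with nz show False by auto
  qed
  then obtain s0 where s0: "s0 \<in> S" "D s0 \<noteq> 0" by auto
  define T where "T = (\<Union>s\<in>S. (\<lambda>i. i - deg s) ` {i. hcomp (D s) i \<noteq> 0})"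
  have finT: "finite T"
    unfolding T_def using S(1) SB D_mem hcomp_props(2) by auto
  have "{i. hcomp (D s0) i \<noteq> 0} \<noteq> {}"
    using hcomp_props(3)[OF D_mem[OF SB[OF s0(1)]]] s0(2) by (metis sum.empty)
  then have "T \<noteq> {}" using s0 by (auto simp: T_def)
  then have "Max T \<in> T" using finT by simp
  then obtain s where s: "s \<in> S" "hcomp (D s) (deg s + Max T) \<noteq> 0"
    by (auto simp: T_def)
  let ?Q = "{b \<in> B. \<forall>j i. i > j + Max T \<longrightarrow> hcomp (D (hcomp b j)) i = 0}"
  have "?Q = B"
  proof (rule gen)
    show "S \<subseteq> ?Q"
    proof (clarsimp simp: SB)
      fix s j i assume s: "s \<in> S" "j + Max T < i"
      show "hcomp (D (hcomp s j)) i = 0"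
      proof (cases "j = deg s")
        case True
        have "i - deg s \<notin> T" using Max_ge[OF finT] s True by force
        then have "hcomp (D s) i = 0" using s by (force simp: T_def)
        then show ?thesis using hcomp_hom[OF S(2)[OF s(1)]] True by simp
      next
        case False
        then show ?thesis using hcomp_hom[OF S(2)[OF s(1)]] by simp
      qed
    qed
  qed (use degree_bound_closed[where l = "Max T"] in auto)
  then have "hcomp (D b) i = 0" if "b \<in> G j" "i > j + Max T" for b i j
    using that hcomp_hom[OF that(1)] G_sub[OF that(1)] by (smt (verit) mem_Collect_eq)
  then show ?thesis using that s by blast
qed

definition top_part :: "int \<Rightarrow> 'a \<Rightarrow> 'a" where
  "top_part l b = (\<Sum>j | hcomp b j \<noteq> 0. hcomp (D (hcomp b j)) (j + l))"

lemma top_part_sum: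
  assumes "b \<in> B" "finite J" "\<And>j. j \<notin> J \<Longrightarrow> hcomp b j = 0"
  shows "top_part l b = (\<Sum>j\<in>J. hcomp (D (hcomp b j)) (j + l))"
  unfolding top_part_def by (rule sum.mono_neutral_left) (use assms in auto)

lemma top_part_hom:
  assumes "b \<in> G j"
  shows "top_part l b = hcomp (D b) (j + l)"
  using top_part_sum[OF G_sub[OF assms], of "{j}" l] hcomp_hom[OF assms] by simp

lemma top_part_hom_mem: "b \<in> G j \<Longrightarrow> top_part l b \<in> G (j + l)"
  by (simp add: top_part_hom hcomp_props D_mem G_sub)

lemma top_part_mem: "b \<in> B \<Longrightarrow> top_part l b \<in> B"
  unfolding top_part_def by (intro sum_mem) (metis hcomp_props(1) D_mem G_sub)

lemma top_part_add:
  assumes "a \<in> B" "b \<in> B"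
  shows "top_part l (a + b) = top_part l a + top_part l b"
proof -
  let ?K = "{j. hcomp a j \<noteq> 0} \<union> {j. hcomp b j \<noteq> 0}"
  have fin: "finite ?K" using assms hcomp_props by auto
  have cB: "hcomp b j \<in> B" if "b \<in> B" for b j
    using that hcomp_props G_sub by blast
  have "top_part l (a + b) = (\<Sum>j\<in>?K. hcomp (D (hcomp (a + b) j)) (j + l))"
    by (rule top_part_sum) (use assms add_mem fin hcomp_add in auto)
  also have "\<dots> = (\<Sum>j\<in>?K. hcomp (D (hcomp a j)) (j + l)) + (\<Sum>j\<in>?K. hcomp (D (hcomp b j)) (j + l))"
    using assms by (simp add: hcomp_add D_add cB D_mem sum.distrib)
  also have "\<dots> = top_part l a + top_part l b"
    using top_part_sum[OF assms(1) fin, of l] top_part_sum[OF assms(2) fin, of l] by auto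
  finally show ?thesis .
qed

text \<open>A component of b of degree j contributes to D b in degrees up to j + l only, so degree N
  + l is reached from the top component alone.\<close>

lemma hcomp_D_bound:
  assumes bound: "\<And>j i b. b \<in> G j \<Longrightarrow> i > j + l \<Longrightarrow> hcomp (D b) i = 0"
    and b: "b \<in> B" "\<And>i. i > N \<Longrightarrow> hcomp b i = 0"
  shows "i > N + l \<Longrightarrow> hcomp (D b) i = 0"
    and "hcomp (D b) (N + l) = hcomp (D (hcomp b N)) (N + l)"
proof -
  let ?J = "insert N {j. hcomp b j \<noteq> 0}"
  have fin: "finite ?J" using hcomp_props(2)[OF b(1)] by simp
  have cB: "hcomp b j \<in> B" for j
    using b(1) hcomp_props G_sub by blast
  have "hcomp (\<Sum>j\<in>J. D (hcomp b j)) i = (\<Sum>j\<in>J. hcomp (D (hcomp b j)) i)" if "finite J" for J i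
    using that by (induction J) (auto simp: hcomp_add D_mem cB sum_mem)
  from this[OF fin] have eq: "hcomp (D b) i = (\<Sum>j\<in>?J. hcomp (D (hcomp b j)) i)" for i
    using hcomp_sum[OF b(1) fin] D_sum[of ?J "hcomp b"] cB by auto
  have le: "j \<le> N" if "j \<in> ?J" for j
    using that b(2) by force
  show "hcomp (D b) i = 0" if "i > N + l"
    unfolding eq using le that bound[OF hcomp_props(1)[OF b(1)]]
    by (intro sum.neutral) fastforce
  have "(\<Sum>j\<in>?J - {N}. hcomp (D (hcomp b j)) (N + l)) = 0"
  proof (intro sum.neutral ballI)
    fix j assume "j \<in> ?J - {N}"
    then have "N + l > j + l" using le[of j] by auto
    then show "hcomp (D (hcomp b j)) (N + l) = 0"
      by (rule bound[OF hcomp_props(1)[OF b(1)]])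
  qed
  then show "hcomp (D b) (N + l) = hcomp (D (hcomp b N)) (N + l)"
    unfolding eq by (subst sum.remove[OF fin, of N]) auto
qed

text \<open>The product rule is the comparison of components in degree i + j + l. Nilpotency is
  inherited: for h of degree j the n-th iterate of the top part is the component of
  \<open>(D ^^ n) h\<close> in the highest possible degree j + n l, so it vanishes together with
  \<open>(D ^^ n) h\<close>.\<close>

lemma lnd_top_part:
  assumes bound: "\<And>j i b. b \<in> G j \<Longrightarrow> i > j + l \<Longrightarrow> hcomp (D b) i = 0"
  shows "lnd B C (top_part l)"
proof unfold_locales
  show "top_part l (c * b) = c * top_part l b" if c: "c \<in> C" and b: "b \<in> B" for c b
    using b
  proof (induction rule: hom_induct)
    case (hom j g)
    then show ?case
      using c top_part_hom[OF G_scal[OF c hom]]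
      by (simp add: top_part_hom D_scal G_sub D_mem hcomp_scal)
  next
    case (add a b)
    then show ?case
      using top_part_add[OF scal_mem[OF c] scal_mem[OF c]] by (simp add: distrib_left top_part_add)
  qed
  have mult_hom: "top_part l (a * b) = a * top_part l b + b * top_part l a"
    if a: "a \<in> G i" and b: "b \<in> G j" for a b i j
    using a b hcomp_mult_hom[OF a D_mem[OF G_sub[OF b]]] hcomp_mult_hom[OF b D_mem[OF G_sub[OF a]]]
    by (simp add: top_part_hom[OF G_mult[OF a b]] D_mult G_sub hcomp_add mult_mem D_mem top_part_hom
        algebra_simps)
  show "top_part l (a * b) = a * top_part l b + b * top_part l a" if "a \<in> B" "b \<in> B" for a b
    using that
  proof (induction rule: hom_induct)
    case (hom i a)
    from hom(2) show ?case
    proof (induction rule: hom_induct)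
      case (hom j b)
      with \<open>a \<in> G i\<close> show ?case by (rule mult_hom)
    next
      case (add b c)
      with \<open>a \<in> G i\<close> show ?case
        using top_part_add[OF mult_mem mult_mem, of a b a c]
        by (simp add: G_sub top_part_add algebra_simps)
    qed
  next
    case (add a c)
    then show ?case
      using top_part_add[OF mult_mem mult_mem, of a b c b]
      by (simp add: top_part_add algebra_simps)
  qed
  show "\<exists>n. (top_part l ^^ n) b = 0" if "b \<in> B" for b
    using that
  proof (induction rule: hom_induct)
    case (hom j h)
    have claim: "(top_part l ^^ n) h \<in> G (j + int n * l)
      \<and> (\<forall>i > j + int n * l. hcomp ((D ^^ n) h) i = 0)
      \<and> hcomp ((D ^^ n) h) (j + int n * l) = (top_part l ^^ n) h" for n
    proof (induction n)
      case 0
      then show ?case using hom hcomp_hom[OF hom] by simp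
    next
      case (Suc n)
      define N where "N = j + int n * l"
      have N: "j + int (Suc n) * l = N + l" by (simp add: N_def algebra_simps)
      have b: "(D ^^ n) h \<in> B" using hom G_sub funpow_mem by blast
      have IH: "(top_part l ^^ n) h \<in> G N" "\<And>i. i > N \<Longrightarrow> hcomp ((D ^^ n) h) i = 0"
        "hcomp ((D ^^ n) h) N = (top_part l ^^ n) h"
        using Suc by (auto simp: N_def)
      have "hcomp (D ((D ^^ n) h)) (N + l) = hcomp (D ((top_part l ^^ n) h)) (N + l)"
        using hcomp_D_bound(2)[where b = "(D ^^ n) h" and N = N and l = l] b IH bound by simp
      moreover have "\<forall>i > N + l. hcomp (D ((D ^^ n) h)) i = 0"
        using hcomp_D_bound(1)[where b = "(D ^^ n) h" and N = N and l = l] b IH bound by simp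
      ultimately show ?case
        unfolding N using top_part_hom[OF IH(1)] top_part_hom_mem[OF IH(1)] by simp
    qed
    obtain n where "(D ^^ n) h = 0" using D_nilpotent G_sub[OF hom] by blast
    then have "(top_part l ^^ n) h = 0" using claim[of n] by simp
    then show ?case by blast
  next
    case (add a b)
    let ?T = "top_part l"
    have zero: "?T 0 = 0" by (simp add: top_part_def)
    have pow0: "(?T ^^ n) 0 = 0" for n by (induction n) (auto simp: zero)
    have mono: "(?T ^^ r) x = 0" if "(?T ^^ n) x = 0" "n \<le> r" for n r x
      using funpow_add[of "r - n" n ?T] that pow0 by simp
    have mem: "(?T ^^ n) x \<in> B" if "x \<in> B" for n x
      using that by (induction n) (auto simp: top_part_mem)
    have sum: "(?T ^^ n) (a + b) = (?T ^^ n) a + (?T ^^ n) b" for n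
      by (induction n) (auto simp: top_part_add mem add)
    obtain r s where "(?T ^^ r) a = 0" "(?T ^^ s) b = 0" using add by blast
    then have "(?T ^^ max r s) (a + b) = 0" by (simp add: sum mono)
    then show ?case by blast
  qed
qed (auto simp: top_part_add top_part_mem)

end

section \<open>Polynomial functions and regular functions\<close>

lemma poly_funs_subst:
  assumes "p \<in> poly_funs n" "\<And>i. i < n \<Longrightarrow> g i \<in> poly_funs N"
  shows "(\<lambda>x. p (\<lambda>i. g i x)) \<in> poly_funs N"
  using assms(1) by induction (auto intro: poly_funs.intros assms(2))

lemma poly_funs_mono: "p \<in> poly_funs n \<Longrightarrow> n \<le> N \<Longrightarrow> p \<in> poly_funs N"
  using poly_funs_subst[of p n "\<lambda>i x. x i" N] poly_funs.coord order_less_le_trans by (metis (full_types))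

lemma poly_funs_cong:
  assumes "p \<in> poly_funs n" "\<And>i. i < n \<Longrightarrow> x i = y i"
  shows "p x = p y"
  using assms(1) by induction (auto simp: assms(2))

lemma poly_funs_uminus: "p \<in> poly_funs n \<Longrightarrow> (\<lambda>x. - p x) \<in> poly_funs n"
  using poly_funs.mult[OF poly_funs.const[of "-1"]] by fastforce

lemma poly_funs_diff: "p \<in> poly_funs n \<Longrightarrow> q \<in> poly_funs n \<Longrightarrow> (\<lambda>x. p x - q x) \<in> poly_funs n"
  using poly_funs.add[OF _ poly_funs_uminus] by fastforce

lemma poly_funs_power: "p \<in> poly_funs n \<Longrightarrow> (\<lambda>x. p x ^ r) \<in> poly_funs n"
  by (induction r) (auto intro: poly_funs.intros)

lemma poly_funs_sum:
  "(\<And>i. i \<in> I \<Longrightarrow> p i \<in> poly_funs n) \<Longrightarrow> (\<lambda>x. \<Sum>i\<in>I. p i x) \<in> poly_funs n"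
  by (induction I rule: infinite_finite_induct) (auto intro: poly_funs.intros)

lemma poly_funs_prod:
  "(\<And>i. i \<in> I \<Longrightarrow> p i \<in> poly_funs n) \<Longrightarrow> (\<lambda>x. \<Prod>i\<in>I. p i x) \<in> poly_funs n"
  by (induction I rule: infinite_finite_induct) (auto intro: poly_funs.intros)

lemmas poly_funs_intros = poly_funs.intros poly_funs_uminus poly_funs_diff poly_funs_power
  poly_funs_sum poly_funs_prod

definition zero_ext :: "'p set \<Rightarrow> ('p \<Rightarrow> 'k::zero) \<Rightarrow> 'p \<Rightarrow> 'k" where
  "zero_ext X p = (\<lambda>x. if x \<in> X then p x else 0)"

text \<open>
  Extending regular functions by zero instead of \<^const>\<open>undefined\<close> turns them into elements of
  the commutative ring of all functions, so that ring identities need no carrier side conditions.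
\<close>

definition reg :: "nat \<Rightarrow> (nat \<Rightarrow> 'k::field) set \<Rightarrow> ((nat \<Rightarrow> 'k) \<Rightarrow> 'k) set" where
  "reg n X = zero_ext X ` poly_funs n"

text \<open>Constants on the whole space, not extended by zero: they act by the ambient
  multiplication, and the integers of the ambient ring are among them.\<close>

definition scalars :: "('p \<Rightarrow> 'k) set" where
  "scalars = range (\<lambda>c x. c)"

lemma zero_ext_apply [simp]: "x \<in> X \<Longrightarrow> zero_ext X p x = p x"
  by (simp add: zero_ext_def)

lemma zero_ext_outside [simp]: "x \<notin> X \<Longrightarrow> zero_ext X p x = 0"
  by (simp add: zero_ext_def)

lemma zero_ext_add: "zero_ext X p + zero_ext X q = zero_ext X (\<lambda>x. p x + q x)"
  for p q :: "'p \<Rightarrow> 'k::field"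
  by (auto simp: zero_ext_def)

lemma zero_ext_mult: "zero_ext X p * zero_ext X q = zero_ext X (\<lambda>x. p x * q x)"
  for p q :: "'p \<Rightarrow> 'k::field"
  by (auto simp: zero_ext_def)

lemma zero_ext_scal: "(\<lambda>x. c) * zero_ext X q = zero_ext X (\<lambda>x. c * q x)"
  for q :: "'p \<Rightarrow> 'k::field"
  by (auto simp: zero_ext_def)

lemma zero_ext_zero: "zero_ext X (\<lambda>x. 0) = 0"
  by (auto simp: zero_ext_def)

lemma zero_ext_eq_iff: "zero_ext X p = zero_ext X q \<longleftrightarrow> (\<forall>x\<in>X. p x = q x)"
  by (auto simp: zero_ext_def fun_eq_iff)

lemma zero_ext_eq_0_iff: "zero_ext X p = 0 \<longleftrightarrow> (\<forall>x\<in>X. p x = 0)"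
  for p :: "'p \<Rightarrow> 'k::zero"
  using zero_ext_eq_iff[of X p "\<lambda>x. 0"] by (simp add: zero_ext_zero)

lemma reg_outside: "b \<in> reg n X \<Longrightarrow> x \<notin> X \<Longrightarrow> b x = 0"
  by (auto simp: reg_def)

lemma subalgebra_reg: "subalgebra (reg n X) scalars"
proof
  show "a + b \<in> reg n X" "a * b \<in> reg n X" if "a \<in> reg n X" "b \<in> reg n X" for a b
    using that by (auto simp: reg_def zero_ext_add zero_ext_mult intro: poly_funs.intros)
  show "c * b \<in> reg n X" if "c \<in> scalars" "b \<in> reg n X" for c b
    using that by (auto simp: reg_def scalars_def zero_ext_scal intro!: imageI poly_funs.mult poly_funs.const)
  show "0 \<in> reg n X"
    unfolding reg_def zero_ext_zero[of X, symmetric] by (intro imageI poly_funs.const)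
  show "of_int i \<in> (scalars :: (((nat \<Rightarrow> 'a) \<Rightarrow> 'a) set))" for i
  proof -
    have "(of_int i :: (nat \<Rightarrow> 'a) \<Rightarrow> 'a) = (\<lambda>x. of_int i)"
      by (cases i rule: int_diff_cases) (simp add: of_nat_fun fun_eq_iff)
    then show ?thesis by (auto simp: scalars_def)
  qed
qed

text \<open>The indicator function of X is listed as a generator because a constant on X is a scalar
  multiple of it.\<close>

lemma reg_generated:
  assumes "zero_ext X (\<lambda>x. 1) \<in> Q" "\<And>i. i < n \<Longrightarrow> zero_ext X (\<lambda>x. x i) \<in> Q"
    and "\<And>a b. a \<in> Q \<Longrightarrow> b \<in> Q \<Longrightarrow> a + b \<in> Q" "\<And>a b. a \<in> Q \<Longrightarrow> b \<in> Q \<Longrightarrow> a * b \<in> Q"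
    and "\<And>c b. c \<in> scalars \<Longrightarrow> b \<in> Q \<Longrightarrow> c * b \<in> Q"
  shows "reg n X \<subseteq> (Q :: ((nat \<Rightarrow> 'k::field) \<Rightarrow> 'k) set)"
proof -
  have "zero_ext X p \<in> Q" if "p \<in> poly_funs n" for p
    using that
  proof induction
    case (const c)
    have "(\<lambda>x. c) * zero_ext X (\<lambda>x. 1) \<in> Q"
      using assms(1,5) by (auto simp: scalars_def)
    then show ?case by (simp add: zero_ext_scal)
  next
    case (add p q)
    then show ?case using assms(3)[of "zero_ext X p" "zero_ext X q"] by (simp add: zero_ext_add)
  next
    case (mult p q)
    then show ?case using assms(4)[of "zero_ext X p" "zero_ext X q"] by (simp add: zero_ext_mult)
  qed (use assms in auto)
  then show ?thesis by (auto simp: reg_def)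
qed

section \<open>The coordinate algebra of the statement and its model by zero extension\<close>

lemma carrier_coord_algebra: "carrier (coord_algebra n X) = (\<lambda>p. restrict p X) ` poly_funs n"
  by (auto simp: coord_algebra_def)

lemma zero_ext_restrict [simp]: "zero_ext X (restrict p X) = zero_ext X p"
  by (auto simp: zero_ext_def)

lemma restrict_zero_ext [simp]: "restrict (zero_ext X p) X = restrict p X"
  by (auto simp: zero_ext_def)

text \<open>Restriction to X and extension by zero are inverse isomorphisms between the two models
  of K[X]. A derivation of one model becomes a derivation of the other by conjugation, and its
  iterates are conjugated likewise.\<close>

lemma rigid_iff:
  "rigid n X \<longleftrightarrow> (\<forall>D. lnd (reg n X) scalars D \<longrightarrow> (\<forall>b\<in>reg n X. D b = 0))"
proof
  assume r: "rigid n X"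
  show "\<forall>D. lnd (reg n X) scalars D \<longrightarrow> (\<forall>b\<in>reg n X. D b = 0)"
  proof (intro allI impI ballI, rule ccontr)
    fix D b assume D: "lnd (reg n X) scalars D" and b: "b \<in> reg n X" "D b \<noteq> 0"
    interpret lnd "reg n X" scalars D by fact
    define E where "E g = restrict (D (zero_ext X g)) X" for g
    have mem: "zero_ext X p \<in> reg n X" if "p \<in> poly_funs n" for p
      using that by (simp add: reg_def)
    have ext: "zero_ext X g = g" if "g \<in> reg n X" for g
      using that by (auto simp: reg_def zero_ext_def)
    have c: "restrict g X \<in> carrier (coord_algebra n X)" if "g \<in> reg n X" for g
      using that by (auto simp: carrier_coord_algebra reg_def)
    have E1: "E (restrict p X) = restrict (D (zero_ext X p)) X" for p
      by (simp add: E_def)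
    have "derivation (coord_algebra n X) E"
      unfolding derivation_def
    proof (intro conjI allI ballI)
      show "E \<in> carrier (coord_algebra n X) \<rightarrow> carrier (coord_algebra n X)"
        by (auto simp: carrier_coord_algebra E1) (metis D_mem mem c carrier_coord_algebra)
      fix f g k assume "f \<in> carrier (coord_algebra n X)"
      then obtain p where p: "p \<in> poly_funs n" "f = restrict p X"
        by (auto simp: carrier_coord_algebra)
      show "E (k \<odot>\<^bsub>coord_algebra n X\<^esub> f) = k \<odot>\<^bsub>coord_algebra n X\<^esub> E f"
      proof -
        have "k \<odot>\<^bsub>coord_algebra n X\<^esub> f = restrict (\<lambda>x. k * p x) X"
          by (auto simp: coord_algebra_def p restrict_def)
        moreover have "D (zero_ext X (\<lambda>x. k * p x)) = (\<lambda>_. k) * D (zero_ext X p)"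
          using D_scal[OF _ mem[OF p(1)], of "\<lambda>_. k"] by (simp add: scalars_def zero_ext_scal)
        ultimately show ?thesis
          unfolding p(2) by (simp add: E1) (auto simp: coord_algebra_def)
      qed
      assume "g \<in> carrier (coord_algebra n X)"
      then obtain q where q: "q \<in> poly_funs n" "g = restrict q X"
        by (auto simp: carrier_coord_algebra)
      show "E (f \<oplus>\<^bsub>coord_algebra n X\<^esub> g) = E f \<oplus>\<^bsub>coord_algebra n X\<^esub> E g"
      proof -
        have "f \<oplus>\<^bsub>coord_algebra n X\<^esub> g = restrict (\<lambda>x. p x + q x) X"
          by (auto simp: coord_algebra_def p q restrict_def)
        moreover have "D (zero_ext X (\<lambda>x. p x + q x)) = D (zero_ext X p) + D (zero_ext X q)"
          using D_add[OF mem[OF p(1)] mem[OF q(1)]] by (simp add: zero_ext_add)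
        ultimately show ?thesis
          unfolding p(2) q(2) by (simp add: E1) (auto simp: coord_algebra_def)
      qed
      show "E (f \<otimes>\<^bsub>coord_algebra n X\<^esub> g)
          = (f \<otimes>\<^bsub>coord_algebra n X\<^esub> E g) \<oplus>\<^bsub>coord_algebra n X\<^esub> (g \<otimes>\<^bsub>coord_algebra n X\<^esub> E f)"
      proof -
        have "f \<otimes>\<^bsub>coord_algebra n X\<^esub> g = restrict (\<lambda>x. p x * q x) X"
          by (auto simp: coord_algebra_def p q restrict_def)
        moreover have "D (zero_ext X (\<lambda>x. p x * q x))
            = zero_ext X p * D (zero_ext X q) + zero_ext X q * D (zero_ext X p)"
          using D_mult[OF mem[OF p(1)] mem[OF q(1)]] by (simp add: zero_ext_mult)
        ultimately show ?thesis
          unfolding p(2) q(2) by (simp add: E1) (auto simp: coord_algebra_def)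
      qed
    qed
    moreover have "locally_nilpotent (coord_algebra n X) E"
      unfolding locally_nilpotent_def
    proof
      fix f assume "f \<in> carrier (coord_algebra n X)"
      then obtain p where p: "p \<in> poly_funs n" "f = restrict p X"
        by (auto simp: carrier_coord_algebra)
      obtain r where r: "(D ^^ r) (zero_ext X p) = 0"
        using D_nilpotent[OF mem[OF p(1)]] by blast
      have "(E ^^ j) f = restrict ((D ^^ j) (zero_ext X p)) X" for j
      proof (induction j)
        case (Suc j)
        then have "(E ^^ Suc j) f = E (restrict ((D ^^ j) (zero_ext X p)) X)"
          by (simp only: funpow.simps o_apply)
        also have "\<dots> = restrict (D ((D ^^ j) (zero_ext X p))) X"
          unfolding E1 ext[OF funpow_mem[OF mem[OF p(1)]]] ..
        finally show ?case by (simp only: funpow.simps o_apply)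
      qed (simp only: funpow.simps id_apply p(2) restrict_zero_ext)
      then have "(E ^^ r) f = \<zero>\<^bsub>coord_algebra n X\<^esub>"
        by (auto simp: r coord_algebra_def)
      then show "\<exists>r. (E ^^ r) f = \<zero>\<^bsub>coord_algebra n X\<^esub>" by blast
    qed
    moreover have "E (restrict b X) \<noteq> \<zero>\<^bsub>coord_algebra n X\<^esub>"
    proof
      assume "E (restrict b X) = \<zero>\<^bsub>coord_algebra n X\<^esub>"
      then have "restrict (D b) X = restrict (\<lambda>x. 0) X"
        by (simp only: E1 ext[OF b(1)]) (simp add: coord_algebra_def)
      then have "\<forall>x\<in>X. D b x = 0"
        by (metis restrict_apply')
      then have "D b = 0" using reg_outside[OF D_mem[OF b(1)]] by (auto simp: fun_eq_iff)
      with b show False by simp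
    qed
    ultimately show False using r c[OF b(1)] unfolding rigid_def by blast
  qed
next
  assume r: "\<forall>D. lnd (reg n X) scalars D \<longrightarrow> (\<forall>b\<in>reg n X. D b = 0)"
  show "rigid n X"
    unfolding rigid_def
  proof clarify
    fix D a
    assume D: "derivation (coord_algebra n X) D" and nil: "locally_nilpotent (coord_algebra n X) D"
      and a: "a \<in> carrier (coord_algebra n X)" "D a \<noteq> \<zero>\<^bsub>coord_algebra n X\<^esub>"
    interpret subalgebra "reg n X" scalars by (rule subalgebra_reg)
    define E where "E g = zero_ext X (D (restrict g X))" for g
    have c: "restrict p X \<in> carrier (coord_algebra n X)" if "p \<in> poly_funs n" for p
      using that by (auto simp: carrier_coord_algebra)
    have cD: "D g \<in> carrier (coord_algebra n X)" if "g \<in> carrier (coord_algebra n X)" for g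
      using D that by (auto simp: derivation_def)
    have cz: "zero_ext X g \<in> reg n X" if "g \<in> carrier (coord_algebra n X)" for g
      using that by (auto simp: carrier_coord_algebra reg_def)
    have rz: "restrict g X = g" if "g \<in> carrier (coord_algebra n X)" for g
      using that by (auto simp: carrier_coord_algebra)
    have Ez: "E (zero_ext X p) = zero_ext X (D (restrict p X))" for p
      by (simp add: E_def)
    have "lnd (reg n X) scalars E"
    proof unfold_locales
      fix a b k assume "a \<in> reg n X"
      then obtain p where p: "p \<in> poly_funs n" "a = zero_ext X p" by (auto simp: reg_def)
      show "E a \<in> reg n X" using p c cD cz by (auto simp: E_def)
      show "E (k * a) = k * E a" if ks: "k \<in> scalars"
      proof -
        obtain k' where k: "k = (\<lambda>x. k')" using ks unfolding scalars_def by blast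
        have "D (k' \<odot>\<^bsub>coord_algebra n X\<^esub> restrict p X) = k' \<odot>\<^bsub>coord_algebra n X\<^esub> D (restrict p X)"
          using D c[OF p(1)] by (simp add: derivation_def)
        moreover have "k' \<odot>\<^bsub>coord_algebra n X\<^esub> restrict p X = restrict (\<lambda>x. k' * p x) X"
          by (auto simp: coord_algebra_def restrict_def)
        ultimately show ?thesis
          unfolding p(2) k zero_ext_scal Ez by (auto simp: coord_algebra_def zero_ext_def)
      qed
      show "\<exists>r. (E ^^ r) a = 0"
      proof -
        obtain r where r: "(D ^^ r) (restrict p X) = \<zero>\<^bsub>coord_algebra n X\<^esub>"
          using nil c[OF p(1)] by (auto simp: locally_nilpotent_def)
        have "(D ^^ j) (restrict p X) \<in> carrier (coord_algebra n X)
            \<and> (E ^^ j) a = zero_ext X ((D ^^ j) (restrict p X))" for j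
        proof (induction j)
          case 0
          show ?case using c[OF p(1)] by (simp only: funpow.simps id_apply zero_ext_restrict p(2) simp_thms)
        next
          case (Suc j)
          then show ?case by (simp add: E_def rz cD)
        qed
        then have "(E ^^ r) a = 0"
          by (auto simp: r coord_algebra_def zero_ext_def)
        then show ?thesis by blast
      qed
      assume "b \<in> reg n X"
      then obtain q where q: "q \<in> poly_funs n" "b = zero_ext X q" by (auto simp: reg_def)
      have "D (restrict p X \<oplus>\<^bsub>coord_algebra n X\<^esub> restrict q X)
          = D (restrict p X) \<oplus>\<^bsub>coord_algebra n X\<^esub> D (restrict q X)"
        using D c[OF p(1)] c[OF q(1)] by (simp add: derivation_def)
      moreover have "restrict p X \<oplus>\<^bsub>coord_algebra n X\<^esub> restrict q X = restrict (\<lambda>x. p x + q x) X"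
        by (auto simp: coord_algebra_def restrict_def)
      ultimately show "E (a + b) = E a + E b"
        unfolding p(2) q(2) zero_ext_add Ez by (auto simp: coord_algebra_def zero_ext_def)
      have "D (restrict p X \<otimes>\<^bsub>coord_algebra n X\<^esub> restrict q X)
          = (restrict p X \<otimes>\<^bsub>coord_algebra n X\<^esub> D (restrict q X))
            \<oplus>\<^bsub>coord_algebra n X\<^esub> (restrict q X \<otimes>\<^bsub>coord_algebra n X\<^esub> D (restrict p X))"
        using D c[OF p(1)] c[OF q(1)] by (simp add: derivation_def)
      moreover have "restrict p X \<otimes>\<^bsub>coord_algebra n X\<^esub> restrict q X = restrict (\<lambda>x. p x * q x) X"
        by (auto simp: coord_algebra_def restrict_def)
      ultimately show "E (a * b) = a * E b + b * E a"
        unfolding p(2) q(2) zero_ext_mult Ez by (auto simp: coord_algebra_def zero_ext_def)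
    qed
    with r have "E (zero_ext X a) = 0" using cz[OF a(1)] by blast
    then have "zero_ext X (D a) = 0" by (simp only: Ez rz[OF a(1)])
    then have "\<forall>x\<in>X. D a x = 0" by (metis zero_ext_apply zero_fun_apply)
    then have "restrict (D a) X = restrict (\<lambda>x. 0) X" by (intro restrict_ext) auto
    then have "D a = \<zero>\<^bsub>coord_algebra n X\<^esub>"
      by (simp only: rz[OF cD[OF a(1)]]) (simp add: coord_algebra_def)
    with a show False by simp
  qed
qed

lemma algebraic_set_Collect:
  assumes "algebraic_set n X" "p \<in> poly_funs n"
  shows "algebraic_set n {x \<in> X. p x = 0}"
proof -
  obtain S where "S \<subseteq> poly_funs n" "X = {x \<in> affine_space n. \<forall>p\<in>S. p x = 0}"
    using assms by (auto simp: algebraic_set_def)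
  then show ?thesis
    unfolding algebraic_set_def using assms(2) by (intro exI[of _ "insert p S"]) auto
qed

text \<open>Absence of zero divisors remains a hypothesis because it has three sources:
  irreducibility, a grading on the suspension, and clearing of denominators on a principal open
  set.\<close>

lemma algebra_domain_reg:
  fixes X :: "(nat \<Rightarrow> 'k::field_char_0) set"
  assumes "\<And>p q. p \<in> poly_funs n \<Longrightarrow> q \<in> poly_funs n \<Longrightarrow> \<forall>x\<in>X. p x * q x = 0 \<Longrightarrow>
    (\<forall>x\<in>X. p x = 0) \<or> (\<forall>x\<in>X. q x = 0)"
  shows "algebra_domain (reg n X) scalars"
proof -
  interpret subalgebra "reg n X" scalars by (rule subalgebra_reg)
  show ?thesis
  proof
    fix a b assume "a \<in> reg n X" "b \<in> reg n X" and ab: "a * b = 0"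
    then obtain p q where pq: "p \<in> poly_funs n" "a = zero_ext X p" "q \<in> poly_funs n" "b = zero_ext X q"
      by (auto simp: reg_def)
    have "\<forall>x\<in>X. p x * q x = 0"
      using ab by (auto simp: pq zero_ext_def fun_eq_iff split: if_splits)
    from assms[OF pq(1) pq(3) this] show "a = 0 \<or> b = 0"
      by (auto simp: pq zero_ext_def fun_eq_iff)
  next
    fix b :: "(nat \<Rightarrow> 'k) \<Rightarrow> 'k" and r
    assume "of_nat (Suc r) * b = 0"
    then have "of_nat (Suc r) * b x = 0" for x
      by (metis of_nat_fun times_fun_apply zero_fun_apply)
    then show "b = 0" by (auto simp del: of_nat_Suc)
  qed
qed

text \<open>The zero sets of p and q in X are algebraic and cover X.\<close>

lemma affine_variety_no_zero_div:
  assumes X: "affine_variety n X" and p: "p \<in> poly_funs n" and q: "q \<in> poly_funs n"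
    and "\<forall>x\<in>X. p x * q x = 0"
  shows "(\<forall>x\<in>X. p x = 0) \<or> (\<forall>x\<in>X. q x = 0)"
proof -
  have "algebraic_set n X" using X by (simp add: affine_variety_def)
  then have "algebraic_set n {x \<in> X. p x = 0}" "algebraic_set n {x \<in> X. q x = 0}"
    using p q algebraic_set_Collect by auto
  moreover have "X = {x \<in> X. p x = 0} \<union> {x \<in> X. q x = 0}"
    using assms(4) by auto
  ultimately have "X = {x \<in> X. p x = 0} \<or> X = {x \<in> X. q x = 0}"
    using X unfolding affine_variety_def by blast
  then show ?thesis by blast
qed

section \<open>Rigidity of suspensions with coprime exponents\<close>

text \<open>If M and N are the top degrees of b and c, then the component of b * c in degree M + N
  is the product of the two top components.\<close>

lemma (in graded_algebra) zero_div_hom: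
  assumes b: "b \<in> B" "b \<noteq> 0" and c: "c \<in> B" "c \<noteq> 0" and bc: "b * c = 0"
  obtains i j where "hcomp b i \<noteq> 0" "hcomp c j \<noteq> 0" "hcomp b i * hcomp c j = 0"
proof -
  have top: "\<exists>N. hcomp x N \<noteq> 0 \<and> (\<forall>i>N. hcomp x i = 0)" if x: "x \<in> B" "x \<noteq> 0" for x
  proof -
    let ?S = "{j. hcomp x j \<noteq> 0}"
    have "?S \<noteq> {}" using hcomp_props(3)[OF x(1)] x(2) by (metis sum.empty)
    then have "Max ?S \<in> ?S" using hcomp_props(2)[OF x(1)] by (rule Max_in[rotated])
    moreover have "hcomp x i = 0" if "i > Max ?S" for i
      using Max_ge[OF hcomp_props(2)[OF x(1)], of i] that by auto
    ultimately show ?thesis by blast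
  qed
  obtain M where M: "hcomp b M \<noteq> 0" "\<And>i. i > M \<Longrightarrow> hcomp b i = 0" using top[OF b] by blast
  obtain N where N: "hcomp c N \<noteq> 0" "\<And>i. i > N \<Longrightarrow> hcomp c i = 0" using top[OF c] by blast
  let ?J = "{j. hcomp b j \<noteq> 0}"
  have fin: "finite ?J" by (rule hcomp_props(2)[OF b(1)])
  have hB: "hcomp b j * c \<in> B" for j
    using hcomp_props(1)[OF b(1)] G_sub c(1) mult_mem by blast
  have "hcomp (\<Sum>j\<in>J. hcomp b j * c) i = (\<Sum>j\<in>J. hcomp b j * hcomp c (i - j))" if "finite J" for J i
    using that by (induction J)
      (simp_all add: hcomp_add hB sum_mem hcomp_mult_hom[OF hcomp_props(1)[OF b(1)] c(1)])
  from this[OF fin, of "M + N"]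
  have "(\<Sum>j\<in>?J. hcomp b j * hcomp c (M + N - j)) = hcomp (b * c) (M + N)"
    by (subst (2) hcomp_props(3)[OF b(1)]) (simp add: sum_distrib_right)
  also have "\<dots> = 0" using bc by simp
  also have "(\<Sum>j\<in>?J. hcomp b j * hcomp c (M + N - j)) = (\<Sum>j\<in>{M}. hcomp b j * hcomp c (M + N - j))"
  proof (rule sum.mono_neutral_right[OF fin])
    show "\<forall>j\<in>?J - {M}. hcomp b j * hcomp c (M + N - j) = 0"
    proof
      fix j assume j: "j \<in> ?J - {M}"
      then have "j < M" using M(2)[of j] by force
      then show "hcomp b j * hcomp c (M + N - j) = 0" using N(2)[of "M + N - j"] by simp
    qed
  qed (use M in auto)
  finally have "hcomp b M * hcomp c N = 0" by simp
  with M N that show ?thesis by blast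
qed

text \<open>After multiplication by a power of t this is a polynomial with infinitely many roots. It
  will separate the weights of a torus action.\<close>

lemma laurent_zero:
  fixes c :: "int \<Rightarrow> 'k::field_char_0"
  assumes J: "finite J" and z: "\<And>t. t \<noteq> 0 \<Longrightarrow> (\<Sum>j\<in>J. t powi j * c j) = 0" and j: "j \<in> J"
  shows "c j = 0"
proof -
  obtain N :: int where N: "\<And>j. j \<in> J \<Longrightarrow> j + N \<ge> 0"
  proof
    fix j assume "j \<in> J"
    then show "j + (\<Sum>i\<in>J. \<bar>i\<bar>) \<ge> 0"
      using member_le_sum[of j J "\<lambda>i. \<bar>i\<bar>"] J by simp
  qed
  define P where "P = (\<Sum>j\<in>J. monom (c j) (nat (j + N)))"
  have "poly P t = 0" if t: "t \<noteq> 0" for t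
  proof -
    have "poly P t = (\<Sum>j\<in>J. t powi N * (t powi j * c j))"
      unfolding P_def poly_sum poly_monom
    proof (rule sum.cong)
      fix j assume "j \<in> J"
      then have "t ^ nat (j + N) = t powi (j + N)"
        using N by (simp add: power_int_def)
      then show "c j * t ^ nat (j + N) = t powi N * (t powi j * c j)"
        using t by (simp add: power_int_add mult_ac)
    qed simp
    also have "\<dots> = t powi N * (\<Sum>j\<in>J. t powi j * c j)" by (simp add: sum_distrib_left)
    finally show ?thesis using z[OF t] by simp
  qed
  then have "- {0} \<subseteq> {t. poly P t = 0}" by auto
  moreover have "infinite (- {0 :: 'k})"
    by (simp add: Compl_eq_Diff_UNIV infinite_UNIV_char_0)
  ultimately have "P = 0" using poly_roots_finite finite_subset by blast
  then have "0 = coeff P (nat (j + N))" by simp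
  also have "\<dots> = (\<Sum>i\<in>J. if i = j then c j else 0)"
    unfolding P_def coeff_sum coeff_monom
  proof (rule sum.cong)
    fix i assume "i \<in> J"
    then have "nat (i + N) = nat (j + N) \<longleftrightarrow> i = j"
      using N[of i] N[OF j] by auto
    then show "(if nat (i + N) = nat (j + N) then c i else 0) = (if i = j then c j else 0)"
      by auto
  qed simp
  also have "\<dots> = c j" using J j by simp
  finally show ?thesis by simp
qed

definition wdeg :: "nat \<Rightarrow> (nat \<Rightarrow> int) \<Rightarrow> (nat \<Rightarrow> nat) \<Rightarrow> int" where
  "wdeg m l a = (\<Sum>i<m. l i * int (a i))"

text \<open>
  Since \<open>k\<close> is primitive, the exponent vectors modulo \<open>k\<close> form a torsion-free group, so a
  suitable functional that kills \<open>k\<close> separates any finite set of classes.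
\<close>

lemma generic_weights:
  assumes m: "m \<ge> 1" and k: "\<And>i. i < m \<Longrightarrow> k i > 0" and gcd: "Gcd (k ` {..<m}) = 1"
    and E: "finite E"
  obtains l where "wdeg m l k = 0"
    "\<And>a b. a \<in> E \<Longrightarrow> b \<in> E \<Longrightarrow> wdeg m l a = wdeg m l b \<Longrightarrow>
      \<exists>r. \<forall>i<m. int (a i) - int (b i) = r * int (k i)"
proof -
  \<comment> \<open>With v = a - b the coefficients are the minors k_0 v_i - k_i v_0, so
    \<open>P a b = 0\<close> means that v is a rational multiple of k. An integer t that is no root
    of the nonzero ones decides this by one evaluation.\<close>
  define P :: "(nat \<Rightarrow> nat) \<Rightarrow> (nat \<Rightarrow> nat) \<Rightarrow> int poly" where
    "P a b = (\<Sum>i<m. monom (int (k 0) * (int (a i) - int (b i)) - int (k i) * (int (a 0) - int (b 0))) i)" for a b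
  let ?R = "\<Union>a\<in>E. \<Union>b\<in>E. if P a b = 0 then {} else {t. poly (P a b) t = 0}"
  have "finite ?R" using E by (auto intro: poly_roots_finite)
  then obtain t where t: "t \<notin> ?R" using infinite_UNIV_int ex_new_if_finite by blast
  \<comment> \<open>The functional that sends a to the sum of (k_0 a_i - k_i a_0) t^i, which visibly
    kills k. The correction at i = 0 gathers the coefficients of a_0.\<close>
  define l where "l i = int (k 0) * t ^ i - (if i = 0 then (\<Sum>j<m. int (k j) * t ^ j) else 0)" for i
  have wd: "wdeg m l a = (\<Sum>i<m. (int (k 0) * int (a i) - int (k i) * int (a 0)) * t ^ i)" for a
  proof -
    have "wdeg m l a = (\<Sum>i<m. int (k 0) * int (a i) * t ^ i)
        - (\<Sum>i<m. (if i = 0 then (\<Sum>j<m. int (k j) * t ^ j) * int (a 0) else 0))"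
      unfolding wdeg_def l_def sum_subtractf[symmetric]
      by (rule sum.cong) (auto simp: algebra_simps)
    also have "(\<Sum>i<m. (if i = 0 then (\<Sum>j<m. int (k j) * t ^ j) * int (a 0) else 0))
        = (\<Sum>j<m. int (k j) * int (a 0) * t ^ j)"
      using m by (simp add: sum_distrib_left sum_distrib_right mult_ac)
    finally show ?thesis by (simp add: sum_subtractf algebra_simps)
  qed
  show ?thesis
  proof (rule that[of l])
    show "wdeg m l k = 0" unfolding wd by simp
  next
    fix a b assume ab: "a \<in> E" "b \<in> E" "wdeg m l a = wdeg m l b"
    have "poly (P a b) t = wdeg m l a - wdeg m l b"
      unfolding wd P_def by (simp add: poly_sum poly_monom sum_subtractf[symmetric] algebra_simps)
    then have P0: "P a b = 0" using t ab by (auto split: if_splits)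
    let ?v = "\<lambda>i. int (a i) - int (b i)"
    have eq: "int (k 0) * ?v i = int (k i) * ?v 0" if "i < m" for i
    proof -
      have "coeff (P a b) i = int (k 0) * ?v i - int (k i) * ?v 0"
        unfolding P_def coeff_sum coeff_monom using that by simp
      then show ?thesis using P0 by simp
    qed
    have "k 0 dvd nat \<bar>?v 0\<bar> * k i" if "i < m" for i
    proof -
      have "int (k 0) dvd ?v 0 * int (k i)"
        using eq[OF that] by (metis dvd_triv_left mult.commute)
      then have "k 0 dvd nat \<bar>?v 0 * int (k i)\<bar>" by (simp only: dvd_nat_abs_iff)
      then show ?thesis by (simp add: abs_mult nat_mult_distrib)
    qed
    \<comment> \<open>Here coprimality turns the rational multiple into an integral one: k_0 divides
      every v_0 k_i, hence v_0 times their gcd, which is v_0 up to sign.\<close>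
    then have "k 0 dvd Gcd ((\<lambda>x. nat \<bar>?v 0\<bar> * x) ` k ` {..<m})"
      by (intro Gcd_greatest) auto
    then have "k 0 dvd nat \<bar>?v 0\<bar>" using gcd by (simp add: Gcd_mult)
    then have "int (k 0) dvd ?v 0" by (simp only: dvd_nat_abs_iff)
    then obtain r where r: "?v 0 = int (k 0) * r" by (rule dvdE)
    have "?v i = r * int (k i)" if "i < m" for i
      using eq[OF that] r k[of 0] m by simp
    then show "\<exists>r. \<forall>i<m. int (a i) - int (b i) = r * int (k i)" by blast
  qed
qed

text \<open>
  As simp rules these would eta-expand every sum and product of functions.
\<close>

lemmas fun_apply = plus_fun_apply times_fun_apply zero_fun_apply

declare plus_fun_apply [simp del] times_fun_apply [simp del] zero_fun_apply [simp del]
  one_fun_apply [simp del]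

section \<open>The coordinate algebra of a suspension\<close>

definition proj :: "nat \<Rightarrow> (nat \<Rightarrow> 'k) \<Rightarrow> nat \<Rightarrow> 'k" where
  "proj m w = (\<lambda>i. w (m + i))"

locale suspension =
  fixes n m :: nat and k :: "nat \<Rightarrow> nat"
    and X :: "(nat \<Rightarrow> 'k :: {alg_closed_field, field_char_0}) set" and f :: "(nat \<Rightarrow> 'k) \<Rightarrow> 'k"
  assumes X: "affine_variety n X" and f: "f \<in> poly_funs n" and f_nonzero: "\<exists>x\<in>X. f x \<noteq> 0"
    and m: "m \<ge> 1" and k_pos: "\<And>i. i < m \<Longrightarrow> k i > 0"
begin

abbreviation W where "W \<equiv> susp n X f m k"

lemma mem_W: "w \<in> W \<longleftrightarrow> w \<in> affine_space (m + n) \<and> proj m w \<in> X \<and> (\<Prod>i<m. w i ^ k i) = f (proj m w)"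
  by (simp add: susp_def proj_def)

lemma X_sub: "X \<subseteq> affine_space n"
  using X by (auto simp: affine_variety_def algebraic_set_def)

definition glue :: "(nat \<Rightarrow> 'k) \<Rightarrow> (nat \<Rightarrow> 'k) \<Rightarrow> nat \<Rightarrow> 'k" where
  "glue y x = (\<lambda>i. if i < m then y i else x (i - m))"

lemma proj_glue [simp]: "proj m (glue y x) = x"
  by (auto simp: proj_def glue_def)

lemma glue_mem_W:
  assumes x: "x \<in> X" and y: "(\<Prod>i<m. y i ^ k i) = f x"
  shows "glue y x \<in> W"
proof -
  have "(\<Prod>i<m. glue y x i ^ k i) = (\<Prod>i<m. y i ^ k i)"
    by (rule prod.cong) (auto simp: glue_def)
  moreover have "x \<in> affine_space n" using x X_sub by blast
  then have "glue y x \<in> affine_space (m + n)"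
    by (auto simp: affine_space_def PiE_def extensional_def glue_def)
  ultimately show ?thesis using x y by (simp add: mem_W)
qed

text \<open>One coordinate is a \<open>k 0\<close>-th root of f x and the others are 1. Surjectivity
  of the projection to X makes \<open>pullback\<close> injective.\<close>

lemma ex_lift:
  assumes "x \<in> X"
  obtains w where "w \<in> W" "proj m w = x"
proof -
  obtain y where y: "y ^ k 0 = f x"
    using nth_root_exists[of "k 0" "f x"] k_pos[of 0] m by auto
  have "(\<Prod>i<m. (if i = 0 then y else 1) ^ k i) = (\<Prod>i<m. if i = 0 then y ^ k 0 else 1)"
    by (rule prod.cong) auto
  also have "\<dots> = f x" using m y by simp
  finally show ?thesis
    using that[OF glue_mem_W[OF assms, of "\<lambda>i. if i = 0 then y else 1"]] by simp
qed

definition B where "B = reg (m + n) W"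
definition A where "A = reg n X"

definition pullback :: "((nat \<Rightarrow> 'k) \<Rightarrow> 'k) \<Rightarrow> (nat \<Rightarrow> 'k) \<Rightarrow> 'k" where
  "pullback g = zero_ext W (\<lambda>w. g (proj m w))"

definition ymon :: "(nat \<Rightarrow> nat) \<Rightarrow> (nat \<Rightarrow> 'k) \<Rightarrow> 'k" where
  "ymon a = zero_ext W (\<lambda>w. \<Prod>i<m. w i ^ a i)"

sublocale A: algebra_domain A scalars
  unfolding A_def by (intro algebra_domain_reg affine_variety_no_zero_div[OF X])

sublocale B: subalgebra B scalars
  unfolding B_def by (rule subalgebra_reg)

lemma pullback_zero_ext: "pullback (zero_ext X p) = zero_ext W (\<lambda>w. p (proj m w))"
  by (auto simp: pullback_def zero_ext_def mem_W fun_eq_iff)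

lemma pullback_mem: "g \<in> A \<Longrightarrow> pullback g \<in> B"
proof -
  assume "g \<in> A"
  then obtain p where p: "p \<in> poly_funs n" "g = zero_ext X p" by (auto simp: A_def reg_def)
  have "(\<lambda>w. p (\<lambda>i. w (m + i))) \<in> poly_funs (m + n)"
    by (rule poly_funs_subst[OF p(1)]) (auto intro: poly_funs.coord)
  then show ?thesis by (auto simp: p(2) pullback_zero_ext B_def reg_def proj_def)
qed

lemma pullback_add: "pullback (a + b) = pullback a + pullback b"
  and pullback_mult: "pullback (a * b) = pullback a * pullback b"
  by (auto simp: pullback_def zero_ext_def fun_eq_iff fun_apply)

lemma pullback_scal: "pullback ((\<lambda>x. c) * b) = (\<lambda>x. c) * pullback b"
  by (auto simp: pullback_def zero_ext_def fun_eq_iff fun_apply)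

lemma pullback_inj: "g \<in> A \<Longrightarrow> pullback g = 0 \<Longrightarrow> g = 0"
proof
  fix x assume g: "g \<in> A" "pullback g = 0"
  show "g x = 0 x"
  proof (cases "x \<in> X")
    case True
    obtain w where "w \<in> W" "proj m w = x" using ex_lift[OF True] .
    then have "g x = pullback g w" by (simp add: pullback_def)
    then show ?thesis using g(2) by (simp add: fun_apply)
  qed (use g reg_outside in \<open>auto simp: A_def fun_apply\<close>)
qed

lemma ymon_mem: "ymon a \<in> B"
  unfolding ymon_def B_def reg_def by (intro imageI poly_funs_intros) auto

lemma ymon_mult: "ymon a * ymon b = ymon (\<lambda>i. a i + b i)"
  by (auto simp: ymon_def zero_ext_def power_add prod.distrib fun_eq_iff fun_apply)

lemma ymon_k: "ymon k = pullback (zero_ext X f)"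
  by (simp add: ymon_def pullback_zero_ext zero_ext_eq_iff) (simp add: mem_W)

lemma ymon_0: "ymon (\<lambda>i. 0) = zero_ext W (\<lambda>w. 1)"
  by (simp add: ymon_def)

lemma pullback_one: "pullback (zero_ext X (\<lambda>x. 1)) = zero_ext W (\<lambda>w. 1)"
  by (simp add: pullback_zero_ext)

text \<open>Since K[X] is a domain, some x has g x and f x both nonzero. At a point of W above x all
  y_i are nonzero, because the product of their powers is f x.\<close>

lemma pullback_ymon_nonzero:
  assumes g: "g \<in> A" "g \<noteq> 0"
  shows "pullback g * ymon a \<noteq> 0"
proof -
  have fA: "zero_ext X f \<in> A" using f by (simp add: A_def reg_def)
  have "zero_ext X f \<noteq> 0" using f_nonzero by (auto simp: fun_eq_iff zero_ext_def fun_apply)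
  then have "g * zero_ext X f \<noteq> 0" using A.no_zero_div[OF g(1) fA] g(2) by blast
  then obtain x where x: "g x \<noteq> 0" "zero_ext X f x \<noteq> 0" by (auto simp: fun_eq_iff fun_apply)
  then have xX: "x \<in> X" "f x \<noteq> 0" by (auto simp: zero_ext_def split: if_splits)
  obtain w where w: "w \<in> W" "proj m w = x" using ex_lift[OF xX(1)] .
  then have "(\<Prod>i<m. w i ^ k i) \<noteq> 0" using xX by (simp add: mem_W)
  then have "w i \<noteq> 0" if "i < m" for i using that k_pos[OF that] by auto
  then have "(pullback g * ymon a) w \<noteq> 0" using w x by (simp add: pullback_def ymon_def fun_apply)
  then show ?thesis by (metis zero_fun_apply)
qed

lemma ymon_nonzero: "ymon a \<noteq> 0"
proof -
  have "zero_ext X (\<lambda>x. 1) \<in> A" by (auto simp: A_def reg_def intro: poly_funs.const)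
  moreover have "zero_ext X (\<lambda>x. 1 :: 'k) \<noteq> 0"
    using f_nonzero by (auto simp: fun_eq_iff zero_ext_def fun_apply)
  ultimately have "pullback (zero_ext X (\<lambda>x. 1)) * ymon a \<noteq> 0"
    by (rule pullback_ymon_nonzero)
  then show ?thesis by auto
qed

text \<open>The K[X]-span of the monomials with exponents in E. Since y^k = f, an element has many
  such representations; E remembers one, and weights can be adapted to it when E is finite.\<close>

inductive_set mspan :: "(nat \<Rightarrow> nat) set \<Rightarrow> ((nat \<Rightarrow> 'k) \<Rightarrow> 'k) set" for E where
  zero: "0 \<in> mspan E"
| mon: "g \<in> A \<Longrightarrow> a \<in> E \<Longrightarrow> pullback g * ymon a \<in> mspan E"
| add: "b \<in> mspan E \<Longrightarrow> c \<in> mspan E \<Longrightarrow> b + c \<in> mspan E"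

lemma mspan_mono: "b \<in> mspan E \<Longrightarrow> E \<subseteq> E' \<Longrightarrow> b \<in> mspan E'"
  by (induction rule: mspan.induct) (auto intro: mspan.intros)

lemma mspan_sub: "b \<in> mspan E \<Longrightarrow> b \<in> B"
  by (induction rule: mspan.induct)
    (auto intro: B.zero_mem B.add_mem B.mult_mem pullback_mem ymon_mem)

lemma mspan_mult:
  assumes "b \<in> mspan E" "c \<in> mspan E'"
  shows "b * c \<in> mspan ((\<lambda>(a, b) i. a i + b i) ` (E \<times> E'))"
  using assms(1)
proof induction
  case (mon g a)
  from assms(2) show ?case
  proof induction
    case (mon h b)
    have "pullback g * ymon a * (pullback h * ymon b) = pullback (g * h) * ymon (\<lambda>i. a i + b i)"
      unfolding pullback_mult ymon_mult[symmetric] by (simp only: mult_ac)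
    also have "\<dots> \<in> mspan ((\<lambda>(a, b) i. a i + b i) ` (E \<times> E'))"
      using \<open>g \<in> A\<close> \<open>a \<in> E\<close> mon by (intro mspan.mon A.mult_mem) auto
    finally show ?case .
  qed (auto simp: distrib_left intro: mspan.intros)
qed (auto simp: distrib_right intro: mspan.intros)

lemma ex_mspan: "b \<in> B \<Longrightarrow> \<exists>E. finite E \<and> b \<in> mspan E"
proof -
  have one: "zero_ext X (\<lambda>x. 1) \<in> A" by (auto simp: A_def reg_def intro: poly_funs.const)
  have "reg (m + n) W \<subseteq> {b. \<exists>E. finite E \<and> b \<in> mspan E}"
  proof (rule reg_generated, safe)
    show "\<exists>E. finite E \<and> zero_ext W (\<lambda>x. 1) \<in> mspan E"
      using mspan.mon[OF one, of "\<lambda>i. 0" "{\<lambda>i. 0}"]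
      by (intro exI[of _ "{\<lambda>i. 0}"]) (simp add: pullback_one ymon_0 zero_ext_mult)
    fix i assume i: "i < m + n"
    show "\<exists>E. finite E \<and> zero_ext W (\<lambda>x. x i) \<in> mspan E"
    proof (cases "i < m")
      case True
      let ?a = "\<lambda>j. if j = i then 1 else 0 :: nat"
      have "(\<Prod>j<m. w j ^ ?a j) = w i" for w :: "nat \<Rightarrow> 'k"
      proof -
        have "(\<Prod>j<m. w j ^ ?a j) = (\<Prod>j<m. if j = i then w j else 1)"
          by (rule prod.cong) auto
        then show ?thesis using True by simp
      qed
      then have "zero_ext W (\<lambda>x. x i) = pullback (zero_ext X (\<lambda>x. 1)) * ymon ?a"
        by (simp only: pullback_one ymon_def zero_ext_mult mult_1)
      then show ?thesis
        using mspan.mon[OF one, of ?a "{?a}"] by (intro exI[of _ "{?a}"]) simp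
    next
      case False
      then have "zero_ext W (\<lambda>x. x i) = pullback (zero_ext X (\<lambda>x. x (i - m))) * ymon (\<lambda>i. 0)"
        by (simp add: pullback_zero_ext ymon_0 zero_ext_mult proj_def)
      moreover have "zero_ext X (\<lambda>x. x (i - m)) \<in> A"
        using i False by (auto simp: A_def reg_def intro!: imageI poly_funs.coord)
      ultimately show ?thesis
        using mspan.mon[of "zero_ext X (\<lambda>x. x (i - m))" "\<lambda>i. 0" "{\<lambda>i. 0}"]
        by (intro exI[of _ "{\<lambda>i. 0}"]) simp
    qed
  next
    fix a b E E' assume "finite E" "a \<in> mspan E" "finite E'" "b \<in> mspan E'"
    then show "\<exists>E. finite E \<and> a + b \<in> mspan E"
      using mspan_mono[of a E "E \<union> E'"] mspan_mono[of b E' "E \<union> E'"]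
      by (intro exI[of _ "E \<union> E'"]) (auto intro: mspan.add)
  next
    fix a b E E' assume "finite E" "a \<in> mspan E" "finite E'" "b \<in> mspan E'"
    then show "\<exists>E. finite E \<and> a * b \<in> mspan E"
      using mspan_mult by (intro exI[of _ "(\<lambda>(a, b) i. a i + b i) ` (E \<times> E')"]) auto
  next
    fix c b :: "(nat \<Rightarrow> 'k) \<Rightarrow> 'k" and E assume c: "c \<in> scalars" and E: "finite E" "b \<in> mspan E"
    obtain c' where c': "c = (\<lambda>x. c')" using c unfolding scalars_def by blast
    have "c * b \<in> mspan E"
      using E(2)
    proof induction
      case (mon g a)
      have "c * (pullback g * ymon a) = pullback ((\<lambda>x. c') * g) * ymon a"
        unfolding pullback_scal c' by (simp only: mult_ac)
      moreover have "(\<lambda>x. c') * g \<in> A"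
        using A.scal_mem[OF _ mon(1)] by (auto simp: scalars_def)
      ultimately show ?case using mspan.mon mon by simp
    qed (auto simp: distrib_left intro: mspan.intros)
    with E show "\<exists>E. finite E \<and> c * b \<in> mspan E" by blast
  qed
  then show "b \<in> B \<Longrightarrow> \<exists>E. finite E \<and> b \<in> mspan E" by (auto simp: B_def)
qed

text \<open>
  If the exponents in \<open>E\<close> are congruent modulo \<open>k\<close>, then they are \<open>e + r k\<close> with \<open>r \<ge> 0\<close> for the
  smallest one \<open>e\<close>, and \<open>y\<^sup>k = f\<close> turns every monomial into a multiple of \<open>y\<^sup>e\<close>.
\<close>

lemma mspan_congruent:
  assumes E: "finite E"
    and cong: "\<And>a b. a \<in> E \<Longrightarrow> b \<in> E \<Longrightarrow> \<exists>r. \<forall>i<m. int (a i) - int (b i) = r * int (k i)"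
  obtains e where "\<And>b. b \<in> mspan E \<Longrightarrow> \<exists>g\<in>A. b = pullback g * ymon e"
proof (cases "E = {}")
  case True
  have "\<exists>g\<in>A. b = pullback g * ymon (\<lambda>i. 0)" if "b \<in> mspan E" for b
    using that
  proof induction
    case zero
    have "pullback 0 = 0" by (auto simp: pullback_def zero_ext_def fun_eq_iff fun_apply)
    then show ?case using A.zero_mem by (intro bexI[of _ 0]) auto
  next
    case (add b c)
    then obtain g h where "g \<in> A" "h \<in> A" "b = pullback g * ymon (\<lambda>i. 0)" "c = pullback h * ymon (\<lambda>i. 0)"
      by blast
    then show ?case
      by (intro bexI[of _ "g + h"]) (auto simp: pullback_add distrib_right A.add_mem)
  qed (use True in auto)
  with that show ?thesis by blast
next
  case False
  \<comment> \<open>Coordinate 0 suffices for the comparison: as \<open>k 0\<close> is positive, the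
    sign of r is the sign of a_0 - e_0.\<close>
  then obtain e where e: "e \<in> E" "\<And>a. a \<in> E \<Longrightarrow> e 0 \<le> a 0"
    using arg_min_if_finite[OF E False, of "\<lambda>a. a 0"] by (metis linorder_not_less)
  have "\<exists>g\<in>A. b = pullback g * ymon e" if "b \<in> mspan E" for b
    using that
  proof induction
    case zero
    have "pullback 0 = 0" by (auto simp: pullback_def zero_ext_def fun_eq_iff fun_apply)
    then show ?case using A.zero_mem by (intro bexI[of _ 0]) auto
  next
    case (mon g a)
    obtain r where r: "\<And>i. i < m \<Longrightarrow> int (a i) - int (e i) = r * int (k i)"
      using cong[OF mon(2) e(1)] by blast
    have "r \<ge> 0"
    proof (rule ccontr)
      assume "\<not> r \<ge> 0"
      then have "r * int (k 0) < 0" using k_pos[of 0] m by (simp add: mult_neg_pos)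
      then show False using r[of 0] m e(2)[OF mon(2)] by simp
    qed
    then have ai: "a i = e i + nat r * k i" if "i < m" for i
    proof -
      have "int (a i) = int (e i + nat r * k i)" using r[OF that] \<open>r \<ge> 0\<close> by simp
      then show ?thesis by (simp only: of_nat_eq_iff)
    qed
    let ?h = "zero_ext X (\<lambda>x. f x ^ nat r)"
    have "(\<Prod>i<m. w i ^ a i) = f (proj m w) ^ nat r * (\<Prod>i<m. w i ^ e i)" if "w \<in> W" for w
    proof -
      have "(\<Prod>i<m. w i ^ a i) = (\<Prod>i<m. w i ^ e i * (w i ^ k i) ^ nat r)"
        by (rule prod.cong) (simp_all add: ai power_add mult.commute flip: power_mult)
      then show ?thesis using that by (simp add: prod.distrib prod_power_distrib[symmetric] mem_W)
    qed
    then have "ymon a = pullback ?h * ymon e"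
      unfolding pullback_zero_ext ymon_def zero_ext_mult zero_ext_eq_iff by blast
    then have "pullback g * ymon a = pullback (g * ?h) * ymon e"
      by (simp add: pullback_mult mult.assoc)
    moreover have "?h \<in> A" using f by (auto simp: A_def reg_def intro!: imageI poly_funs_intros)
    ultimately show ?case using mon(1) A.mult_mem by blast
  next
    case (add b c)
    then obtain g h where "g \<in> A" "h \<in> A" "b = pullback g * ymon e" "c = pullback h * ymon e"
      by blast
    then show ?case
      by (intro bexI[of _ "g + h"]) (auto simp: pullback_add distrib_right A.add_mem)
  qed
  with that show ?thesis by blast
qed

text \<open>The one-parameter group with weights l. It preserves W if \<open>wdeg m l k = 0\<close>,
  because y^k is then invariant.\<close>

definition torus :: "(nat \<Rightarrow> int) \<Rightarrow> 'k \<Rightarrow> (nat \<Rightarrow> 'k) \<Rightarrow> nat \<Rightarrow> 'k" where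
  "torus l t w = (\<lambda>i. if i < m then t powi l i * w i else w i)"

text \<open>The weight space is defined through the action and not through monomials, so that the
  many monomial expressions of an element do not matter.\<close>

definition wpart :: "(nat \<Rightarrow> int) \<Rightarrow> int \<Rightarrow> ((nat \<Rightarrow> 'k) \<Rightarrow> 'k) set" where
  "wpart l j = {b \<in> B. \<forall>w\<in>W. \<forall>t. t \<noteq> 0 \<longrightarrow> b (torus l t w) = t powi j * b w}"

lemma proj_torus [simp]: "proj m (torus l t w) = proj m w"
  by (simp add: proj_def torus_def)

lemma prod_torus:
  assumes "t \<noteq> 0"
  shows "(\<Prod>i<m. torus l t w i ^ a i) = t powi wdeg m l a * (\<Prod>i<m. w i ^ a i)"
proof -
  have "(\<Prod>i<m. torus l t w i ^ a i) = (\<Prod>i<m. t powi (l i * int (a i)) * w i ^ a i)"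
    by (rule prod.cong) (auto simp: torus_def power_mult_distrib power_int_mult)
  also have "\<dots> = (\<Prod>i<m. t powi (l i * int (a i))) * (\<Prod>i<m. w i ^ a i)"
    by (rule prod.distrib)
  also have "(\<Prod>i<m. t powi (l i * int (a i))) = t powi wdeg m l a"
  proof -
    have "(\<Prod>i\<in>I. t powi g i) = t powi (\<Sum>i\<in>I. g i)" if "finite I" for I and g :: "nat \<Rightarrow> int"
      using that by (induction I) (auto simp: power_int_add assms)
    then show ?thesis by (simp add: wdeg_def)
  qed
  finally show ?thesis .
qed

lemma torus_mem_W: "w \<in> W \<Longrightarrow> wdeg m l k = 0 \<Longrightarrow> t \<noteq> 0 \<Longrightarrow> torus l t w \<in> W"
  unfolding mem_W
  by (auto simp: prod_torus affine_space_def PiE_def extensional_def) (auto simp: torus_def)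

lemma ymon_wpart: "wdeg m l k = 0 \<Longrightarrow> ymon a \<in> wpart l (wdeg m l a)"
  using ymon_mem[of a] by (simp add: wpart_def ymon_def torus_mem_W prod_torus)

lemma pullback_wpart: "wdeg m l k = 0 \<Longrightarrow> g \<in> A \<Longrightarrow> pullback g \<in> wpart l 0"
  using pullback_mem[of g] by (simp add: wpart_def pullback_def torus_mem_W)

text \<open>A relation between elements of different weights, evaluated along the torus orbit of a
  point, is a Laurent polynomial in t, so all its terms vanish. The monomials provide the
  spanning.\<close>

lemma graded_wpart:
  assumes l: "wdeg m l k = 0"
  shows "graded_algebra B scalars (wpart l)"
proof unfold_locales
  show mult: "a * b \<in> wpart l (i + j)" if "a \<in> wpart l i" "b \<in> wpart l j" for a b i j
    using that by (auto simp: wpart_def B.mult_mem power_int_add fun_apply)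
  fix g :: "int \<Rightarrow> (nat \<Rightarrow> 'k) \<Rightarrow> 'k" and J j
  assume J: "finite J" and g: "\<And>j. j \<in> J \<Longrightarrow> g j \<in> wpart l j" and s: "sum g J = 0" and j: "j \<in> J"
  have sum_apply: "sum g I x = (\<Sum>j\<in>I. g j x)" for I x
    by (induction I rule: infinite_finite_induct) (auto simp: fun_apply)
  show "g j = 0"
  proof
    fix w show "g j w = 0 w"
    proof (cases "w \<in> W")
      case True
      have "(\<Sum>j\<in>J. t powi j * g j w) = 0" if "t \<noteq> 0" for t
      proof -
        have "(\<Sum>j\<in>J. t powi j * g j w) = (\<Sum>j\<in>J. g j (torus l t w))"
          using g True that by (intro sum.cong) (auto simp: wpart_def)
        also have "\<dots> = 0" using s by (metis sum_apply zero_fun_apply)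
        finally show ?thesis .
      qed
      from laurent_zero[OF J this j] show ?thesis by (simp add: fun_apply)
    next
      case False
      then show ?thesis using g[OF j] reg_outside by (auto simp: wpart_def B_def fun_apply)
    qed
  qed
next
  fix b assume "b \<in> B"
  then obtain E where E: "b \<in> mspan E" using ex_mspan by blast
  have zero: "0 \<in> wpart l j" for j by (simp add: wpart_def B.zero_mem fun_apply)
  have add: "a + b \<in> wpart l j" if "a \<in> wpart l j" "b \<in> wpart l j" for a b j
    using that by (auto simp: wpart_def B.add_mem distrib_left fun_apply)
  from E show "\<exists>J g. finite J \<and> (\<forall>j. g j \<in> wpart l j) \<and> (\<forall>j. j \<notin> J \<longrightarrow> g j = 0) \<and> b = sum g J"
  proof induction
    case zero
    then show ?case by (intro exI[of _ "{}"] exI[of _ "\<lambda>j. 0"]) (auto simp: \<open>\<And>j. 0 \<in> wpart l j\<close>)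
  next
    case (mon g a)
    let ?b = "pullback g * ymon a"
    have "?b \<in> wpart l (wdeg m l a)"
      using pullback_wpart[OF l mon(1)] ymon_wpart[OF l, of a]
      by (auto simp: wpart_def B.mult_mem fun_apply)
    then show ?case
      by (intro exI[of _ "{wdeg m l a}"] exI[of _ "\<lambda>j. if j = wdeg m l a then ?b else 0"])
        (auto simp: zero)
  next
    case (add b c)
    then obtain I J g h where g: "finite I" "\<forall>j. g j \<in> wpart l j" "\<forall>j. j \<notin> I \<longrightarrow> g j = 0" "b = sum g I"
      and h: "finite J" "\<forall>j. h j \<in> wpart l j" "\<forall>j. j \<notin> J \<longrightarrow> h j = 0" "c = sum h J"
      by blast
    have "b = sum g (I \<union> J)" unfolding g(4) by (rule sum.mono_neutral_left) (use g h in auto)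
    moreover have "c = sum h (I \<union> J)" unfolding h(4) by (rule sum.mono_neutral_left) (use g h in auto)
    ultimately show ?case
      using g h \<open>\<And>a b j. a \<in> wpart l j \<Longrightarrow> b \<in> wpart l j \<Longrightarrow> a + b \<in> wpart l j\<close>
      by (intro exI[of _ "I \<union> J"] exI[of _ "\<lambda>j. g j + h j"]) (auto simp: sum.distrib)
  qed
qed (auto simp: wpart_def scalars_def B.zero_mem B.add_mem B.scal_mem distrib_left mult_ac fun_apply)

text \<open>Each term \<open>pullback g * ymon a\<close> is homogeneous of weight
  \<open>wdeg m l a\<close>. With weights generic for E the exponents left in one component are
  congruent modulo k, and \<open>mspan_congruent\<close> makes the component a single term.\<close>

lemma hcomp_mspan:
  assumes l: "wdeg m l k = 0" and b: "b \<in> mspan E"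
  shows "graded_algebra.hcomp (wpart l) b j \<in> mspan {a \<in> E. wdeg m l a = j}"
proof -
  interpret graded_algebra B scalars "wpart l" by (rule graded_wpart[OF l])
  from b show ?thesis
  proof induction
    case (mon g a)
    have "pullback g * ymon a \<in> wpart l (wdeg m l a)"
      using G_mult[OF pullback_wpart[OF l mon(1)] ymon_wpart[OF l, of a]] by simp
    then show ?case using mon by (auto simp: hcomp_hom intro: mspan.intros)
  next
    case (add b c)
    then show ?case using mspan_sub by (auto simp: hcomp_add intro: mspan.add)
  qed (auto intro: mspan.zero)
qed

end

section \<open>The coprime case\<close>

context suspension
begin

text \<open>Homogeneous components in generic weights are single terms g y^e, and the product of two
  nonzero ones is nonzero because K[X] is a domain. For d > 1 this can fail: if f is a d-th power,
  the defining equation factors.\<close>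

lemma algebra_domain_B:
  assumes gcd: "Gcd (k ` {..<m}) = 1"
  shows "algebra_domain B scalars"
  unfolding B_def
proof (rule algebra_domain_reg, rule ccontr)
  fix p q assume pq: "p \<in> poly_funs (m + n)" "q \<in> poly_funs (m + n)" and z: "\<forall>w\<in>W. p w * q w = 0"
    and nz: "\<not> ((\<forall>w\<in>W. p w = 0) \<or> (\<forall>w\<in>W. q w = 0))"
  let ?b = "zero_ext W p" and ?c = "zero_ext W q"
  have bc: "?b \<in> B" "?c \<in> B" using pq by (auto simp: B_def reg_def)
  have ne: "?b \<noteq> 0" "?c \<noteq> 0" using nz by (simp_all add: zero_ext_eq_0_iff)
  have prod: "?b * ?c = 0"
    using z by (simp add: zero_ext_mult zero_ext_eq_0_iff)
  obtain E1 E2 where E: "finite E1" "?b \<in> mspan E1" "finite E2" "?c \<in> mspan E2"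
    using ex_mspan[OF bc(1)] ex_mspan[OF bc(2)] by blast
  have fin: "finite (E1 \<union> E2)" using E by simp
  obtain l where l: "wdeg m l k = 0"
    and lE: "\<And>a b. a \<in> E1 \<union> E2 \<Longrightarrow> b \<in> E1 \<union> E2 \<Longrightarrow> wdeg m l a = wdeg m l b \<Longrightarrow>
      \<exists>r. \<forall>i<m. int (a i) - int (b i) = r * int (k i)"
    using generic_weights[OF m k_pos gcd fin] by blast
  interpret graded_algebra B scalars "wpart l" by (rule graded_wpart[OF l])
  obtain i j where ij: "hcomp ?b i \<noteq> 0" "hcomp ?c j \<noteq> 0" "hcomp ?b i * hcomp ?c j = 0"
    using zero_div_hom[OF bc(1) ne(1) bc(2) ne(2) prod] .
  obtain e1 where "\<And>b. b \<in> mspan {a \<in> E1. wdeg m l a = i} \<Longrightarrow> \<exists>g\<in>A. b = pullback g * ymon e1"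
    using mspan_congruent[of "{a \<in> E1. wdeg m l a = i}"] lE E(1) by auto
  then obtain g where g: "g \<in> A" "hcomp ?b i = pullback g * ymon e1"
    using hcomp_mspan[OF l E(2)] by blast
  obtain e2 where "\<And>b. b \<in> mspan {a \<in> E2. wdeg m l a = j} \<Longrightarrow> \<exists>g\<in>A. b = pullback g * ymon e2"
    using mspan_congruent[of "{a \<in> E2. wdeg m l a = j}"] lE E(3) by auto
  then obtain h where h: "h \<in> A" "hcomp ?c j = pullback h * ymon e2"
    using hcomp_mspan[OF l E(4)] by blast
  have "pullback 0 = 0" by (auto simp: pullback_def zero_ext_def fun_eq_iff fun_apply)
  then have "g \<noteq> 0" "h \<noteq> 0" using ij g h by auto
  then have "g * h \<noteq> 0" using A.no_zero_div g h by blast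
  then have "pullback (g * h) * ymon (\<lambda>i. e1 i + e2 i) \<noteq> 0"
    using pullback_ymon_nonzero A.mult_mem g h by blast
  moreover have "pullback (g * h) * ymon (\<lambda>i. e1 i + e2 i) = hcomp ?b i * hcomp ?c j"
    unfolding g(2) h(2) pullback_mult ymon_mult[symmetric] by (simp only: mult_ac)
  ultimately show False using ij by simp
qed

theorem rigid_suspension:
  assumes gcd: "Gcd (k ` {..<m}) = 1" and rigid: "rigid n X"
  shows "rigid (m + n) W"
  unfolding rigid_iff
proof (intro allI impI ballI, rule ccontr)
  fix D b assume D: "lnd (reg (m + n) W) scalars D" and b: "b \<in> reg (m + n) W" "D b \<noteq> 0"
  interpret B: algebra_domain B scalars by (rule algebra_domain_B[OF gcd])
  interpret D: lnd_domain B scalars D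
    using D by (intro lnd_domain.intro B.algebra_domain_axioms) (simp add: B_def)
  let ?one = "zero_ext W (\<lambda>w. 1)" and ?y = "\<lambda>i. zero_ext W (\<lambda>w. w i)"
  define S where "S = insert ?one (?y ` {..<m + n})"
  have finS: "finite S" by (simp add: S_def)
  have SB: "s \<in> B" if "s \<in> S" for s
    using that by (auto simp: S_def B_def reg_def intro!: imageI poly_funs.intros)
  have gen: "Q = B" if "S \<subseteq> Q" "Q \<subseteq> B" "\<And>a b. a \<in> Q \<Longrightarrow> b \<in> Q \<Longrightarrow> a + b \<in> Q"
    "\<And>c b. c \<in> scalars \<Longrightarrow> b \<in> Q \<Longrightarrow> c * b \<in> Q" "\<And>a b. a \<in> Q \<Longrightarrow> b \<in> Q \<Longrightarrow> a * b \<in> Q" for Q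
  proof
    show "B \<subseteq> Q" unfolding B_def
      by (rule reg_generated) (use that in \<open>auto simp: S_def\<close>)
  qed fact
  have "\<exists>E. finite E \<and> D s \<in> mspan E" if "s \<in> S" for s
    using ex_mspan D.D_mem SB that by blast
  then obtain F where F: "\<And>s. s \<in> S \<Longrightarrow> finite (F s) \<and> D s \<in> mspan (F s)"
    by metis
  \<comment> \<open>The weights depend on these exponents and the top degree t on the weights, so E
    has to be fixed before t is known and collects the images of all generators.\<close>
  define E where "E = (\<Union>s\<in>S. F s)"
  have finE: "finite E" using F finS by (auto simp: E_def)
  have DE: "D s \<in> mspan E" if "s \<in> S" for s
    using F[OF that] mspan_mono[of "D s" "F s" E] that by (auto simp: E_def)
  obtain l where l: "wdeg m l k = 0"
    and lE: "\<And>a b. a \<in> E \<Longrightarrow> b \<in> E \<Longrightarrow> wdeg m l a = wdeg m l b \<Longrightarrow>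
      \<exists>r. \<forall>i<m. int (a i) - int (b i) = r * int (k i)"
    using generic_weights[OF m k_pos gcd finE] by blast
  interpret G: graded_lnd B scalars "wpart l" D
    by (intro graded_lnd.intro graded_wpart[OF l] D.lnd_axioms)
  have coord_hom: "?y i \<in> wpart l (if i < m then l i else 0)" if "i < m + n" for i
    using SB[of "?y i"] that by (auto simp: wpart_def S_def torus_mem_W[OF _ l]) (auto simp: torus_def)
  have "\<exists>j. s \<in> wpart l j" if "s \<in> S" for s
    using that coord_hom pullback_wpart[OF l, of "zero_ext X (\<lambda>x. 1)"] ymon_wpart[OF l, of "\<lambda>i. 0"]
    by (auto simp: S_def ymon_0)
  then obtain deg where deg: "\<And>s. s \<in> S \<Longrightarrow> s \<in> wpart l (deg s)"
    using bchoice[of S "\<lambda>s j. s \<in> wpart l j"] by blast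
  have "\<exists>t. (\<forall>j i b. b \<in> wpart l j \<longrightarrow> i > j + t \<longrightarrow> G.hcomp (D b) i = 0)
      \<and> (\<exists>s\<in>S. G.hcomp (D s) (deg s + t) \<noteq> 0)"
  proof (rule G.ex_top_degree[where S = S and deg = deg and b = b])
    show "b \<in> B" "D b \<noteq> 0" using b by (auto simp: B_def)
    show "s \<in> wpart l (deg s)" if "s \<in> S" for s using that by (rule deg)
    show "Q = B" if "S \<subseteq> Q" "Q \<subseteq> B" "\<And>a b. a \<in> Q \<Longrightarrow> b \<in> Q \<Longrightarrow> a + b \<in> Q"
      "\<And>c b. c \<in> scalars \<Longrightarrow> b \<in> Q \<Longrightarrow> c * b \<in> Q" "\<And>a b. a \<in> Q \<Longrightarrow> b \<in> Q \<Longrightarrow> a * b \<in> Q" for Q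
      using that by (rule gen)
    show ?thesis if "\<And>j i b. b \<in> wpart l j \<Longrightarrow> i > j + t \<Longrightarrow> G.hcomp (D b) i = 0" "s \<in> S"
      "G.hcomp (D s) (deg s + t) \<noteq> 0" for t s
      using that by blast
  qed (rule finS)
  then obtain t s where bound: "\<And>j i b. b \<in> wpart l j \<Longrightarrow> i > j + t \<Longrightarrow> G.hcomp (D b) i = 0"
    and s: "s \<in> S" "G.hcomp (D s) (deg s + t) \<noteq> 0"
    by blast
  let ?T = "G.top_part t"
  interpret T: lnd_domain B scalars ?T
    by (intro lnd_domain.intro B.algebra_domain_axioms G.lnd_top_part[OF bound])
  have Ts: "?T s \<noteq> 0" using s G.top_part_hom[OF deg[OF s(1)]] by simp
  have T_one: "?T ?one = 0"
    by (rule T.D_idempotent) (use SB in \<open>auto simp: S_def zero_ext_mult\<close>)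
  \<comment> \<open>Coordinates on X have weight 0, so the top part sends them to weight t. The
    exponents of E in that weight are congruent modulo k, which gives one e for all
    coordinates.\<close>
  obtain e where e: "\<And>b. b \<in> mspan {a \<in> E. wdeg m l a = t} \<Longrightarrow> \<exists>g\<in>A. b = pullback g * ymon e"
    using mspan_congruent[of "{a \<in> E. wdeg m l a = t}"] lE finE by auto
  have scal: "pullback (c * g) = c * pullback g \<and> c \<in> scalars" if c: "c \<in> scalars" "g \<in> A" for c g
  proof -
    obtain c' where "c = (\<lambda>x. c')" using c(1) unfolding scalars_def by blast
    then show ?thesis using c by (simp add: pullback_scal)
  qed
  \<comment> \<open>K[X] y^e is stable under multiplication by K[X], so by the product rule the
    generators of K[X] suffice.\<close>
  have T_pullback: "\<exists>h\<in>A. ?T (pullback g) = pullback h * ymon e" if "g \<in> A" for g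
  proof -
    have "reg n X \<subseteq> {g \<in> A. \<exists>h\<in>A. ?T (pullback g) = pullback h * ymon e}"
    proof (rule reg_generated; safe)
      show "zero_ext X (\<lambda>x. 1) \<in> A" by (auto simp: A_def reg_def intro!: imageI poly_funs.const)
      have "pullback 0 = 0" by (auto simp: pullback_def zero_ext_def fun_eq_iff fun_apply)
      then show "\<exists>h\<in>A. ?T (pullback (zero_ext X (\<lambda>x. 1))) = pullback h * ymon e"
        using T_one A.zero_mem by (intro bexI[of _ 0]) (auto simp: pullback_one)
    next
      fix i assume i: "i < n"
      show xA: "zero_ext X (\<lambda>x. x i) \<in> A"
        using i by (auto simp: A_def reg_def intro!: imageI poly_funs.coord)
      have eq: "pullback (zero_ext X (\<lambda>x. x i)) = ?y (m + i)"
        by (simp add: pullback_zero_ext proj_def)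
      have "?T (?y (m + i)) = G.hcomp (D (?y (m + i))) (0 + t)"
        by (rule G.top_part_hom) (use pullback_wpart[OF l xA] in \<open>simp add: eq\<close>)
      also have "\<dots> \<in> mspan {a \<in> E. wdeg m l a = t}"
        using hcomp_mspan[OF l DE, of "?y (m + i)" t] i by (simp add: S_def)
      finally show "\<exists>h\<in>A. ?T (pullback (zero_ext X (\<lambda>x. x i))) = pullback h * ymon e"
        using e by (simp add: eq)
    next
      fix a b g h assume gh: "a \<in> A" "b \<in> A" "g \<in> A" "h \<in> A"
        "?T (pullback a) = pullback g * ymon e" "?T (pullback b) = pullback h * ymon e"
      show "a + b \<in> A" "a * b \<in> A" using gh A.add_mem A.mult_mem by auto
      have "?T (pullback (a + b)) = pullback (g + h) * ymon e"
        using gh by (simp add: pullback_add T.D_add pullback_mem distrib_right)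
      then show "\<exists>h\<in>A. ?T (pullback (a + b)) = pullback h * ymon e"
        using gh A.add_mem by blast
      have "?T (pullback (a * b)) = pullback (a * h + b * g) * ymon e"
        using gh by (simp add: pullback_add pullback_mult T.D_mult pullback_mem algebra_simps)
      then show "\<exists>h\<in>A. ?T (pullback (a * b)) = pullback h * ymon e"
        using gh A.add_mem A.mult_mem by blast
    next
      fix c a g :: "(nat \<Rightarrow> 'k) \<Rightarrow> 'k"
      assume c: "c \<in> scalars" and g: "a \<in> A" "g \<in> A" "?T (pullback a) = pullback g * ymon e"
      show "c * a \<in> A" using A.scal_mem c g by auto
      have "?T (pullback (c * a)) = c * ?T (pullback a)"
        using scal[OF c g(1)] T.D_scal[OF c pullback_mem[OF g(1)]] by simp
      also have "\<dots> = pullback (c * g) * ymon e"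
        using scal[OF c g(2)] g(3) by (simp add: mult.assoc)
      finally have "?T (pullback (c * a)) = pullback (c * g) * ymon e" .
      then show "\<exists>h\<in>A. ?T (pullback (c * a)) = pullback h * ymon e"
        using A.scal_mem c g by blast
    qed
    with that show ?thesis by (auto simp: A_def)
  qed
  have "\<exists>\<delta>. lnd A scalars \<delta> \<and> (\<forall>g\<in>A. ?T (pullback g) = pullback (\<delta> g) * ymon e)"
  proof (rule T.lnd_quotient[of A scalars pullback "\<lambda>c. c" "ymon e"])
    show "subalgebra A scalars" by (rule A.subalgebra_axioms)
    show "pullback g \<in> B" if "g \<in> A" for g using that by (rule pullback_mem)
    show "g = 0" if "g \<in> A" "pullback g = 0" for g using that by (rule pullback_inj)
    show "\<exists>h\<in>A. ?T (pullback g) = pullback h * ymon e" if "g \<in> A" for g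
      using that by (rule T_pullback)
    show "pullback (c * g) = c * pullback g \<and> c \<in> scalars" if "c \<in> scalars" "g \<in> A" for c g
      using that by (rule scal)
    show "\<exists>\<delta>. lnd A scalars \<delta> \<and> (\<forall>g\<in>A. ?T (pullback g) = pullback (\<delta> g) * ymon e)"
      if "lnd A scalars \<delta>" "\<And>g. g \<in> A \<Longrightarrow> ?T (pullback g) = pullback (\<delta> g) * ymon e" for \<delta>
      using that by auto
  qed (rule pullback_add pullback_mult ymon_mem ymon_nonzero)+
  then obtain \<delta> where \<delta>: "lnd A scalars \<delta>" "\<And>g. g \<in> A \<Longrightarrow> ?T (pullback g) = pullback (\<delta> g) * ymon e"
    by auto
  have "\<delta> g = 0" if "g \<in> A" for g
    using rigid \<delta>(1) that unfolding rigid_iff A_def by blast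
  moreover have "pullback 0 = 0" by (auto simp: pullback_def zero_ext_def fun_eq_iff fun_apply)
  ultimately have T0: "?T (pullback g) = 0" if "g \<in> A" for g
    using that \<delta>(2) by simp
  have fA: "zero_ext X f \<in> A" using f by (simp add: A_def reg_def)
  have T_y: "?T (?y i) = 0" if i: "i < m + n" for i
  proof (cases "i < m")
    case True
    let ?a = "\<lambda>j. if j = i then 1 else 0 :: nat" and ?r = "\<lambda>j. if j = i then k j - 1 else k j"
    have "(\<Prod>j<m. w j ^ ?a j) = w i" for w :: "nat \<Rightarrow> 'k"
    proof -
      have "(\<Prod>j<m. w j ^ ?a j) = (\<Prod>j<m. if j = i then w j else 1)"
        by (rule prod.cong) auto
      then show ?thesis using True by simp
    qed
    then have y: "?y i = ymon ?a" by (simp only: ymon_def)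
    \<comment> \<open>y_i times the complementary monomial is y^k = f, which the top part kills, and
      its kernel is factorially closed.\<close>
    have "ymon ?a * ymon ?r = ymon k"
      unfolding ymon_mult using k_pos[OF True] by (intro arg_cong[of _ _ ymon]) auto
    then show ?thesis
      using T.D_eq_0_factor(1)[OF ymon_mem ymon_mem, of ?a ?r] ymon_nonzero[of k] T0[OF fA] ymon_k y
      by simp
  next
    case False
    then have "?y i = pullback (zero_ext X (\<lambda>x. x (i - m)))"
      by (simp add: pullback_zero_ext proj_def)
    moreover have "zero_ext X (\<lambda>x. x (i - m)) \<in> A"
      using i False by (auto simp: A_def reg_def intro!: imageI poly_funs.coord)
    ultimately show ?thesis using T0 by simp
  qed
  show False using Ts s(1) T_one T_y by (auto simp: S_def)
qed

end

section \<open>Principal open subsets of affine space\<close>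

lemma card_roots_of_unity:
  assumes d: "d > 0"
  shows "card {x :: 'k :: {alg_closed_field, field_char_0}. x ^ d = 1} = d"
    and "finite {x :: 'k. x ^ d = 1}"
proof -
  define p :: "'k poly" where "p = monom 1 d - 1"
  have deg: "degree p = d"
  proof -
    have "degree p = degree (monom (1::'k) d)"
      unfolding p_def diff_conv_add_uminus by (rule degree_add_eq_left) (use d in \<open>simp add: degree_monom_eq\<close>)
    then show ?thesis by (simp add: degree_monom_eq)
  qed
  have p0: "p \<noteq> 0" using deg d by auto
  have roots: "poly p x = 0 \<longleftrightarrow> x ^ d = 1" for x by (simp add: p_def poly_monom)
  obtain A where A: "size A = degree p" "p = Polynomial.smult (lead_coeff p) (\<Prod>x\<in>#A. [:-x, 1:])"
    using alg_closed_imp_factorization[OF p0] by blast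
  have rA: "poly p x = 0 \<longleftrightarrow> x \<in># A" for x
  proof -
    have "poly p x = lead_coeff p * (\<Prod>y\<in>#A. x - y)"
      by (subst A(2)) (simp add: poly_prod_mset)
    then show ?thesis using p0 by (auto simp: prod_mset_zero_iff)
  qed
  \<comment> \<open>A double root of p would be a root of its derivative d x^(d-1), which does not
    vanish where x^d = 1.\<close>
  have "count A x \<le> 1" for x
  proof (rule ccontr)
    assume "\<not> count A x \<le> 1"
    then have "replicate_mset 2 x \<subseteq># A"
      by (simp flip: count_le_replicate_mset_subset_eq)
    then obtain C where C: "A = replicate_mset 2 x + C"
      by (auto simp: mset_subset_eq_exists_conv)
    have "x ^ d = 1" using rA[of x] roots C by simp
    then have x: "x \<noteq> 0" using d by (auto simp: power_0_left)
    have "p = [:-x, 1:] * ([:-x, 1:] * Polynomial.smult (lead_coeff p) (\<Prod>x\<in>#C. [:-x, 1:]))"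
      by (subst A(2)) (simp add: C numeral_2_eq_2 mult.assoc)
    then obtain q where "p = [:-x, 1:] * ([:-x, 1:] * q)" by blast
    moreover have "poly (pderiv (l * (l * q))) x = 0" if "poly l x = 0" for l
      using that by (simp add: pderiv_mult)
    from this[of "[:-x, 1:]"] have "poly (pderiv ([:-x, 1:] * ([:-x, 1:] * q))) x = 0"
      by simp
    ultimately have "poly (pderiv p) x = 0" by argo
    moreover have "poly (pderiv p) x = of_nat d * x ^ (d - 1)"
      by (simp add: p_def pderiv_diff pderiv_monom poly_monom)
    ultimately show False using x d by simp
  qed
  have "A = mset_set (set_mset A)"
  proof (intro multiset_eqI)
    fix x
    show "count A x = count (mset_set (set_mset A)) x"
    proof (cases "x \<in># A")
      case True
      then have "count A x \<ge> 1" by (simp add: Suc_le_eq)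
      with \<open>\<And>x. count A x \<le> 1\<close> True show ?thesis by (simp add: le_antisym)
    next
      case False
      then show ?thesis by (simp add: not_in_iff)
    qed
  qed
  then have "card (set_mset A) = d" using A(1) deg size_mset_set[of "set_mset A"] by simp
  moreover have "{x. x ^ d = 1} = set_mset A" using rA roots by auto
  ultimately show "card {x :: 'k. x ^ d = 1} = d" "finite {x :: 'k. x ^ d = 1}" by auto
qed

text \<open>For d not dividing j some root z has z^j different from 1, and multiplication by z
  permutes the roots, so the sum equals z^j times itself.\<close>

lemma sum_roots_of_unity:
  fixes d j :: nat
  assumes d: "d > 0"
  shows "(\<Sum>x | x ^ d = (1 :: 'k :: {alg_closed_field, field_char_0}). x ^ j) = (if d dvd j then of_nat d else 0)"
proof (cases "d dvd j")
  case True
  then have "(\<Sum>x | x ^ d = (1 :: 'k). x ^ j) = (\<Sum>x | x ^ d = (1 :: 'k). 1)"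
    by (intro sum.cong) (auto simp: power_mult)
  then show ?thesis using True card_roots_of_unity[OF d, where ?'k = 'k] by simp
next
  case False
  let ?U = "{x :: 'k. x ^ d = 1}"
  let ?g = "gcd d j"
  have g: "?g > 0" "?g < d"
    using d False by (auto simp: gcd_pos_nat intro!: le_neq_implies_less gcd_le1_nat)
      (metis gcd_dvd2)
  \<comment> \<open>If all z^j were 1, Bezout would turn every d-th root of unity into a root of x^g
    = 1 with g = gcd d j < d, which has too few roots.\<close>
  obtain z where z: "z \<in> ?U" "z ^ j \<noteq> 1"
  proof (rule ccontr)
    assume "\<not> thesis"
    then have all: "\<forall>z\<in>?U. z ^ j = 1" using that by blast
    obtain a b where ab: "d * a = j * b + ?g" using bezout_nat[of d j] d by auto
    have "?U \<subseteq> {x. x ^ ?g = 1}"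
    proof
      fix x assume x: "x \<in> ?U"
      have "x ^ (d * a) = 1" using x by (simp add: power_mult)
      moreover have "x ^ (j * b) = 1" using x all by (simp add: power_mult)
      ultimately show "x \<in> {x. x ^ ?g = 1}" by (simp add: ab power_add)
    qed
    then have "card ?U \<le> card {x :: 'k. x ^ ?g = 1}"
      by (rule card_mono[OF card_roots_of_unity(2)[OF g(1)]])
    then show False using card_roots_of_unity(1)[OF g(1), where ?'k = 'k]
        card_roots_of_unity(1)[OF d, where ?'k = 'k] g(2) by simp
  qed
  have z0: "z \<noteq> 0" using z d by (auto simp: power_0_left)
  have bij: "bij_betw (\<lambda>x. z * x) ?U ?U"
    using z z0 by (intro bij_betwI[of _ _ _ "\<lambda>x. x / z"]) (auto simp: power_mult_distrib power_divide)
  have "(\<Sum>x\<in>?U. x ^ j) = (\<Sum>x\<in>?U. (z * x) ^ j)"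
    by (rule sum.reindex_bij_betw[OF bij, symmetric])
  also have "\<dots> = z ^ j * (\<Sum>x\<in>?U. x ^ j)"
    by (simp add: power_mult_distrib sum_distrib_left)
  finally show ?thesis using z(2) False by auto
qed

text \<open>The last coordinate n is set apart as a variable t. It later plays the inverse of
  \<open>S\<close>, the d-th root of u, and the time of a flow.\<close>

lemma poly_funs_expand:
  assumes "p \<in> poly_funs (Suc n)"
  shows "\<exists>M c. (\<forall>i. c i \<in> poly_funs n) \<and> (\<forall>x t. p (x(n := t)) = (\<Sum>i<M. c i x * t ^ i))"
  using assms
proof induction
  case (const a)
  show ?case
    by (intro exI[of _ "1 :: nat"] exI[of _ "\<lambda>_ _. a"]) (auto intro: poly_funs.const)
next
  case (coord i)
  show ?case
  proof (cases "i = n")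
    case True
    then show ?thesis
      by (intro exI[of _ "2 :: nat"] exI[of _ "\<lambda>i _. if i = 1 then 1 else 0"])
        (auto intro: poly_funs.const simp: numeral_2_eq_2)
  next
    case False
    then show ?thesis using coord
      by (intro exI[of _ "1 :: nat"] exI[of _ "\<lambda>_ x. x i"]) (auto intro: poly_funs.coord)
  qed
next
  case (add p q)
  then obtain M c N e where c: "\<forall>i. c i \<in> poly_funs n" "\<forall>x t. p (x(n := t)) = (\<Sum>i<M. c i x * t ^ i)"
    and e: "\<forall>i. e i \<in> poly_funs n" "\<forall>x t. q (x(n := t)) = (\<Sum>i<N. e i x * t ^ i)"
    by blast
  define c' e' where "c' = (\<lambda>i x. if i < M then c i x else 0)" and "e' = (\<lambda>i x. if i < N then e i x else 0)"
  have z: "(\<lambda>x. 0) \<in> poly_funs n" by (rule poly_funs.const)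
  have [intro]: "c' i \<in> poly_funs n" for i
    using c(1) z by (cases "i < M") (simp_all add: c'_def)
  have [intro]: "e' i \<in> poly_funs n" for i
    using e(1) z by (cases "i < N") (simp_all add: e'_def)
  have "(\<Sum>i<M. c i x * t ^ i) = (\<Sum>i<max M N. c' i x * t ^ i)" for x t
    unfolding c'_def by (rule sum.mono_neutral_cong_left) auto
  moreover have "(\<Sum>i<N. e i x * t ^ i) = (\<Sum>i<max M N. e' i x * t ^ i)" for x t
    unfolding e'_def by (rule sum.mono_neutral_cong_left) auto
  ultimately show ?case using c(2) e(2)
    by (intro exI[of _ "max M N"] exI[of _ "\<lambda>i x. c' i x + e' i x"])
      (auto intro: poly_funs.add simp: sum.distrib distrib_right simp del: fun_upd_apply)
next
  case (mult p q)
  then obtain M c N e where c: "\<forall>i. c i \<in> poly_funs n" "\<forall>x t. p (x(n := t)) = (\<Sum>i<M. c i x * t ^ i)"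
    and e: "\<forall>i. e i \<in> poly_funs n" "\<forall>x t. q (x(n := t)) = (\<Sum>i<N. e i x * t ^ i)"
    by blast
  define g where "g r x = (\<Sum>(i, j) \<in> {(i, j). i < M \<and> j < N \<and> i + j = r}. c i x * e j x)" for r x
  have fin: "finite {(i, j). i < M \<and> j < N \<and> i + j = r}" for r
    by (rule finite_subset[of _ "{..<M} \<times> {..<N}"]) auto
  have "g r \<in> poly_funs n" for r
    unfolding g_def[abs_def] case_prod_beta
    by (intro poly_funs_sum poly_funs.mult) (use c e in auto)
  moreover have "p (x(n := t)) * q (x(n := t)) = (\<Sum>r<M + N. g r x * t ^ r)" for x t
  proof -
    have "(\<Sum>r<M + N. g r x * t ^ r)
        = (\<Sum>r<M + N. \<Sum>(i, j) \<in> {(i, j). i < M \<and> j < N \<and> i + j = r}. c i x * t ^ i * (e j x * t ^ j))"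
      unfolding g_def sum_distrib_right by (intro sum.cong refl) (auto simp: power_add mult_ac)
    also have "\<dots> = (\<Sum>(i, j) \<in> {..<M} \<times> {..<N}. c i x * t ^ i * (e j x * t ^ j))"
    proof -
      have "(\<Sum>r<M + N. \<Sum>ij \<in> {ij \<in> {..<M} \<times> {..<N}. fst ij + snd ij = r}. c (fst ij) x * t ^ fst ij * (e (snd ij) x * t ^ snd ij))
          = (\<Sum>ij \<in> {..<M} \<times> {..<N}. c (fst ij) x * t ^ fst ij * (e (snd ij) x * t ^ snd ij))"
        by (rule sum.group) auto
      moreover have "{ij \<in> {..<M} \<times> {..<N}. fst ij + snd ij = r} = {(i, j). i < M \<and> j < N \<and> i + j = r}" for r
        by auto
      ultimately show ?thesis by (simp add: case_prod_beta)
    qed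
    also have "\<dots> = (\<Sum>i<M. c i x * t ^ i) * (\<Sum>j<N. e j x * t ^ j)"
      by (simp add: sum_product sum.cartesian_product)
    finally show ?thesis using c(2) e(2) by simp
  qed
  ultimately show ?case by blast
qed

lemma poly_funs_line:
  assumes "p \<in> poly_funs n"
  shows "\<exists>P. \<forall>t. poly P t = p (\<lambda>i. a i + t * (b i - a i))"
  using assms
proof induction
  case (const c)
  show ?case by (intro exI[of _ "[:c:]"]) simp
next
  case (coord i)
  show ?case by (intro exI[of _ "[:a i, b i - a i:]"]) simp
next
  case (add p q)
  then obtain P Q where "\<forall>t. poly P t = p (\<lambda>i. a i + t * (b i - a i))"
    "\<forall>t. poly Q t = q (\<lambda>i. a i + t * (b i - a i))" by blast
  then show ?case by (intro exI[of _ "P + Q"]) simp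
next
  case (mult p q)
  then obtain P Q where "\<forall>t. poly P t = p (\<lambda>i. a i + t * (b i - a i))"
    "\<forall>t. poly Q t = q (\<lambda>i. a i + t * (b i - a i))" by blast
  then show ?case by (intro exI[of _ "P * Q"]) simp
qed

text \<open>On the line from a point with p nonzero to a point with q nonzero both functions
  restrict to nonzero polynomials in one variable.\<close>

lemma poly_funs_no_zero_div:
  fixes p q :: "(nat \<Rightarrow> 'k :: field_char_0) \<Rightarrow> 'k"
  assumes p: "p \<in> poly_funs n" and q: "q \<in> poly_funs n" and pq: "\<And>x. p x * q x = 0"
  shows "(\<forall>x. p x = 0) \<or> (\<forall>x. q x = 0)"
proof (rule ccontr)
  assume "\<not> ?thesis"
  then obtain a b where ab: "p a \<noteq> 0" "q b \<noteq> 0" by blast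
  obtain P where P: "\<And>t. poly P t = p (\<lambda>i. a i + t * (b i - a i))" using poly_funs_line[OF p] by blast
  obtain Q where Q: "\<And>t. poly Q t = q (\<lambda>i. a i + t * (b i - a i))" using poly_funs_line[OF q] by blast
  have "poly (P * Q) t = 0" for t using P Q pq by simp
  then have "P * Q = 0" using poly_all_0_iff_0 by blast
  moreover have "poly P 0 \<noteq> 0" "poly Q 1 \<noteq> 0" using P[of 0] Q[of 1] ab by auto
  then have "P \<noteq> 0" "Q \<noteq> 0" by auto
  ultimately show False by simp
qed

locale principal_open =
  fixes n :: nat and S :: "(nat \<Rightarrow> 'k :: field_char_0) \<Rightarrow> 'k"
  assumes S: "S \<in> poly_funs n" and S_nonzero: "\<exists>x. S x \<noteq> 0"
begin

text \<open>The Rabinowitsch model of the open set where \<open>S\<close> is nonzero: the last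
  coordinate is the inverse of \<open>S\<close>, which thereby becomes a unit on a closed
  set.\<close>

definition X where "X = {x \<in> affine_space (Suc n). x n * S x = 1}"

definition point :: "(nat \<Rightarrow> 'k) \<Rightarrow> nat \<Rightarrow> 'k" where
  "point x = (\<lambda>i. if i < n then x i else if i = n then 1 / S x else undefined)"

lemma S_point [simp]: "S (point x) = S x"
  by (rule poly_funs_cong[OF S]) (simp add: point_def)

lemma point_mem: "S x \<noteq> 0 \<Longrightarrow> point x \<in> X"
  by (auto simp: X_def affine_space_def PiE_def extensional_def) (auto simp: point_def)

lemma S_X: "x \<in> X \<Longrightarrow> S x \<noteq> 0"
  by (auto simp: X_def)

lemma point_X:
  assumes "x \<in> X"
  shows "point x = x"
proof
  fix i
  have "x n = 1 / S x" using assms S_X[OF assms] by (simp add: X_def field_simps)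
  then show "point x i = x i"
    using assms by (auto simp: X_def affine_space_def PiE_def extensional_def point_def)
qed

text \<open>Functions on the open set are polynomials divided by powers of \<open>S\<close>. All
  large r are allowed, so that finitely many functions can be given one common denominator.\<close>

lemma clear_denominators:
  assumes "p \<in> poly_funs (Suc n)"
  shows "\<exists>M. \<forall>r\<ge>M. \<exists>q\<in>poly_funs n. \<forall>x. S x \<noteq> 0 \<longrightarrow> p (point x) * S x ^ r = q x"
proof -
  obtain M c where c: "\<And>i. c i \<in> poly_funs n" "\<And>x t. p (x(n := t)) = (\<Sum>i<M. c i x * t ^ i)"
    using poly_funs_expand[OF assms] by blast
  show ?thesis
  proof (intro exI[of _ M] allI impI)
    fix r assume r: "M \<le> r"
    show "\<exists>q\<in>poly_funs n. \<forall>x. S x \<noteq> 0 \<longrightarrow> p (point x) * S x ^ r = q x"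
    proof (intro bexI[of _ "\<lambda>x. \<Sum>i<M. c i x * S x ^ (r - i)"] allI impI)
      fix x assume x: "S x \<noteq> 0"
      have "p (point x) = p (x(n := 1 / S x))"
        by (rule poly_funs_cong[OF assms]) (auto simp: point_def)
      then have "p (point x) * S x ^ r = (\<Sum>i<M. c i x * (1 / S x) ^ i * S x ^ r)"
        by (simp add: c(2) sum_distrib_right)
      also have "\<dots> = (\<Sum>i<M. c i x * S x ^ (r - i))"
        using r x by (intro sum.cong) (auto simp: power_diff power_one_over field_simps)
      finally show "p (point x) * S x ^ r = (\<Sum>i<M. c i x * S x ^ (r - i))" .
    qed (intro poly_funs_sum poly_funs.mult poly_funs_power c S)
  qed
qed

lemma no_zero_div:
  assumes p: "p \<in> poly_funs (Suc n)" and q: "q \<in> poly_funs (Suc n)" and pq: "\<forall>x\<in>X. p x * q x = 0"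
  shows "(\<forall>x\<in>X. p x = 0) \<or> (\<forall>x\<in>X. q x = 0)"
proof -
  obtain r p' where p': "p' \<in> poly_funs n" "\<And>x. S x \<noteq> 0 \<Longrightarrow> p (point x) * S x ^ r = p' x"
    using clear_denominators[OF p] by blast
  obtain s q' where q': "q' \<in> poly_funs n" "\<And>x. S x \<noteq> 0 \<Longrightarrow> q (point x) * S x ^ s = q' x"
    using clear_denominators[OF q] by blast
  \<comment> \<open>The factor \<open>S x\<close> covers the points outside the open set, where
    nothing is known about p' and q'.\<close>
  have "S x * (p' x * q' x) = 0" for x
    using p'(2)[of x] q'(2)[of x] pq point_mem[of x] by (cases "S x = 0") auto
  then have "(\<forall>x. S x = 0) \<or> (\<forall>x. p' x * q' x = 0)"
    by (intro poly_funs_no_zero_div[OF S poly_funs.mult[OF p'(1) q'(1)]])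
  then have "(\<forall>x. p' x = 0) \<or> (\<forall>x. q' x = 0)"
    using S_nonzero poly_funs_no_zero_div[OF p'(1) q'(1)] by blast
  moreover have "p x * S x ^ r = p' x" "q x * S x ^ s = q' x" if "x \<in> X" for x
    using p'(2)[OF S_X[OF that]] q'(2)[OF S_X[OF that]] point_X[OF that] by auto
  ultimately show ?thesis using S_X by (metis mult_eq_0_iff power_eq_0_iff)
qed

lemma affine_variety_X: "affine_variety (Suc n) X"
  unfolding affine_variety_def
proof (intro conjI allI impI)
  have "(\<lambda>x. x n * S x - 1) \<in> poly_funs (Suc n)"
    by (intro poly_funs_diff poly_funs.mult poly_funs.const poly_funs.coord poly_funs_mono[OF S]) auto
  then show "algebraic_set (Suc n) X"
    unfolding algebraic_set_def by (intro exI[of _ "{\<lambda>x. x n * S x - 1}"]) (auto simp: X_def)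
  show "X \<noteq> {}" using S_nonzero point_mem by blast
  fix Y Z assume YZ: "algebraic_set (Suc n) Y \<and> algebraic_set (Suc n) Z \<and> X = Y \<union> Z"
  then obtain P Q where P: "P \<subseteq> poly_funs (Suc n)" "Y = {x \<in> affine_space (Suc n). \<forall>p\<in>P. p x = 0}"
    and Q: "Q \<subseteq> poly_funs (Suc n)" "Z = {x \<in> affine_space (Suc n). \<forall>p\<in>Q. p x = 0}"
    by (auto simp: algebraic_set_def)
  have XA: "X \<subseteq> affine_space (Suc n)" by (auto simp: X_def)
  show "X = Y \<or> X = Z"
  proof (rule ccontr)
    assume "\<not> ?thesis"
    then obtain a b where ab: "a \<in> X" "a \<notin> Y" "b \<in> X" "b \<notin> Z" using YZ by blast
    then obtain p q where pq: "p \<in> P" "p a \<noteq> 0" "q \<in> Q" "q b \<noteq> 0"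
      using P(2) Q(2) XA by blast
    have "\<forall>x\<in>X. p x * q x = 0" using YZ P(2) Q(2) pq by auto
    then have "(\<forall>x\<in>X. p x = 0) \<or> (\<forall>x\<in>X. q x = 0)"
      using no_zero_div pq P(1) Q(1) by blast
    then show False using ab pq by blast
  qed
qed

end

section \<open>The norm form\<close>

locale reg_lnd = lnd_domain "reg n X" scalars D
  for n and X :: "(nat \<Rightarrow> 'k :: field_char_0) set" and D
begin

text \<open>The value at x of exp(t D) b as a polynomial in t: the function b along the orbit of x
  under the action generated by D.\<close>

definition orbit :: "((nat \<Rightarrow> 'k) \<Rightarrow> 'k) \<Rightarrow> (nat \<Rightarrow> 'k) \<Rightarrow> 'k poly" where
  "orbit b x = (\<Sum>i<nil_index b. monom ((D ^^ i) b x / fact i) i)"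

lemma coeff_orbit:
  assumes "b \<in> reg n X"
  shows "coeff (orbit b x) i = (D ^^ i) b x / fact i"
proof -
  have "coeff (orbit b x) i = (if i < nil_index b then (D ^^ i) b x / fact i else 0)"
    by (simp add: orbit_def coeff_sum)
  moreover have "(D ^^ i) b x = 0" if "\<not> i < nil_index b"
    using funpow_eq_0_iff[OF assms, of i] that by (simp add: fun_apply)
  ultimately show ?thesis by auto
qed

lemma degree_orbit: "b \<in> reg n X \<Longrightarrow> nil_index b \<le> Suc r \<Longrightarrow> degree (orbit b x) \<le> r"
proof (intro degree_le allI impI)
  fix i assume b: "b \<in> reg n X" "nil_index b \<le> Suc r" and "r < i"
  then have "(D ^^ i) b = 0" using funpow_eq_0_iff[OF b(1), of i] by simp
  then show "coeff (orbit b x) i = 0" by (simp add: coeff_orbit[OF b(1)] fun_apply)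
qed

lemma orbit_add: "a \<in> reg n X \<Longrightarrow> b \<in> reg n X \<Longrightarrow> orbit (a + b) x = orbit a x + orbit b x"
  by (intro poly_eqI) (simp add: coeff_orbit add_mem funpow_add_distrib fun_apply add_divide_distrib)

lemma orbit_scal: "b \<in> reg n X \<Longrightarrow> orbit ((\<lambda>x. c) * b) x = Polynomial.smult c (orbit b x)"
proof (intro poly_eqI)
  fix i assume b: "b \<in> reg n X"
  have c: "(\<lambda>x. c) \<in> (scalars :: ((nat \<Rightarrow> 'k) \<Rightarrow> 'k) set)" by (simp add: scalars_def)
  show "coeff (orbit ((\<lambda>x. c) * b) x) i = coeff (Polynomial.smult c (orbit b x)) i"
    using funpow_scal[OF c b, of i] by (simp add: coeff_orbit scal_mem[OF c b] b fun_apply)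
qed

lemma orbit_mult:
  assumes a: "a \<in> reg n X" and b: "b \<in> reg n X"
  shows "orbit (a * b) x = orbit a x * orbit b x"
proof (intro poly_eqI)
  fix r
  have sum_apply: "(\<Sum>i\<in>I. g i) x = (\<Sum>i\<in>I. g i x)" for I :: "nat set" and g :: "nat \<Rightarrow> (nat \<Rightarrow> 'k) \<Rightarrow> 'k"
    by (induction I rule: infinite_finite_induct) (auto simp: fun_apply)
  have "coeff (orbit (a * b) x) r
      = (\<Sum>i\<le>r. of_nat (r choose i) * ((D ^^ i) a x * (D ^^ (r - i)) b x)) / fact r"
    by (simp add: coeff_orbit mult_mem a b Leibniz sum_apply fun_apply of_nat_fun)
  also have "\<dots> = (\<Sum>i\<le>r. (D ^^ i) a x / fact i * ((D ^^ (r - i)) b x / fact (r - i)))"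
    unfolding sum_divide_distrib
    by (intro sum.cong) (auto simp: binomial_fact field_simps)
  also have "\<dots> = coeff (orbit a x * orbit b x) r"
    by (simp add: coeff_mult coeff_orbit a b)
  finally show "coeff (orbit (a * b) x) r = coeff (orbit a x * orbit b x) r" .
qed

lemma orbit_killed: "b \<in> reg n X \<Longrightarrow> D b = 0 \<Longrightarrow> orbit b x = [:b x:]"
proof (intro poly_eqI)
  fix i assume b: "b \<in> reg n X" "D b = 0"
  have "(D ^^ i) b = 0" if "i > 0"
    using b that by (cases i) (simp_all add: funpow_swap1)
  then show "coeff (orbit b x) i = coeff [:b x:] i"
    by (cases i) (auto simp: coeff_orbit[OF b(1)] fun_apply)
qed

lemma one_mem: "zero_ext X (\<lambda>x. 1) \<in> reg n X"
  unfolding reg_def by (intro imageI poly_funs.const)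

lemma D_one: "D (zero_ext X (\<lambda>x. 1)) = 0"
  by (rule D_idempotent[OF one_mem]) (simp add: zero_ext_mult)

text \<open>exp(s D) is an algebra homomorphism, so it is enough to move the coordinates.\<close>

lemma poly_orbit:
  assumes "p \<in> poly_funs n" and x: "x \<in> X"
  shows "poly (orbit (zero_ext X p) x) s = p (\<lambda>i. poly (orbit (zero_ext X (\<lambda>x. x i)) x) s)"
  using assms(1)
proof induction
  case (const c)
  have "zero_ext X (\<lambda>x. c) = (\<lambda>x. c) * zero_ext X (\<lambda>x. 1)" by (simp add: zero_ext_scal)
  then show ?case using x by (simp add: orbit_scal one_mem orbit_killed[OF one_mem D_one])
next
  case (add p q)
  then have "zero_ext X p \<in> reg n X" "zero_ext X q \<in> reg n X" by (auto simp: reg_def)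
  then have "orbit (zero_ext X (\<lambda>x. p x + q x)) x = orbit (zero_ext X p) x + orbit (zero_ext X q) x"
    unfolding zero_ext_add[symmetric] by (rule orbit_add)
  then show ?case using add by simp
next
  case (mult p q)
  then have "zero_ext X p \<in> reg n X" "zero_ext X q \<in> reg n X" by (auto simp: reg_def)
  then have "orbit (zero_ext X (\<lambda>x. p x * q x)) x = orbit (zero_ext X p) x * orbit (zero_ext X q) x"
    unfolding zero_ext_mult[symmetric] by (rule orbit_mult)
  then show ?case using mult by simp
qed auto

end

section \<open>Conjugates over the roots of unity\<close>

definition unity :: "nat \<Rightarrow> 'k :: field set" where
  "unity d = {e. e ^ d = 1}"

lemma finite_unity [simp]: "d > 0 \<Longrightarrow> finite (unity d :: 'k :: {alg_closed_field, field_char_0} set)"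
  and card_unity: "d > 0 \<Longrightarrow> card (unity d :: 'k set) = d"
  unfolding unity_def by (rule card_roots_of_unity; simp)+

lemma sum_unity:
  "d > 0 \<Longrightarrow> (\<Sum>e\<in>unity d. e ^ j) = (if d dvd j then of_nat d else (0 :: 'k :: {alg_closed_field, field_char_0}))"
  unfolding unity_def by (rule sum_roots_of_unity)

lemma unity_mult_bij: "d > 0 \<Longrightarrow> e \<in> unity d \<Longrightarrow> bij_betw (\<lambda>x. x * e) (unity d) (unity d)"
  by (rule bij_betwI[of _ _ _ "\<lambda>x. x / e"])
    (auto simp: unity_def power_mult_distrib power_divide power_0_left)

text \<open>
  A point is a tuple \<open>(u, v, z, x\<^sub>0, \<dots>, x\<^bsub>d-1\<^esub>)\<close>. If \<open>y\<^sup>d = u\<close>, then \<open>lin d y _ e\<close> for \<open>e\<^sup>d = 1\<close> are the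
  conjugates of \<open>\<Sum>\<^sub>j x\<^sub>j y\<^sup>j\<close>, and their product is a polynomial in \<open>u\<close> and \<open>x\<close>: the norm form of the
  extension by \<open>u\<^bsup>1/d\<^esup>\<close>.
\<close>

definition lin :: "nat \<Rightarrow> 'k \<Rightarrow> (nat \<Rightarrow> 'k) \<Rightarrow> 'k \<Rightarrow> 'k :: field" where
  "lin d y x e = (\<Sum>j<d. (e * y) ^ j * x (3 + j))"

text \<open>The product is unchanged when y is replaced by e' y for a d-th root of unity e'.
  Averaging over e' therefore removes the powers of y whose exponent is not divisible by d, and the
  others are powers of u = \<open>x 0\<close>.\<close>

lemma ex_norm_form:
  assumes d: "d > 0"
  shows "\<exists>p\<in>poly_funs (d + 3). \<forall>x (y :: 'k :: {alg_closed_field, field_char_0}). y ^ d = x 0 \<longrightarrow> p x = (\<Prod>e\<in>unity d. lin d y x e)"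
proof -
  let ?n = "d + 3"
  \<comment> \<open>y is stored as an additional coordinate, in which
    \<open>poly_funs_expand\<close> can expand.\<close>
  let ?F = "\<lambda>x :: nat \<Rightarrow> 'k. \<Prod>e\<in>unity d. \<Sum>j<d. (e * x ?n) ^ j * x (3 + j)"
  have "?F \<in> poly_funs (Suc ?n)"
    by (intro poly_funs_prod poly_funs_sum poly_funs.mult poly_funs_power poly_funs.const poly_funs.coord) auto
  then obtain M c where c: "\<And>i. c i \<in> poly_funs ?n" "\<And>x t. ?F (x(?n := t)) = (\<Sum>i<M. c i x * t ^ i)"
    using poly_funs_expand by blast
  have F: "(\<Prod>e\<in>unity d. lin d y x e) = (\<Sum>i<M. c i x * y ^ i)" for x y
  proof -
    have "(\<Prod>e\<in>unity d. lin d y x e) = ?F (x(?n := y))"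
      unfolding lin_def by (intro prod.cong sum.cong refl) simp
    then show ?thesis by (simp only: c(2))
  qed
  have inv: "(\<Prod>e\<in>unity d. lin d (e' * y) x e) = (\<Prod>e\<in>unity d. lin d y x e)" if "e' \<in> unity d" for e' y :: 'k and x
  proof -
    have "(\<Prod>e\<in>unity d. lin d (e' * y) x e) = (\<Prod>e\<in>unity d. lin d y x (e * e'))"
      by (simp add: lin_def mult.assoc)
    also have "\<dots> = (\<Prod>e\<in>unity d. lin d y x e)"
      by (rule prod.reindex_bij_betw[OF unity_mult_bij[OF d that]])
    finally show ?thesis .
  qed
  let ?p = "\<lambda>x. \<Sum>i<M. if d dvd i then c i x * x 0 ^ (i div d) else 0"
  have mem: "?p \<in> poly_funs ?n"
  proof (rule poly_funs_sum)
    fix i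
    show "(\<lambda>x. if d dvd i then c i x * x 0 ^ (i div d) else 0) \<in> poly_funs ?n"
      using poly_funs.mult[OF c(1) poly_funs_power[OF poly_funs.coord[of 0 ?n]]] poly_funs.const[of 0 ?n]
      by (cases "d dvd i") simp_all
  qed
  have eq: "?p x = (\<Prod>e\<in>unity d. lin d y x e)" if y: "y ^ d = x 0" for x y
  proof -
    have "of_nat d * (\<Prod>e\<in>unity d. lin d y x e) = (\<Sum>e'\<in>unity d. \<Prod>e\<in>unity d. lin d (e' * y) x e)"
    proof -
      have "(\<Sum>e'\<in>unity d. \<Prod>e\<in>unity d. lin d (e' * y) x e)
          = (\<Sum>e'\<in>(unity d :: 'k set). \<Prod>e\<in>unity d. lin d y x e)"
        by (rule sum.cong[OF refl]) (rule inv)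
      then show ?thesis by (simp only: sum_constant card_unity[OF d])
    qed
    also have "\<dots> = (\<Sum>i<M. c i x * y ^ i * (\<Sum>e'\<in>unity d. e' ^ i))"
      unfolding F sum_distrib_left power_mult_distrib
      by (subst sum.swap) (intro sum.cong refl, simp only: mult_ac)
    also have "\<dots> = (\<Sum>i<M. of_nat d * (if d dvd i then c i x * x 0 ^ (i div d) else 0))"
    proof (intro sum.cong refl)
      fix i
      have "y ^ i = x 0 ^ (i div d)" if "d dvd i"
        unfolding y[symmetric] power_mult[symmetric] using that by simp
      then show "c i x * y ^ i * (\<Sum>e'\<in>unity d. e' ^ i)
          = of_nat d * (if d dvd i then c i x * x 0 ^ (i div d) else 0)"
        by (simp add: sum_unity[OF d])
    qed
    also have "\<dots> = of_nat d * ?p x" by (simp add: sum_distrib_left)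
    finally show ?thesis using d by simp
  qed
  show ?thesis by (rule bexI[OF _ mem]) (intro allI impI eq)
qed

text \<open>The choice has no freedom: every \<open>x 0\<close> has a d-th root, so the property
  determines all values.\<close>

definition norm_form :: "nat \<Rightarrow> (nat \<Rightarrow> 'k) \<Rightarrow> 'k :: {alg_closed_field, field_char_0}" where
  "norm_form d = (SOME p. p \<in> poly_funs (d + 3) \<and>
     (\<forall>x y. y ^ d = x 0 \<longrightarrow> p x = (\<Prod>e\<in>unity d. lin d y x e)))"

lemma norm_form_props:
  assumes "d > 0"
  shows "(norm_form d :: (nat \<Rightarrow> 'k) \<Rightarrow> 'k :: {alg_closed_field, field_char_0}) \<in> poly_funs (d + 3) \<and>
     (\<forall>x (y :: 'k). y ^ d = x 0 \<longrightarrow> norm_form d x = (\<Prod>e\<in>unity d. lin d y x e))"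
  unfolding norm_form_def using ex_norm_form[OF assms, unfolded Bex_def] by (rule someI_ex)

lemmas norm_form_poly = norm_form_props[THEN conjunct1]
  and norm_form_eq = norm_form_props[THEN conjunct2, rule_format]

definition form :: "nat \<Rightarrow> (nat \<Rightarrow> 'k) \<Rightarrow> 'k :: {alg_closed_field, field_char_0}" where
  "form d x = norm_form d x - x 1 * x 2 ^ d"

definition disc :: "nat \<Rightarrow> (nat \<Rightarrow> 'k) \<Rightarrow> 'k :: {alg_closed_field, field_char_0}" where
  "disc d x = x 0 * (x 1 * form d x)"

lemma form_poly: "d > 0 \<Longrightarrow> form d \<in> poly_funs (d + 3)"
  unfolding form_def[abs_def]
  by (intro poly_funs_diff poly_funs.mult poly_funs_power norm_form_poly poly_funs.coord) auto

lemma disc_poly: "d > 0 \<Longrightarrow> disc d \<in> poly_funs (d + 3)"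
  unfolding disc_def[abs_def] by (intro poly_funs.mult form_poly poly_funs.coord) auto

text \<open>The point with u = c, v = 1, z = 0 and x = (1, 0, ..., 0), where all conjugate factors
  are 1 and \<open>disc\<close> is c. It shows that \<open>disc\<close> is not zero, that u is not
  constant and that the flow on the suspension moves.\<close>

definition sample :: "'k :: field \<Rightarrow> nat \<Rightarrow> 'k" where
  "sample c = (\<lambda>i. if i = 0 then c else if i = 1 \<or> i = 3 then 1 else 0)"

lemma lin_sample: "d > 0 \<Longrightarrow> lin d y (sample c) e = 1"
proof -
  assume "d > 0"
  moreover have "lin d y (sample c) e = (\<Sum>j<d. if j = 0 then 1 else 0)"
    unfolding lin_def sample_def by (intro sum.cong) auto
  ultimately show ?thesis by simp
qed

lemma disc_sample:
  assumes d: "d > 0"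
  shows "disc d (sample c) = (c :: 'k :: {alg_closed_field, field_char_0})"
proof -
  obtain y where y: "y ^ d = c" using nth_root_exists[of d c] d by auto
  have "sample c 0 = c" "sample c (Suc 0) = 1" "sample c 2 = 0" by (simp_all add: sample_def)
  moreover from this have "norm_form d (sample c) = 1"
    using norm_form_eq[of d y "sample c"] d y by (simp add: lin_sample)
  ultimately show ?thesis using d by (simp add: disc_def form_def)
qed

section \<open>A rigid variety\<close>

lemma (in reg_lnd) D_eq_0I:
  assumes "\<And>i. i < n \<Longrightarrow> D (zero_ext X (\<lambda>x. x i)) = 0" "b \<in> reg n X"
  shows "D b = 0"
proof -
  have "zero_ext X (\<lambda>x. x i) \<in> reg n X" if "i < n" for i
    using that by (auto simp: reg_def intro!: imageI poly_funs.coord)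
  then have "reg n X \<subseteq> {b \<in> reg n X. D b = 0}"
    by (intro reg_generated)
      (auto simp: one_mem D_one assms(1) add_mem D_add mult_mem D_mult scal_mem D_scal)
  then show ?thesis using assms(2) by auto
qed

text \<open>The coefficient at a degree bound, rather than a leading coefficient, allows factors of
  smaller degree: only some coordinates may attain the largest degree along an orbit.\<close>

lemma coeff_mult_top:
  assumes "degree p \<le> a" "degree q \<le> b"
  shows "coeff (p * q) (a + b) = coeff p a * coeff q b"
proof -
  have "coeff (p * q) (a + b) = (\<Sum>i\<le>a + b. if i = a then coeff p a * coeff q b else 0)"
    unfolding coeff_mult
  proof (intro sum.cong refl)
    fix i assume "i \<in> {..a + b}"
    show "coeff p i * coeff q (a + b - i) = (if i = a then coeff p a * coeff q b else 0)"
    proof (cases i a rule: linorder_cases)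
      case less
      then have "coeff q (a + b - i) = 0" using assms by (intro coeff_eq_0) simp
      then show ?thesis using less by simp
    next
      case greater
      then have "coeff p i = 0" using assms by (intro coeff_eq_0) simp
      then show ?thesis using greater by simp
    qed simp
  qed
  then show ?thesis by simp
qed

lemma coeff_prod_top:
  fixes f :: "'i \<Rightarrow> 'k :: field poly"
  assumes "finite I" "\<And>i. i \<in> I \<Longrightarrow> degree (f i) \<le> r"
  shows "coeff (prod f I) (card I * r) = (\<Prod>i\<in>I. coeff (f i) r)"
proof -
  have "degree (prod f I) \<le> card I * r \<and> coeff (prod f I) (card I * r) = (\<Prod>i\<in>I. coeff (f i) r)"
    using assms
  proof (induction I rule: finite_induct)
    case (insert i I)
    then have IH: "degree (prod f I) \<le> card I * r" "coeff (prod f I) (card I * r) = (\<Prod>i\<in>I. coeff (f i) r)"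
      by auto
    have "degree (f i) \<le> r" using insert by simp
    then have "degree (f i * prod f I) \<le> r + card I * r"
      using degree_mult_le[of "f i" "prod f I"] IH(1) by linarith
    then show ?case
      using insert IH coeff_mult_top[of "f i" r "prod f I" "card I * r"] by simp
  qed simp
  then show ?thesis by simp
qed

text \<open>The outer variable is v and the inner one is y, so that \<open>degree\<close> is the
  degree in v.\<close>

definition ev2 :: "'k :: field poly poly \<Rightarrow> 'k \<Rightarrow> 'k \<Rightarrow> 'k" where
  "ev2 P y v = poly (poly P [:v:]) y"

lemma ev2_simps [simp]:
  "ev2 0 y v = 0" "ev2 (P + Q) y v = ev2 P y v + ev2 Q y v" "ev2 (P - Q) y v = ev2 P y v - ev2 Q y v"
  "ev2 (P * Q) y v = ev2 P y v * ev2 Q y v" "ev2 (P ^ r) y v = ev2 P y v ^ r"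
  "ev2 (pCons c P) y v = poly c y + v * ev2 P y v"
  "ev2 (Polynomial.smult c P) y v = poly c y * ev2 P y v"
  "ev2 (\<Sum>i\<in>I. F i) y v = (\<Sum>i\<in>I. ev2 (F i) y v)"
  "ev2 (\<Prod>i\<in>I. F i) y v = (\<Prod>i\<in>I. ev2 (F i) y v)"
  by (simp_all add: ev2_def poly_sum poly_prod)

lemma ev2_eqI:
  fixes P Q :: "'k :: field_char_0 poly poly"
  assumes "\<And>y v. ev2 P y v = ev2 Q y v"
  shows "P = Q"
proof -
  have z: "poly (P - Q) [:v:] = 0" for v
    using assms poly_all_0_iff_0[of "poly (P - Q) [:v:]"] by (simp add: ev2_def)
  have "range (\<lambda>v :: 'k. [:v:]) \<subseteq> {c. poly (P - Q) c = 0}" using z by auto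
  moreover have "infinite (range (\<lambda>v :: 'k. [:v:]))"
    using finite_imageD[of "\<lambda>v :: 'k. [:v:]" UNIV] infinite_UNIV_char_0[where ?'a = 'k]
    by (auto simp: inj_on_def)
  ultimately have "P - Q = 0" using poly_roots_finite finite_subset by blast
  then show ?thesis by simp
qed

text \<open>The substitution of e y for y. It acts on the coefficients of the powers of v, so
  conjugate factors have the same degree in v.\<close>

definition scale_inner :: "'k :: field \<Rightarrow> 'k poly poly \<Rightarrow> 'k poly poly" where
  "scale_inner e = map_poly (\<lambda>c. pcompose c [:0, e:])"

lemma ev2_scale_inner: "ev2 (scale_inner e P) y v = ev2 P (e * y) v"
  unfolding scale_inner_def
  by (induction P) (simp_all add: map_poly_pCons poly_pcompose mult.commute)

lemma degree_scale_inner: "e \<noteq> 0 \<Longrightarrow> degree (scale_inner e P) = degree P"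
  unfolding scale_inner_def by (rule degree_map_poly) (auto dest: pcompose_eq_0)

lemma scale_inner_eq_0: "e \<noteq> 0 \<Longrightarrow> scale_inner e P = 0 \<longleftrightarrow> P = 0"
  unfolding scale_inner_def by (rule map_poly_eq_0_iff) (auto dest: pcompose_eq_0)

text \<open>The coordinates other than u and v are frozen at those of a, and y^d is substituted for
  u, which makes the d-th root of u a polynomial variable.\<close>

lemma poly_funs_ev2:
  assumes "p \<in> poly_funs n"
  shows "\<exists>Q. \<forall>y v. ev2 Q y v = p (a(0 := y ^ d, 1 := v))"
  using assms
proof induction
  case (const c)
  show ?case by (intro exI[of _ "[:[:c:]:]"]) simp
next
  case (coord i)
  consider "i = 0" | "i = 1" | "i \<noteq> 0" "i \<noteq> 1" by blast
  then show ?case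
  proof cases
    case 1
    then show ?thesis by (intro exI[of _ "[:monom 1 d:]"]) (simp add: poly_monom)
  next
    case 2
    then show ?thesis by (intro exI[of _ "[:0, 1:]"]) simp
  next
    case 3
    then show ?thesis by (intro exI[of _ "[:[:a i:]:]"]) simp
  qed
next
  case (add p q)
  then obtain P Q where "\<forall>y v. ev2 P y v = p (a(0 := y ^ d, 1 := v))"
    "\<forall>y v. ev2 Q y v = q (a(0 := y ^ d, 1 := v))" by blast
  then show ?case by (intro exI[of _ "P + Q"]) (simp del: fun_upd_apply)
next
  case (mult p q)
  then obtain P Q where "\<forall>y v. ev2 P y v = p (a(0 := y ^ d, 1 := v))"
    "\<forall>y v. ev2 Q y v = q (a(0 := y ^ d, 1 := v))" by blast
  then show ?case by (intro exI[of _ "P * Q"]) (simp del: fun_upd_apply)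
qed

locale norm_variety =
  fixes d :: nat and K :: "'k :: {alg_closed_field, field_char_0} itself"
  assumes d: "d > 1"
begin

sublocale principal_open "d + 3" "disc d :: (nat \<Rightarrow> 'k) \<Rightarrow> 'k"
proof
  show "disc d \<in> poly_funs (d + 3)" using d by (intro disc_poly) simp
  show "\<exists>x. disc d x \<noteq> (0 :: 'k)"
    using disc_sample[of d "1 :: 'k"] d by (intro exI[of _ "sample 1"]) simp
qed

text \<open>
  As polynomials in \<open>v\<close> the conjugate factors on the left all have the same degree, so the left side has
  degree \<open>0\<close> modulo \<open>d\<close> and the right side has degree \<open>1\<close> modulo \<open>d\<close>.
\<close>

lemma anisotropic:
  assumes g: "\<And>i. i \<in> {2..<d + 3} \<Longrightarrow> g i \<in> poly_funs (Suc (d + 3))"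
    and eq: "\<And>x y. x \<in> X \<Longrightarrow> y ^ d = x 0 \<Longrightarrow>
      (\<Prod>e\<in>unity d. \<Sum>j<d. (e * y) ^ j * g (3 + j) x) = x 1 * g 2 x ^ d"
    and x0: "x0 \<in> X" and i: "i \<in> {2..<d + 3}"
  shows "g i x0 = 0"
proof -
  let ?I = "{2..<d + 3}"
  have "\<forall>i\<in>?I. \<exists>M. \<forall>r\<ge>M. \<exists>q\<in>poly_funs (d + 3). \<forall>x. disc d x \<noteq> 0 \<longrightarrow> g i (point x) * disc d x ^ r = q x"
    using clear_denominators g by blast
  from bchoice[OF this] obtain M where M: "\<forall>i\<in>?I. \<forall>r\<ge>M i.
      \<exists>q\<in>poly_funs (d + 3). \<forall>x. disc d x \<noteq> 0 \<longrightarrow> g i (point x) * disc d x ^ r = q x"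
    by blast
  \<comment> \<open>One exponent for all \<open>g i\<close>: both sides of the equation are
    homogeneous of degree d in g, so it survives multiplication of every \<open>g i\<close> by the
    same factor.\<close>
  define r where "r = (\<Sum>i\<in>?I. M i)"
  have "r \<ge> M i" if "i \<in> ?I" for i
    unfolding r_def using that by (intro member_le_sum) auto
  then have "\<forall>i\<in>?I. \<exists>q. q \<in> poly_funs (d + 3) \<and> (\<forall>x. disc d x \<noteq> 0 \<longrightarrow> g i (point x) * disc d x ^ r = q x)"
    using M by blast
  from bchoice[OF this] obtain q where q: "\<And>i. i \<in> ?I \<Longrightarrow> q i \<in> poly_funs (d + 3)"
    "\<And>i x. i \<in> ?I \<Longrightarrow> disc d x \<noteq> 0 \<Longrightarrow> g i (point x) * disc d x ^ r = q i x"
    by blast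
  have disc_x0: "disc d x0 \<noteq> 0" by (rule S_X[OF x0])
  then have x00: "x0 0 \<noteq> 0" by (auto simp: disc_def)
  obtain y0 where y0: "y0 ^ d = x0 0" using nth_root_exists[of d "x0 0"] d by auto
  have y0_ne: "y0 \<noteq> 0" using y0 x00 d by (auto simp: power_0_left)
  \<comment> \<open>Only u = y^d and v vary around x0. The coordinate that holds the inverse of
    \<open>disc\<close> is frozen too, and \<open>point\<close> restores it.\<close>
  define pt where "pt y v = x0(0 := y ^ d, 1 := v)" for y v
  have pt0: "pt y0 (x0 1) = x0" by (auto simp: pt_def y0)
  have "\<forall>i\<in>?I. \<exists>Q. \<forall>y v. ev2 Q y v = q i (pt y v)"
    unfolding pt_def using poly_funs_ev2[OF q(1)] by blast
  from bchoice[OF this] obtain Q where Q: "\<And>i y v. i \<in> ?I \<Longrightarrow> ev2 (Q i) y v = q i (pt y v)"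
    by blast
  obtain T where T: "\<And>y v. ev2 T y v = disc d (pt y v)"
    unfolding pt_def using poly_funs_ev2[OF S] by blast
  have "T \<noteq> 0"
  proof
    assume "T = 0"
    then show False using T[of y0 "x0 1"] disc_x0 unfolding pt0 by simp
  qed
  define L where "L e = (\<Sum>j<d. [:monom (e ^ j) j:] * Q (3 + j))" for e
  have L: "ev2 (L e) y v = (\<Sum>j<d. (e * y) ^ j * q (3 + j) (pt y v))" for e y v
    by (simp add: L_def poly_monom Q power_mult_distrib)
  have L_conj: "L e = scale_inner e (L 1)" if "e \<in> unity d" for e
  proof (rule ev2_eqI)
    fix y v
    have "pt (e * y) v = pt y v" using that by (simp add: pt_def unity_def power_mult_distrib)
    then show "ev2 (L e) y v = ev2 (scale_inner e (L 1)) y v" by (simp add: ev2_scale_inner L)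
  qed
  have e_ne: "e \<noteq> 0" if "e \<in> unity d" for e :: 'k
    using that d by (auto simp: unity_def power_0_left)
  have d0: "d > 0" using d by simp
  \<comment> \<open>The factor \<open>T\<close> makes the identity hold also where
    \<open>pt y v\<close> leaves the open set; being a nonzero polynomial, it cancels.\<close>
  have "(\<Prod>e\<in>unity d. L e) * T = [:0, 1:] * Q 2 ^ d * T"
  proof (rule ev2_eqI)
    fix y v
    show "ev2 ((\<Prod>e\<in>unity d. L e) * T) y v = ev2 ([:0, 1:] * Q 2 ^ d * T) y v"
    proof (cases "disc d (pt y v) = 0")
      case True
      then show ?thesis by (simp add: T)
    next
      case False
      let ?x = "point (pt y v)" and ?s = "disc d (pt y v) ^ r"
      have x: "?x \<in> X" "?x 0 = y ^ d" "?x 1 = v"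
        using point_mem[OF False] by (auto simp: point_def pt_def)
      have "(\<Prod>e\<in>unity d. ev2 (L e) y v) = (\<Prod>e\<in>unity d. (\<Sum>j<d. (e * y) ^ j * g (3 + j) ?x) * ?s)"
        unfolding L sum_distrib_right
        by (intro prod.cong sum.cong refl) (simp add: q(2)[OF _ False, symmetric])
      also have "\<dots> = (\<Prod>e\<in>unity d. \<Sum>j<d. (e * y) ^ j * g (3 + j) ?x) * ?s ^ d"
        by (simp add: prod.distrib card_unity[OF d0])
      also have "\<dots> = v * (g 2 ?x * ?s) ^ d"
        using eq[OF x(1), of y] x by (simp add: power_mult_distrib)
      also have "\<dots> = v * ev2 (Q 2) y v ^ d"
        using q(2)[OF _ False, of 2] Q[of 2 y v] d by simp
      finally show ?thesis by simp
    qed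
  qed
  then have id: "(\<Prod>e\<in>unity d. L e) = [:0, 1:] * Q 2 ^ d" using mult_right_cancel[OF \<open>T \<noteq> 0\<close>] by blast
  have L1: "L 1 = 0"
  proof (rule ccontr)
    assume ne: "L 1 \<noteq> 0"
    have Le: "L e \<noteq> 0" "degree (L e) = degree (L 1)" if "e \<in> unity d" for e
      using ne L_conj[OF that] e_ne[OF that] by (simp_all add: scale_inner_eq_0 degree_scale_inner)
    then have prod_ne: "(\<Prod>e\<in>unity d. L e) \<noteq> 0" using d0 by simp
    then have Q2: "Q 2 \<noteq> 0" using id d0 by (auto simp: power_0_left)
    have "degree (\<Prod>e\<in>unity d. L e) = (\<Sum>e\<in>(unity d :: 'k set). degree (L 1))"
      using Le by (subst degree_prod_eq_sum_degree) auto
    also have "\<dots> = d * degree (L 1)" by (simp add: card_unity[OF d0])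
    finally have "d * degree (L 1) = 1 + d * degree (Q 2)"
      using id Q2 by (simp add: degree_mult_eq degree_power_eq)
    then have "d dvd 1 + d * degree (Q 2)" by (metis dvd_triv_left)
    then have "d dvd 1" using dvd_add_left_iff dvd_triv_left by blast
    then show False using d by simp
  qed
  have L0: "L e = 0" if "e \<in> unity d" for e
    using L_conj[OF that] e_ne[OF that] L1 by (simp add: scale_inner_eq_0)
  have q0: "q i x0 = 0"
  proof (cases "i = 2")
    case True
    have "Q 2 = 0"
    proof -
      have "(1 :: 'k) \<in> unity d" by (simp add: unity_def)
      then have "(\<Prod>e\<in>unity d. L e) = 0" using L1 d0 by auto
      then show ?thesis using id by simp
    qed
    then show ?thesis using Q[OF i, of y0 "x0 1"] True unfolding pt0 by simp
  next
    case False
    define j where "j = i - 3"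
    have j: "j < d" "i = 3 + j" using i False by (auto simp: j_def)
    \<comment> \<open>Evaluated at y0 and v = \<open>x0 1\<close>, the vanishing of all
      \<open>L e\<close> says that this polynomial of degree less than d has the d roots of unity as
      roots. As y0 is nonzero, its coefficients give \<open>q (3 + j) x0 = 0\<close>.\<close>
    let ?R = "\<Sum>j<d. monom (y0 ^ j * q (3 + j) x0) j"
    have "poly ?R e = 0" if "e \<in> unity d" for e
      using L[of e y0 "x0 1"] L0[OF that] unfolding pt0
      by (simp add: poly_sum poly_monom power_mult_distrib mult_ac)
    then have sub: "unity d \<subseteq> {e. poly ?R e = 0}" by auto
    have deg: "degree ?R < d"
      using d0 by (intro degree_lessI) (auto simp: coeff_sum)
    have "?R = 0"
    proof (rule ccontr)
      assume ne: "?R \<noteq> 0"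
      have "d \<le> card {e. poly ?R e = 0}"
        using card_mono[OF poly_roots_finite[OF ne] sub] by (simp only: card_unity[OF d0])
      also have "\<dots> \<le> degree ?R" by (rule card_poly_roots_bound[OF ne])
      finally show False using deg by simp
    qed
    then have "coeff ?R j = 0" by simp
    then show ?thesis using j y0_ne by (simp add: coeff_sum)
  qed
  then show ?thesis using q(2)[OF i disc_x0] disc_x0 by (simp add: point_X[OF x0])
qed

text \<open>Along an orbit the form is constant, while z and the x_j are polynomials in t of degree
  at most s, where s is the largest order in which D does not annihilate all of them. For s > 0 the
  coefficient of t^(d s) is the anisotropic equation for their coefficients at t^s, which then
  vanish everywhere, against the choice of s.\<close>

theorem rigid_X: "rigid (Suc (d + 3)) X"
  unfolding rigid_iff
proof (intro allI impI ballI, rule ccontr)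
  fix D b assume D: "lnd (reg (Suc (d + 3)) X) scalars D" and b: "b \<in> reg (Suc (d + 3)) X" "D b \<noteq> 0"
  interpret reg_lnd "Suc (d + 3)" X D
    by (intro reg_lnd.intro lnd_domain.intro algebra_domain_reg no_zero_div D)
  let ?c = "\<lambda>i. zero_ext X (\<lambda>x. x i)"
  have cmem: "?c i \<in> reg (Suc (d + 3)) X" if "i < Suc (d + 3)" for i
    using that by (auto simp: reg_def intro!: imageI poly_funs.coord)
  have d0: "d > 0" using d by simp
  have form: "(form d :: (nat \<Rightarrow> 'k) \<Rightarrow> 'k) \<in> poly_funs (Suc (d + 3))"
    by (rule poly_funs_mono[OF form_poly[OF d0]]) simp
  have fmem: "zero_ext X (form d) \<in> reg (Suc (d + 3)) X" unfolding reg_def using form by (rule imageI)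
  have one: "?c (d + 3) * (?c 0 * (?c 1 * zero_ext X (form d))) = zero_ext X (\<lambda>x. 1)"
    unfolding zero_ext_mult zero_ext_eq_iff by (auto simp: X_def disc_def)
  have one_ne: "zero_ext X (\<lambda>x. 1 :: 'k) \<noteq> 0"
    using S_nonzero point_mem by (auto simp: zero_ext_eq_0_iff)
  have p2: "?c 1 * zero_ext X (form d) \<in> reg (Suc (d + 3)) X"
    by (intro mult_mem cmem fmem) simp
  have p1: "?c 0 * (?c 1 * zero_ext X (form d)) \<in> reg (Suc (d + 3)) X"
    by (intro mult_mem[OF _ p2] cmem) simp
  have c: "?c (d + 3) \<in> reg (Suc (d + 3)) X" "?c 0 \<in> reg (Suc (d + 3)) X" "?c 1 \<in> reg (Suc (d + 3)) X"
    by (rule cmem; simp)+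
  \<comment> \<open>The inverse of \<open>disc\<close>, u, v and the form multiply to the unit;
    peeling off one factor at a time puts all of them into the kernel.\<close>
  note k1 = D_eq_0_factor[OF c(1) p1, unfolded one, OF one_ne D_one]
  have n1: "?c 0 * (?c 1 * zero_ext X (form d)) \<noteq> 0" using one one_ne by auto
  note k2 = D_eq_0_factor[OF c(2) p2 n1 k1(2)]
  have n2: "?c 1 * zero_ext X (form d) \<noteq> 0" using n1 by auto
  note k3 = D_eq_0_factor[OF c(3) fmem n2 k2(2)]
  let ?I = "{2..<d + 3}"
  have fin: "finite ((\<lambda>i. nil_index (?c i)) ` ?I)" "(\<lambda>i. nil_index (?c i)) ` ?I \<noteq> {}"
    using d by auto
  define r where "r = Max ((\<lambda>i. nil_index (?c i)) ` ?I)"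
  have r_max: "nil_index (?c i) \<le> r" if "i \<in> ?I" for i
    unfolding r_def using that fin by (intro Max_ge) auto
  have "r \<in> (\<lambda>i. nil_index (?c i)) ` ?I" unfolding r_def by (rule Max_in[OF fin])
  then obtain i0 where i0: "i0 \<in> ?I" "nil_index (?c i0) = r" by auto
  have "r > 1"
  proof (rule ccontr)
    assume "\<not> r > 1"
    then have "D (?c i) = 0" if "i \<in> ?I" for i
      using r_max[OF that] D_eq_0_iff[OF cmem, of i] that by auto
    then have Dc: "D (?c i) = 0" if "i < Suc (d + 3)" for i
    proof -
      consider "i = 0" | "i = 1" | "i \<in> ?I" | "i = d + 3" using \<open>i < Suc (d + 3)\<close> by fastforce
      then show ?thesis
        using \<open>\<And>i. i \<in> ?I \<Longrightarrow> D (?c i) = 0\<close> k1(1) k2(1) k3(1) by cases auto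
    qed
    show False using D_eq_0I[OF Dc b(1)] b(2) by blast
  qed
  then obtain s where s: "r = Suc s" "s > 0" by (cases r) auto
  have "\<forall>i\<in>?I. \<exists>g. g \<in> poly_funs (Suc (d + 3)) \<and> (D ^^ s) (?c i) = zero_ext X g"
  proof
    fix i assume "i \<in> ?I"
    then have "(D ^^ s) (?c i) \<in> reg (Suc (d + 3)) X" by (intro funpow_mem cmem) auto
    then show "\<exists>g. g \<in> poly_funs (Suc (d + 3)) \<and> (D ^^ s) (?c i) = zero_ext X g"
      by (auto simp: reg_def)
  qed
  from bchoice[OF this] obtain g where g: "\<And>i. i \<in> ?I \<Longrightarrow> g i \<in> poly_funs (Suc (d + 3))"
    "\<And>i. i \<in> ?I \<Longrightarrow> (D ^^ s) (?c i) = zero_ext X (g i)"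
    by blast
  have eq: "(\<Prod>e\<in>unity d. \<Sum>j<d. (e * y) ^ j * g (3 + j) x) = x 1 * g 2 x ^ d"
    if x: "x \<in> X" and y: "y ^ d = x 0" for x y
  proof -
    define o' where "o' i = orbit (?c i) x" for i
    define \<gamma> where "\<gamma> t i = poly (o' i) t" for t i
    have coeff_o: "coeff (o' i) s = g i x / fact s" if "i \<in> ?I" for i
      using that g(2)[OF that] x cmem[of i] by (simp add: o'_def coeff_orbit)
    have deg_o: "degree (o' i) \<le> s" if "i \<in> ?I" for i
      unfolding o'_def using r_max[OF that] that s by (intro degree_orbit cmem) auto
    have g0: "\<gamma> t 0 = x 0" and g1: "\<gamma> t 1 = x 1" for t
      using x orbit_killed[OF c(2) k2(1)] orbit_killed[OF c(3) k3(1)]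
      by (simp_all add: \<gamma>_def o'_def)
    define L where "L e = (\<Sum>j<d. Polynomial.smult ((e * y) ^ j) (o' (3 + j)))" for e
    \<comment> \<open>The d-th power of z is written as a product over the roots of unity, so that
      \<open>coeff_prod_top\<close> applies to both terms with the same number of factors.\<close>
    have "(\<Prod>e\<in>unity d. L e) - Polynomial.smult (x 1) (\<Prod>e\<in>(unity d :: 'k set). o' 2) = [:form d x:]"
    proof (rule poly_eq_poly_eq_iff[THEN iffD1], rule ext)
      fix t
      have "poly (L e) t = lin d y (\<gamma> t) e" for e
        by (simp add: L_def lin_def \<gamma>_def poly_sum)
      then have "poly ((\<Prod>e\<in>unity d. L e) - Polynomial.smult (x 1) (\<Prod>e\<in>(unity d :: 'k set). o' 2)) t
          = form d (\<gamma> t)"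
        using norm_form_eq[OF d0, of y "\<gamma> t"] y
        by (simp add: form_def poly_prod g0 g1[unfolded One_nat_def] card_unity[OF d0]) (simp add: \<gamma>_def)
      also have "\<dots> = poly (orbit (zero_ext X (form d)) x) t"
        unfolding \<gamma>_def o'_def by (rule poly_orbit[OF form x, symmetric])
      also have "\<dots> = poly [:form d x:] t" using x by (simp add: orbit_killed[OF fmem k3(2)])
      finally show "poly ((\<Prod>e\<in>unity d. L e) - Polynomial.smult (x 1) (\<Prod>e\<in>(unity d :: 'k set). o' 2)) t
          = poly [:form d x:] t" .
    qed
    then have "coeff ((\<Prod>e\<in>unity d. L e) - Polynomial.smult (x 1) (\<Prod>e\<in>(unity d :: 'k set). o' 2)) (d * s)
        = coeff [:form d x:] (d * s)" by simp
    \<comment> \<open>A constant polynomial has no term in degree d s because s > 0.\<close>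
    also have "\<dots> = 0" using s d by (cases "d * s") auto
    finally have "coeff (\<Prod>e\<in>unity d. L e) (card (unity d :: 'k set) * s)
        = x 1 * coeff (\<Prod>e\<in>(unity d :: 'k set). o' 2) (card (unity d :: 'k set) * s)"
      by (simp add: card_unity[OF d0])
    also have "coeff (\<Prod>e\<in>unity d. L e) (card (unity d :: 'k set) * s) = (\<Prod>e\<in>unity d. coeff (L e) s)"
    proof (rule coeff_prod_top)
      show "degree (L e) \<le> s" for e unfolding L_def
        by (intro degree_sum_le order.trans[OF degree_smult_le] deg_o) auto
    qed (use d0 in simp)
    also have "coeff (\<Prod>e\<in>(unity d :: 'k set). o' 2) (card (unity d :: 'k set) * s) = (\<Prod>e\<in>(unity d :: 'k set). coeff (o' 2) s)"
      by (rule coeff_prod_top) (use d0 deg_o in auto)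
    also have "\<dots> = g 2 x ^ d / fact s ^ d"
      using coeff_o[of 2] d by (simp add: card_unity[OF d0] power_divide)
    also have "(\<Prod>e\<in>unity d. coeff (L e) s) = (\<Prod>e\<in>unity d. (\<Sum>j<d. (e * y) ^ j * g (3 + j) x) / fact s)"
      unfolding L_def coeff_sum sum_divide_distrib
      by (intro prod.cong sum.cong refl) (simp add: coeff_o)
    also have "\<dots> = (\<Prod>e\<in>unity d. \<Sum>j<d. (e * y) ^ j * g (3 + j) x) / fact s ^ d"
      by (simp add: prod_dividef card_unity[OF d0])
    finally show ?thesis by simp
  qed
  have "g i0 x = 0" if "x \<in> X" for x
    using anisotropic[of g, OF g(1) eq that i0(1)] by blast
  then have "(D ^^ s) (?c i0) = 0" using g(2)[OF i0(1)] by (simp add: zero_ext_eq_0_iff)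
  moreover have "i0 < Suc (d + 3)" using i0 by simp
  ultimately show False using funpow_eq_0_iff[OF cmem, of i0 s] i0 s by simp
qed

end

section \<open>Non-rigid suspensions\<close>

lemma funpow_pderiv_eq_0:
  fixes p :: "'k :: field_char_0 poly"
  shows "degree p < r \<Longrightarrow> (pderiv ^^ r) p = 0"
proof (induction r arbitrary: p)
  case (Suc r)
  show ?case
  proof (cases "degree p = 0")
    case True
    then have "pderiv p = 0" by (simp add: pderiv_eq_0_iff)
    moreover have "(pderiv ^^ r) (0 :: 'k poly) = 0" by (induction r) auto
    ultimately show ?thesis by (simp add: funpow_swap1)
  next
    case False
    then have "degree (pderiv p) < r" using Suc.prems by (simp add: degree_pderiv)
    then show ?thesis using Suc.IH by (simp add: funpow_swap1)
  qed
qed simp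

text \<open>An action of the additive group on V whose coordinates are polynomial in the point and
  in the time s; the time is stored as the extra coordinate n.\<close>

locale polynomial_flow =
  fixes n :: nat and V :: "(nat \<Rightarrow> 'k :: field_char_0) set" and \<phi> :: "'k \<Rightarrow> (nat \<Rightarrow> 'k) \<Rightarrow> nat \<Rightarrow> 'k"
  assumes flow_mem: "w \<in> V \<Longrightarrow> \<phi> s w \<in> V"
    and flow_poly: "i < n \<Longrightarrow> \<exists>q\<in>poly_funs (Suc n). \<forall>w\<in>V. \<forall>s. \<phi> s w i = q (w(n := s))"
    and flow_zero: "w \<in> V \<Longrightarrow> \<phi> 0 w = w"
    and flow_add: "w \<in> V \<Longrightarrow> \<phi> (s + t) w = \<phi> s (\<phi> t w)"
begin

lemma flow_expand:
  assumes "b \<in> reg n V"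
  shows "\<exists>M c. (\<forall>i. c i \<in> poly_funs n) \<and> (\<forall>w\<in>V. \<forall>s. b (\<phi> s w) = (\<Sum>i<M. c i w * s ^ i))"
proof -
  obtain p where p: "p \<in> poly_funs n" "b = zero_ext V p" using assms by (auto simp: reg_def)
  have "\<forall>i\<in>{..<n}. \<exists>q. q \<in> poly_funs (Suc n) \<and> (\<forall>w\<in>V. \<forall>s. \<phi> s w i = q (w(n := s)))"
    using flow_poly by blast
  from bchoice[OF this] obtain q where q: "\<And>i. i < n \<Longrightarrow> q i \<in> poly_funs (Suc n)"
    "\<And>i w s. i < n \<Longrightarrow> w \<in> V \<Longrightarrow> \<phi> s w i = q i (w(n := s))" by blast
  have "(\<lambda>x. p (\<lambda>i. q i x)) \<in> poly_funs (Suc n)"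
    by (rule poly_funs_subst[OF p(1)]) (rule q)
  from poly_funs_expand[OF this] obtain M c where c: "\<And>i. c i \<in> poly_funs n"
    "\<And>x t. p (\<lambda>i. q i (x(n := t))) = (\<Sum>i<M. c i x * t ^ i)" by blast
  have "b (\<phi> s w) = (\<Sum>i<M. c i w * s ^ i)" if w: "w \<in> V" for w s
  proof -
    have "b (\<phi> s w) = p (\<phi> s w)" using flow_mem[OF w] by (simp add: p(2))
    also have "\<dots> = p (\<lambda>i. q i (w(n := s)))"
      by (rule poly_funs_cong[OF p(1)]) (rule q(2)[OF _ w])
    finally show ?thesis by (simp only: c(2))
  qed
  with c(1) show ?thesis by blast
qed

definition taylor :: "((nat \<Rightarrow> 'k) \<Rightarrow> 'k) \<Rightarrow> (nat \<Rightarrow> 'k) \<Rightarrow> 'k poly" where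
  "taylor b w = (THE P. \<forall>s. poly P s = b (\<phi> s w))"

lemma taylor_unique: "(\<And>s. poly P s = b (\<phi> s w)) \<Longrightarrow> taylor b w = P"
  unfolding taylor_def by (rule the_equality) (auto intro!: poly_eq_poly_eq_iff[THEN iffD1])

lemma poly_taylor:
  assumes "b \<in> reg n V" "w \<in> V"
  shows "poly (taylor b w) s = b (\<phi> s w)"
proof -
  obtain M c where "\<forall>w\<in>V. \<forall>s. b (\<phi> s w) = (\<Sum>i<M. c i w * s ^ i)"
    using flow_expand[OF assms(1)] by blast
  then have P: "poly (\<Sum>i<M. monom (c i w) i) s = b (\<phi> s w)" for s
    using assms(2) by (simp add: poly_sum poly_monom)
  show ?thesis unfolding taylor_unique[OF P] by (rule P)
qed

definition flow_deriv :: "((nat \<Rightarrow> 'k) \<Rightarrow> 'k) \<Rightarrow> (nat \<Rightarrow> 'k) \<Rightarrow> 'k" where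
  "flow_deriv b = zero_ext V (\<lambda>w. coeff (taylor b w) 1)"

text \<open>The degree bound does not depend on the point w, which later yields one exponent that
  annihilates b. It is \<open>Suc M\<close> because an empty sum has degree 0, which is not below M
  = 0.\<close>

lemma taylor_bound:
  assumes "b \<in> reg n V"
  obtains M where "\<And>w. w \<in> V \<Longrightarrow> degree (taylor b w) < Suc M" and "flow_deriv b \<in> reg n V"
proof -
  obtain M c where c: "\<And>i. c i \<in> poly_funs n" "\<And>w s. w \<in> V \<Longrightarrow> b (\<phi> s w) = (\<Sum>i<M. c i w * s ^ i)"
    using flow_expand[OF assms] by blast
  have T: "taylor b w = (\<Sum>i<M. monom (c i w) i)" if "w \<in> V" for w
    by (rule taylor_unique) (simp add: c(2)[OF that] poly_sum poly_monom)
  have "flow_deriv b = zero_ext V (if 1 < M then c 1 else (\<lambda>w. 0))"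
    unfolding flow_deriv_def zero_ext_eq_iff by (auto simp: T coeff_sum)
  moreover have "(if 1 < M then c 1 else (\<lambda>w. 0)) \<in> poly_funs n"
    using c(1) poly_funs.const[of "0 :: 'k" n] by simp
  ultimately have "flow_deriv b \<in> reg n V" by (simp add: reg_def)
  moreover have "degree (taylor b w) < Suc M" if "w \<in> V" for w
    unfolding T[OF that] by (intro degree_lessI) (auto simp: coeff_sum)
  ultimately show ?thesis using that by blast
qed

lemma flow_deriv_mem: "b \<in> reg n V \<Longrightarrow> flow_deriv b \<in> reg n V"
  using taylor_bound by blast

text \<open>By the group law the Taylor polynomial at \<open>\<phi> s w\<close> is the one at w
  shifted by s, so its linear coefficient is the derivative at s.\<close>

lemma taylor_flow_deriv:
  assumes b: "b \<in> reg n V" and w: "w \<in> V"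
  shows "taylor (flow_deriv b) w = pderiv (taylor b w)"
proof (rule taylor_unique)
  fix s
  have "taylor b (\<phi> s w) = pcompose (taylor b w) [:s, 1:]"
    by (rule taylor_unique) (simp add: poly_pcompose poly_taylor[OF b w] flow_add[OF w] add.commute)
  then have "flow_deriv b (\<phi> s w) = coeff (pcompose (taylor b w) [:s, 1:]) 1"
    using flow_mem[OF w] by (simp add: flow_deriv_def)
  also have "\<dots> = poly (pderiv (pcompose (taylor b w) [:s, 1:])) 0"
    by (simp add: poly_0_coeff_0 coeff_pderiv)
  also have "\<dots> = poly (pderiv (taylor b w)) s"
    by (simp add: pderiv_pcompose poly_pcompose pderiv_pCons)
  finally show "poly (pderiv (taylor b w)) s = flow_deriv b (\<phi> s w)" by simp
qed

text \<open>On Taylor polynomials \<open>flow_deriv\<close> acts as \<open>pderiv\<close>, which is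
  nilpotent in bounded degree. The product rule is the linear coefficient of a product.\<close>

lemma lnd_flow_deriv: "lnd (reg n V) scalars flow_deriv"
proof -
  interpret subalgebra "reg n V" scalars by (rule subalgebra_reg)
  show ?thesis
  proof
    fix b assume b: "b \<in> reg n V"
    show "flow_deriv b \<in> reg n V" by (rule flow_deriv_mem[OF b])
    obtain M where M: "\<And>w. w \<in> V \<Longrightarrow> degree (taylor b w) < Suc M" using taylor_bound[OF b] by blast
    have pow: "(flow_deriv ^^ r) b \<in> reg n V \<and> (\<forall>w\<in>V. taylor ((flow_deriv ^^ r) b) w = (pderiv ^^ r) (taylor b w))" for r
      by (induction r) (auto simp: b flow_deriv_mem taylor_flow_deriv)
    have "(flow_deriv ^^ Suc M) b w = 0" for w
    proof (cases "w \<in> V")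
      case True
      have "(flow_deriv ^^ Suc M) b w = poly (taylor ((flow_deriv ^^ Suc M) b) w) 0"
        using poly_taylor[of "(flow_deriv ^^ Suc M) b" w 0] pow[of "Suc M"] True
        by (simp only: flow_zero simp_thms)
      also have "\<dots> = 0"
        using pow[of "Suc M"] True funpow_pderiv_eq_0[OF M[OF True]] by (simp only: poly_0)
      finally show ?thesis .
    next
      case False
      then show ?thesis using pow[of "Suc M"] reg_outside by blast
    qed
    then show "\<exists>r. (flow_deriv ^^ r) b = 0"
      by (intro exI[of _ "Suc M"]) (simp add: fun_eq_iff fun_apply)
  next
    fix c b :: "(nat \<Rightarrow> 'k) \<Rightarrow> 'k" assume c: "c \<in> scalars" and b: "b \<in> reg n V"
    obtain c' where c': "c = (\<lambda>x. c')" using c unfolding scalars_def by blast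
    have "taylor (c * b) w = Polynomial.smult c' (taylor b w)" if "w \<in> V" for w
      by (rule taylor_unique) (simp add: c' poly_taylor[OF b that] fun_apply)
    then show "flow_deriv (c * b) = c * flow_deriv b"
      by (auto simp: flow_deriv_def c' zero_ext_scal zero_ext_eq_iff)
  next
    fix a b assume a: "a \<in> reg n V" and b: "b \<in> reg n V"
    have "taylor (a + b) w = taylor a w + taylor b w" if "w \<in> V" for w
      by (rule taylor_unique) (simp add: poly_taylor[OF a that] poly_taylor[OF b that] fun_apply)
    then show "flow_deriv (a + b) = flow_deriv a + flow_deriv b"
      by (auto simp: flow_deriv_def zero_ext_add zero_ext_eq_iff)
    have T: "taylor (a * b) w = taylor a w * taylor b w" if "w \<in> V" for w
      by (rule taylor_unique) (simp add: poly_taylor[OF a that] poly_taylor[OF b that] fun_apply)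
    have val: "coeff (taylor f w) 0 = f w" if "f \<in> reg n V" "w \<in> V" for f w
      using poly_taylor[OF that, of 0] flow_zero[OF that(2)] by (simp add: poly_0_coeff_0)
    show "flow_deriv (a * b) = a * flow_deriv b + b * flow_deriv a"
    proof
      fix w show "flow_deriv (a * b) w = (a * flow_deriv b + b * flow_deriv a) w"
      proof (cases "w \<in> V")
        case True
        then show ?thesis
          by (simp add: flow_deriv_def T coeff_mult val a b fun_apply)
      next
        case False
        then show ?thesis by (simp add: flow_deriv_def fun_apply)
      qed
    qed
  qed
qed

end

section \<open>The additive group action on the suspension\<close>

locale norm_suspension = norm_variety d K
  for d and K :: "'k :: {alg_closed_field, field_char_0} itself" +
  fixes m :: nat and k :: "nat \<Rightarrow> nat"
  assumes d_dvd: "\<And>i. i < m \<Longrightarrow> d dvd k i"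
begin

definition W :: "(nat \<Rightarrow> 'k) set" where
  "W = susp (Suc (d + 3)) X (\<lambda>x. x 0) m k"

lemma mem_W: "w \<in> W \<longleftrightarrow> w \<in> affine_space (m + Suc (d + 3)) \<and> proj m w \<in> X \<and> (\<Prod>i<m. w i ^ k i) = w m"
  by (simp add: W_def susp_def proj_def)

text \<open>On W this is a d-th root of u, as the product of the \<open>w i ^ k i\<close> is u and d
  divides each exponent.\<close>

definition root :: "(nat \<Rightarrow> 'k) \<Rightarrow> 'k" where
  "root w = (\<Prod>i<m. w i ^ (k i div d))"

text \<open>On W the norm form is this product times the conjugate factor with e = 1.\<close>

definition cofactor :: "(nat \<Rightarrow> 'k) \<Rightarrow> 'k" where
  "cofactor w = (\<Prod>e\<in>unity d - {1}. lin d (root w) (proj m w) e)"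

text \<open>The power of the root clears denominators: it lets the flow shift x_j by multiples of
  \<open>root w ^ (d - 1 - j)\<close> instead of negative powers of the root.\<close>

definition speed :: "(nat \<Rightarrow> 'k) \<Rightarrow> 'k" where
  "speed w = cofactor w * root w ^ (d - 1)"

text \<open>The quotient ((z + s E)^d - z^d) / E, expanded so that it makes sense for E = 0.\<close>

definition secant :: "'k \<Rightarrow> 'k \<Rightarrow> 'k \<Rightarrow> 'k" where
  "secant z E s = s * (\<Sum>i<d. z ^ (d - Suc i) * (z + s * E) ^ i)"

text \<open>
  The flow moves \<open>z\<close> with speed \<open>E\<close>. It changes only the conjugate factor with \<open>e = 1\<close>, so that the change of
  the norm compensates the change of \<open>v z\<^sup>d\<close>.
\<close>

definition flow :: "'k \<Rightarrow> (nat \<Rightarrow> 'k) \<Rightarrow> nat \<Rightarrow> 'k" where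
  "flow s w = (\<lambda>i. if i = m + 2 then w i + s * speed w
     else if m + 3 \<le> i \<and> i < m + 3 + d
     then w i + w (m + 1) * root w ^ (d - 1 - (i - (m + 3))) * secant (w (m + 2)) (speed w) s / of_nat d
     else w i)"

lemma d0: "d > 0"
  using d by simp

lemma root_power: "w \<in> W \<Longrightarrow> root w ^ d = w m"
proof -
  assume "w \<in> W"
  then have "w m = (\<Prod>i<m. w i ^ k i)" by (simp add: mem_W)
  also have "\<dots> = (\<Prod>i<m. (w i ^ (k i div d)) ^ d)"
    by (intro prod.cong refl) (simp add: d_dvd flip: power_mult)
  finally show ?thesis by (simp add: root_def prod_power_distrib)
qed

lemma secant_mult: "E * secant z E s = (z + s * E) ^ d - z ^ d"
  unfolding secant_def power_diff_sumr2 by simp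

text \<open>Multiplied by E the identity telescopes. For E = 0 the secant is linear in the
  time.\<close>

lemma secant_add: "secant z E (s + t) = secant z E t + secant (z + t * E) E s"
proof (cases "E = 0")
  case True
  then show ?thesis by (simp add: secant_def algebra_simps)
next
  case False
  have "E * secant z E (s + t) = E * (secant z E t + secant (z + t * E) E s)"
    by (simp add: distrib_left secant_mult algebra_simps)
  then show ?thesis using False by simp
qed

lemma secant_zero: "secant z E 0 = 0"
  by (simp add: secant_def)

lemma root_flow [simp]: "root (flow s w) = root w"
  unfolding root_def by (intro prod.cong refl) (simp add: flow_def)

text \<open>The shift of x_j is chosen so that it contributes to the factor at e the product of e^j
  and a quantity independent of j; the sum of e^j over j < d vanishes unless e = 1.\<close>

lemma lin_flow:
  assumes "e \<in> unity d"
  shows "lin d (root w) (proj m (flow s w)) e = lin d (root w) (proj m w) e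
    + (if e = 1 then w (m + 1) * root w ^ (d - 1) * secant (w (m + 2)) (speed w) s else 0)"
proof -
  let ?G = "secant (w (m + 2)) (speed w) s" and ?y = "root w"
  have "lin d ?y (proj m (flow s w)) e
      = (\<Sum>j<d. (e * ?y) ^ j * proj m w (3 + j) + e ^ j * (w (m + 1) * ?y ^ (d - 1) * ?G / of_nat d))"
    unfolding lin_def
  proof (intro sum.cong refl)
    fix j assume j: "j \<in> {..<d}"
    have "?y ^ j * ?y ^ (d - 1 - j) = ?y ^ (d - 1)" using j by (simp flip: power_add)
    moreover have "proj m (flow s w) (3 + j) = proj m w (3 + j) + w (m + 1) * ?y ^ (d - 1 - j) * ?G / of_nat d"
      using j by (simp add: proj_def flow_def)
    ultimately show "(e * ?y) ^ j * proj m (flow s w) (3 + j)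
        = (e * ?y) ^ j * proj m w (3 + j) + e ^ j * (w (m + 1) * ?y ^ (d - 1) * ?G / of_nat d)"
      by (simp add: distrib_left power_mult_distrib)
  qed
  also have "\<dots> = lin d ?y (proj m w) e + (\<Sum>j<d. e ^ j) * (w (m + 1) * ?y ^ (d - 1) * ?G / of_nat d)"
    unfolding sum.distrib lin_def sum_distrib_right ..
  also have "(\<Sum>j<d. e ^ j) = (if e = 1 then of_nat d else 0)"
    using assms by (simp add: geometric_sum unity_def)
  finally show ?thesis using d0 by simp
qed

text \<open>All factors with e different from 1 stay fixed. Hence the speed is constant along the
  flow, which gives the group law.\<close>

lemma cofactor_flow [simp]: "cofactor (flow s w) = cofactor w"
  unfolding cofactor_def root_flow by (intro prod.cong refl) (simp add: lin_flow)

lemma speed_flow [simp]: "speed (flow s w) = speed w"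
  by (simp add: speed_def)

text \<open>The norm grows by v times \<open>cofactor\<close>, \<open>root w ^ (d - 1)\<close> and
  the secant, that is by v ((z + s E)^d - z^d) with E the speed. This is the change of v
  z^d.\<close>

lemma form_flow:
  assumes w: "w \<in> W"
  shows "form d (proj m (flow s w)) = form d (proj m w)"
proof -
  let ?y = "root w" and ?v = "w (m + 1)" and ?z = "w (m + 2)"
  have split: "prod g (unity d) = g 1 * prod g (unity d - {1})" for g :: "'k \<Rightarrow> 'k"
    by (rule prod.remove) (use d0 in simp, simp add: unity_def)
  have y: "?y ^ d = proj m w 0" "?y ^ d = proj m (flow s w) 0"
    using root_power[OF w] by (simp_all add: proj_def flow_def)
  have "norm_form d (proj m (flow s w)) = lin d ?y (proj m (flow s w)) 1 * cofactor (flow s w)"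
    using norm_form_eq[of d "root w" "proj m (flow s w)", OF d0 y(2)] by (simp only: split cofactor_def root_flow)
  also have "\<dots> = norm_form d (proj m w) + ?v * (speed w * secant ?z (speed w) s)"
    using norm_form_eq[of d "root w" "proj m w", OF d0 y(1)] lin_flow[of 1 w s]
    by (simp add: split cofactor_def[of w, symmetric]) (simp add: unity_def speed_def algebra_simps)
  finally show ?thesis
    by (simp add: form_def secant_mult) (simp add: proj_def flow_def algebra_simps)
qed

text \<open>\<open>disc\<close> is constant along the flow, so the coordinate that holds its inverse
  may stay fixed.\<close>

lemma flow_W: "w \<in> W \<Longrightarrow> flow s w \<in> W"
proof -
  assume w: "w \<in> W"
  have "disc d (proj m (flow s w)) = disc d (proj m w)"
    unfolding disc_def form_flow[OF w] by (simp add: proj_def flow_def)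
  moreover have "(\<Prod>i<m. flow s w i ^ k i) = (\<Prod>i<m. w i ^ k i)"
    by (intro prod.cong refl) (simp add: flow_def)
  moreover have "flow s w \<in> affine_space (m + Suc (d + 3))" "proj m (flow s w) \<in> affine_space (Suc (d + 3))"
    using w by (auto simp: mem_W X_def affine_space_def PiE_def extensional_def proj_def flow_def)
  moreover have "proj m (flow s w) (d + 3) = proj m w (d + 3)" "flow s w m = w m"
    by (simp_all add: proj_def flow_def)
  ultimately show ?thesis using w by (simp add: mem_W X_def)
qed

lemma root_poly: "m \<le> r \<Longrightarrow> root \<in> poly_funs r"
  unfolding root_def[abs_def] by (intro poly_funs_prod poly_funs_power poly_funs.coord) auto

lemma speed_poly: "m + 3 + d \<le> r \<Longrightarrow> speed \<in> poly_funs r"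
  unfolding speed_def[abs_def] cofactor_def lin_def proj_def
  by (intro poly_funs_prod poly_funs_sum poly_funs.mult poly_funs_power poly_funs.const
      poly_funs.coord root_poly) auto

sublocale polynomial_flow "m + Suc (d + 3)" W flow
proof
  show "flow s w \<in> W" if "w \<in> W" for w s using that by (rule flow_W)
  show "flow 0 w = w" for w
    by (simp add: flow_def secant_zero fun_eq_iff)
  show "flow (s + t) w = flow s (flow t w)" for w s t
  proof
    fix i
    have z: "flow t w (m + 2) = w (m + 2) + t * speed w" "flow t w (m + 1) = w (m + 1)"
      by (simp_all add: flow_def)
    show "flow (s + t) w i = flow s (flow t w) i"
      unfolding flow_def[of s "flow t w"] z root_flow speed_flow
      by (auto simp: flow_def secant_add algebra_simps add_divide_distrib)
  qed
  fix i assume i: "i < m + Suc (d + 3)"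
  define n where "n = m + Suc (d + 3)"
  have [intro]: "root \<in> poly_funs (Suc n)" "speed \<in> poly_funs (Suc n)"
    by (auto simp: n_def intro: root_poly speed_poly)
  have "(\<lambda>x. flow (x n) x i) \<in> poly_funs (Suc n)"
  proof -
    have c: "(\<lambda>x. x j) \<in> poly_funs (Suc n)" if "j \<le> n" for j
      using that by (intro poly_funs.coord) simp
    have "(\<lambda>x. secant (x (m + 2)) (speed x) (x n)) \<in> poly_funs (Suc n)"
      unfolding secant_def
      by (intro poly_funs.mult poly_funs_sum poly_funs_power poly_funs.add c) (auto simp: n_def intro: speed_poly)
    then have "(\<lambda>x. x (m + 1) * root x ^ (d - 1 - (i - (m + 3))) * secant (x (m + 2)) (speed x) (x n) * (1 / of_nat d))
        \<in> poly_funs (Suc n)"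
      by (intro poly_funs.mult poly_funs_power poly_funs.const c) (auto simp: n_def intro: root_poly)
    moreover have "(\<lambda>x. x n * speed x) \<in> poly_funs (Suc n)"
      by (intro poly_funs.mult c) (auto simp: n_def intro: speed_poly)
    moreover have "(\<lambda>x. x i) \<in> poly_funs (Suc n)" using i by (intro c) (simp add: n_def)
    ultimately show ?thesis
      unfolding flow_def
      by (cases "i = m + 2"; cases "m + 3 \<le> i \<and> i < m + 3 + d") (auto intro!: poly_funs.add)
  qed
  \<comment> \<open>Storing the time in coordinate n does not disturb \<open>root\<close> and
    \<open>speed\<close>, which depend on earlier coordinates only.\<close>
  moreover have "flow s w i = flow s (w(n := s)) i" for s w
  proof -
    have "root (w(n := s)) = root w" "speed (w(n := s)) = speed w"
      by (rule poly_funs_cong[OF root_poly[of n]] poly_funs_cong[OF speed_poly[of n]]; simp add: n_def)+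
    then show ?thesis using i unfolding flow_def by (auto simp: n_def)
  qed
  ultimately have "\<exists>q\<in>poly_funs (Suc n). \<forall>w\<in>W. \<forall>s. flow s w i = q (w(n := s))"
    by (intro bexI[of _ "\<lambda>x. flow (x n) x i"]) auto
  then show "\<exists>q\<in>poly_funs (Suc (m + Suc (d + 3))). \<forall>w\<in>W. \<forall>s. flow s w i = q (w(m + Suc (d + 3) := s))"
    by (simp only: n_def)
qed

text \<open>The derivative of z along the flow is \<open>speed\<close>, which is 1 at the point
  above \<open>sample 1\<close> with all y_i equal to 1.\<close>

theorem not_rigid_W: "\<not> rigid (m + Suc (d + 3)) W"
proof
  assume rigid: "rigid (m + Suc (d + 3)) W"
  let ?b = "zero_ext W (\<lambda>w. w (m + 2))"
  have b: "?b \<in> reg (m + Suc (d + 3)) W"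
    by (auto simp: reg_def intro!: imageI poly_funs.coord)
  define w where "w i = (if i < m then 1 else point (sample (1 :: 'k)) (i - m))" for i
  have disc: "disc d (sample (1 :: 'k)) = 1" by (rule disc_sample[OF d0])
  have pw: "proj m w = point (sample 1)" by (auto simp: proj_def w_def)
  have X: "proj m w \<in> X" unfolding pw by (rule point_mem) (simp add: disc)
  have "point (sample 1) \<in> affine_space (Suc (d + 3))" using X unfolding pw by (simp add: X_def)
  then have "w \<in> affine_space (m + Suc (d + 3))"
    by (auto simp: affine_space_def PiE_def extensional_def w_def)
  moreover have "(\<Prod>i<m. w i ^ k i) = w m"
    by (simp add: w_def point_def sample_def)
  ultimately have w: "w \<in> W" using X by (simp add: mem_W)
  have "lin d y (proj m w) e = lin d y (sample 1) e" for y e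
    unfolding lin_def pw by (intro sum.cong refl) (simp add: point_def)
  moreover have "root w = 1" by (simp add: root_def w_def)
  ultimately have "speed w = 1"
    by (simp add: speed_def cofactor_def lin_sample[OF d0])
  moreover have "taylor ?b w = [:w (m + 2), speed w:]"
    by (rule taylor_unique) (simp add: flow_W[OF w], simp add: flow_def)
  ultimately have "flow_deriv ?b w = 1" using w by (simp add: flow_deriv_def)
  moreover have "flow_deriv ?b = 0" using rigid lnd_flow_deriv b unfolding rigid_iff by blast
  ultimately show False by (simp add: fun_apply)
qed

end

lemma susp_restrict: "susp n X (restrict p X) m k = susp n X p m k"
  by (auto simp: susp_def)

theorem theorem4p4:
  fixes m :: nat and k :: "nat \<Rightarrow> nat" and d :: nat
  assumes "m \<ge> 1" and "\<And>i. i < m \<Longrightarrow> k i > 0"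
  defines "d \<equiv> Gcd (k ` {..<m})"
  shows "(d = 1 \<longrightarrow>
            (\<forall>n (X :: (nat \<Rightarrow> 'k :: {alg_closed_field, field_char_0}) set) f.
               affine_variety n X \<and> rigid n X \<and>
               f \<in> carrier (coord_algebra n X) \<and> nonconstant_on X f \<longrightarrow>
               rigid (m + n) (susp n X f m k))) \<and>
         (d > 1 \<longrightarrow>
            (\<exists>n (X :: (nat \<Rightarrow> 'k) set) f.
               affine_variety n X \<and> rigid n X \<and>
               f \<in> carrier (coord_algebra n X) \<and> nonconstant_on X f \<and>
               \<not> rigid (m + n) (susp n X f m k)))"
proof (intro conjI impI allI)
  fix n and X :: "(nat \<Rightarrow> 'k) set" and f
  assume d1: "d = 1"
    and "affine_variety n X \<and> rigid n X \<and> f \<in> carrier (coord_algebra n X) \<and> nonconstant_on X f"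
  then obtain p where vX: "affine_variety n X" "rigid n X" and p: "p \<in> poly_funs n" "f = restrict p X"
    and nc: "nonconstant_on X f" by (auto simp: carrier_coord_algebra)
  have "\<exists>x\<in>X. p x \<noteq> 0" using nc by (auto simp: nonconstant_on_def p(2))
  then interpret suspension n m k X p
    using vX p assms by unfold_locales auto
  show "rigid (m + n) (susp n X f m k)"
    unfolding p(2) susp_restrict using rigid_suspension d1 vX by (simp add: d_def)
next
  assume "d > 1"
  then interpret norm_suspension d "TYPE('k)" m k
    by unfold_locales (auto simp: d_def)
  have pt: "point (sample c) \<in> X" if "c \<noteq> 0" for c :: 'k
    using that disc_sample[OF d0, of c] by (intro point_mem) simp
  have pt0: "point (sample c) 0 = c" for c :: 'k
    by (simp add: point_def sample_def)
  have "nonconstant_on X (restrict (\<lambda>x. x 0) X)"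
    unfolding nonconstant_on_def
  proof
    assume "\<exists>c. \<forall>x\<in>X. restrict (\<lambda>x. x 0) X x = c"
    then obtain c where "\<And>x. x \<in> X \<Longrightarrow> x 0 = c" by (metis restrict_apply')
    \<comment> \<open>u takes the values 1 and 2 on X; the second is admissible because 2 is nonzero
      in characteristic zero.\<close>
    from this[OF pt[of 1]] this[OF pt[of 2]] have "(1 :: 'k) = 2" by (simp add: pt0)
    then show False by simp
  qed
  moreover have "restrict (\<lambda>x. x 0) X \<in> carrier (coord_algebra (Suc (d + 3)) X)"
    by (auto simp: carrier_coord_algebra intro!: imageI poly_funs.coord)
  ultimately show "\<exists>n (X :: (nat \<Rightarrow> 'k) set) f. affine_variety n X \<and> rigid n X \<and>
      f \<in> carrier (coord_algebra n X) \<and> nonconstant_on X f \<and> \<not> rigid (m + n) (susp n X f m k)"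
    using affine_variety_X rigid_X not_rigid_W
    by (intro exI[of _ "Suc (d + 3)"] exI[of _ X] exI[of _ "restrict (\<lambda>x. x 0) X"])
      (simp add: W_def susp_restrict)
qed

end
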